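(* Let $H$ be a graph on $k$ vertices whose independence number is $\alpha$. For every $\varepsilon>0$ there exists $C=C(H,\varepsilon)>0$ such that the following holds. If $p=p(n)\geq C n^{-1/\max\{m_2(H),1\}}$ and $G\sim \mathbb{G}(n,p)$, then with high probability \[ Rt(H,G)\geq \frac{n}{2k-\alpha}-\varepsilon n. \]
   Context: $\mathbb{G}(n,p)$ is the binomial random graph on $n$ vertices where each edge is present independently with probability $p$; "with high probability" means with probability tending to $1$ as $n\to\infty$. For a graph $H$ with at least two edges, $m_2(H)=\max\{(e(F)-1)/(v(F)-2) : F\subseteq H,\ v(F)\ge 3\}$; for all other graphs $H$, $m_2(H)=1/2$. An $H$-tiling is a collection of vertex-disjoint copies of $H$ (subgraphs isomorphic to $H$, not necessarily induced); its size is the number of copies. A $2$-colouring of the edges of $G$ assigns to each edge one of the colours red or blue; a copy of $H$ is monochromatic if all its edges have the same colour, and a monochromatic $H$-tiling is one in which all copies are monochromatic of the same colour. For graphs $H$ and $G$, $Rt(H,G)$ is the largest integer $m$ such that in every $2$-colouring of the edges of $G$ there is a monochromatic $H$-tiling of size $m$ in $G$. *)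

theory Defs
  imports "HOL-Probability.Probability" "HOL-Library.Ramsey"
begin

text \<open>A graph is a pair of a vertex set and a set of two-element sets of vertices.
  Predicate \<^term>\<open>indep\<close> is the one from \<^theory>\<open>HOL-Library.Ramsey\<close>.\<close>

type_synonym 'a ugraph = "'a set \<times> 'a set set"

abbreviation verts :: "'a ugraph \<Rightarrow> 'a set" where
  "verts \<equiv> fst"

abbreviation edges :: "'a ugraph \<Rightarrow> 'a set set" where
  "edges \<equiv> snd"

definition fin_graph :: "'a ugraph \<Rightarrow> bool" where
  "fin_graph G \<longleftrightarrow> finite (verts G) \<and> edges G \<subseteq> nsets (verts G) 2"

definition subgraph :: "'a ugraph \<Rightarrow> 'a ugraph \<Rightarrow> bool" where
  "subgraph F G \<longleftrightarrow> fin_graph F \<and> verts F \<subseteq> verts G \<and> edges F \<subseteq> edges G"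

definition graph_iso :: "'a ugraph \<Rightarrow> 'b ugraph \<Rightarrow> bool" where
  "graph_iso G H \<longleftrightarrow>
     (\<exists>f. bij_betw f (verts G) (verts H) \<and>
          (\<forall>u\<in>verts G. \<forall>v\<in>verts G. {u, v} \<in> edges G \<longleftrightarrow> {f u, f v} \<in> edges H))"

definition independence_number :: "'a ugraph \<Rightarrow> nat" where
  "independence_number G = Max {card I | I. I \<subseteq> verts G \<and> indep I (edges G)}"

definition m2 :: "'a ugraph \<Rightarrow> real" where
  "m2 H =
     (if card (edges H) \<ge> 2
      then Max {(real (card (edges F)) - 1) / (real (card (verts F)) - 2) | F.
                  subgraph F H \<and> card (verts F) \<ge> 3}
      else 1 / 2)"

definition is_copy :: "'a ugraph \<Rightarrow> 'b ugraph \<Rightarrow> 'b ugraph \<Rightarrow> bool" where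
  "is_copy H G F \<longleftrightarrow> subgraph F G \<and> graph_iso H F"

definition is_tiling :: "'a ugraph \<Rightarrow> 'b ugraph \<Rightarrow> 'b ugraph set \<Rightarrow> bool" where
  "is_tiling H G T \<longleftrightarrow>
     finite T \<and> (\<forall>F\<in>T. is_copy H G F) \<and>
     (\<forall>F\<in>T. \<forall>F'\<in>T. F \<noteq> F' \<longrightarrow> verts F \<inter> verts F' = {})"

datatype colour = Red | Blue

text \<open>Colourings are total functions on vertex sets; only their values on edges matter.\<close>

definition mono_tiling ::
  "'a ugraph \<Rightarrow> 'b ugraph \<Rightarrow> ('b set \<Rightarrow> colour) \<Rightarrow> 'b ugraph set \<Rightarrow> bool" where
  "mono_tiling H G c T \<longleftrightarrow>
     is_tiling H G T \<and> (\<exists>col. \<forall>F\<in>T. \<forall>e\<in>edges F. c e = col)"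

text \<open>For a finite graph \<open>G\<close> the set below contains 0 and is finite.\<close>

definition Rt :: "'a ugraph \<Rightarrow> 'b ugraph \<Rightarrow> nat" where
  "Rt H G = Max {m. \<forall>c. \<exists>T. mono_tiling H G c T \<and> card T = m}"

definition binomial_random_graph :: "nat \<Rightarrow> real \<Rightarrow> nat ugraph pmf" where
  "binomial_random_graph n p =
     map_pmf (\<lambda>present. ({..<n}, {e \<in> nsets {..<n} 2. present e}))
       (Pi_pmf (nsets {..<n} 2) False (\<lambda>_. bernoulli_pmf p))"

end

theory Submission
  imports Defs
begin

text \<open>
  Colour the edges of \<open>G\<close>. A \<^emph>\<open>bowtie set\<close> is a vertex set \<open>Z\<close> which carries both a red and a blue
  \<open>H\<close>-tiling of size close to \<open>|Z| / (2k - \<alpha>)\<close>. Take a bowtie set of maximum size; the rest \<open>W\<close>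
  contains no nonempty bowtie set. If neither colour tiles almost all of \<open>W\<close>, then deleting greedy
  tilings leaves linear sets \<open>X\<close> without blue and \<open>Y\<close> without red copies of \<open>H\<close>. Cut \<open>X\<close> and \<open>Y\<close> into
  many clusters. For two injections of \<open>V(H)\<close> into the clusters that together use at most
  \<open>2k - \<alpha>\<close> of them, copies along the first (red) and along the second (blue) cannot both
  tile almost everything, so after shrinking the clusters one of them has no copies at all.
  A typical \<open>G\<close> provides a colouring of the pairs of clusters in which every monochromatic
  injection is realised by a copy of the same colour in \<open>G\<close>. By Ramsey's theorem it contains a red
  clique on the \<open>X\<close>-side and a blue clique on the \<open>Y\<close>-side with all pairs in between of one colour;
  sending a largest independent set of \<open>H\<close> to one side and the rest to the other gives two injections
  that contradict the shrinking (this is the argument of Burr, Erdos and Spencer for complete graphs).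

  The typical property of \<open>G\<close> follows from hypergraph containers: otherwise the coloured edges of \<open>G\<close>
  form an independent set in the hypergraph of coloured copies along some family of injections which
  every colouring of the pairs of clusters hits. Any container of few such copies misses quadratically
  many pairs of vertices, since a random choice of one vertex per cluster would otherwise produce a
  colouring not hit. A union bound over the fingerprints of the containers finishes the proof.

  Containers are obtained by induction on the uniformity: scan the vertices and pick those of the
  independent set \<open>I\<close> which have large degree, collecting their links in a hypergraph of lower
  uniformity, and discard edges through sets whose link degree has become too large. Either the
  links become dense, and the induction hypothesis applies to them, or all vertices of \<open>I\<close> that were
  not picked have small degree at the end, whereas many other vertices have large degree.
\<close>

section \<open>Hypergraph containers\<close>

text \<open>For \<open>L = {}\<close> this is the total weight, so one notion covers both the size
  of a hypergraph and its codegrees. With \<open>V\<close> as an argument, the same \<open>w\<close>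
  can be restricted to smaller vertex sets without being changed.\<close>

definition wdeg :: "'v set \<Rightarrow> ('v set \<Rightarrow> real) \<Rightarrow> 'v set \<Rightarrow> real" where
  "wdeg V w L = (\<Sum>e | e \<subseteq> V \<and> L \<subseteq> e. w e)"

definition whyp :: "'v set \<Rightarrow> nat \<Rightarrow> ('v set \<Rightarrow> real) \<Rightarrow> bool" where
  "whyp V r w \<longleftrightarrow> finite V \<and> (\<forall>e. e \<subseteq> V \<longrightarrow> 0 \<le> w e \<and> (w e \<noteq> 0 \<longrightarrow> card e = r))"

section \<open>Degrees in weighted hypergraphs\<close>

lemma wdeg_empty: "wdeg V w {} = sum w (Pow V)"
  by (simp add: wdeg_def Pow_def)

lemma wdeg_mono:
  assumes "\<And>e. e \<subseteq> V \<Longrightarrow> w e \<le> w' e"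
  shows "wdeg V w L \<le> wdeg V w' L"
  unfolding wdeg_def by (rule sum_mono) (use assms in auto)

lemma wdeg_nonneg:
  assumes "\<And>e. e \<subseteq> V \<Longrightarrow> 0 \<le> w e"
  shows "0 \<le> wdeg V w L"
  unfolding wdeg_def by (rule sum_nonneg) (use assms in auto)

lemma wdeg_antimono:
  assumes "finite V" "\<And>e. e \<subseteq> V \<Longrightarrow> 0 \<le> w e" "U \<subseteq> V" "L' \<subseteq> L"
  shows "wdeg U w L \<le> wdeg V w L'"
  unfolding wdeg_def by (rule sum_mono2) (use assms in auto)

lemma wdeg_add: "wdeg V (\<lambda>e. w e + w' e) L = wdeg V w L + wdeg V w' L"
  unfolding wdeg_def by (rule sum.distrib)

text \<open>The weight on the left is the link of \<open>x\<close>. Inserting \<open>x\<close> is a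
  bijection from the sets without \<open>x\<close> onto those with it, so degrees in the link are
  codegrees in \<open>a\<close> with \<open>x\<close> added; sets that contain \<open>x\<close>
  carry no weight in the link.\<close>

lemma wdeg_link:
  assumes "finite V" "x \<in> V"
  shows "wdeg V (\<lambda>f. if x \<notin> f then a (insert x f) else 0) L =
         (if x \<in> L then 0 else wdeg V a (insert x L))"
proof (cases "x \<in> L")
  case True
  then show ?thesis
    unfolding wdeg_def by (auto intro!: sum.neutral)
next
  case False
  have "wdeg V (\<lambda>f. if x \<notin> f then a (insert x f) else 0) L
      = (\<Sum>f | f \<subseteq> V \<and> L \<subseteq> f \<and> x \<notin> f. a (insert x f))"
    unfolding wdeg_def
    by (rule sum.mono_neutral_cong_right) (use assms in auto)
  also have "\<dots> = (\<Sum>e | e \<subseteq> V \<and> insert x L \<subseteq> e. a e)"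
    by (rule sum.reindex_bij_witness[where i="\<lambda>e. e - {x}" and j="insert x"])
       (use False assms in \<open>auto simp: insert_absorb\<close>)
  finally show ?thesis using False by (simp add: wdeg_def)
qed

text \<open>Double counting of the pairs of an edge and a family member inside it.\<close>

lemma sum_wdeg:
  assumes "finite V" "\<L> \<subseteq> Pow V"
  shows "(\<Sum>L\<in>\<L>. wdeg V w L) = (\<Sum>e\<in>Pow V. w e * card {L\<in>\<L>. L \<subseteq> e})"
proof -
  have fin: "finite \<L>" using assms finite_subset by blast
  have "(\<Sum>L\<in>\<L>. wdeg V w L) = (\<Sum>L\<in>\<L>. \<Sum>e\<in>Pow V. if L \<subseteq> e then w e else 0)"
  proof (rule sum.cong)
    fix L
    show "wdeg V w L = (\<Sum>e\<in>Pow V. if L \<subseteq> e then w e else 0)"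
      unfolding wdeg_def using assms(1)
      by (subst sum.inter_filter[symmetric]) (auto intro!: sum.cong)
  qed simp
  also have "\<dots> = (\<Sum>e\<in>Pow V. \<Sum>L\<in>\<L>. if L \<subseteq> e then w e else 0)"
    by (rule sum.swap)
  also have "\<dots> = (\<Sum>e\<in>Pow V. w e * card {L\<in>\<L>. L \<subseteq> e})"
    using fin by (intro sum.cong) (auto simp: sum.If_cases Int_def)
  finally show ?thesis .
qed

text \<open>Positive uniformity gives every edge of nonzero weight at least one vertex. The factor
  \<open>Suc r\<close> that degree counting would yield is given away.\<close>

lemma wdeg_empty_le_sum:
  assumes "whyp V (Suc r) w"
  shows "wdeg V w {} \<le> (\<Sum>x\<in>V. wdeg V w {x})"
proof -
  have fin: "finite V" using assms by (simp add: whyp_def)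
  have "(\<Sum>x\<in>V. wdeg V w {x}) = (\<Sum>L\<in>(\<lambda>x. {x}) ` V. wdeg V w L)"
    by (subst sum.reindex) (auto simp: inj_on_def)
  also have "\<dots> = (\<Sum>e\<in>Pow V. w e * card {L\<in>(\<lambda>x. {x}) ` V. L \<subseteq> e})"
    by (rule sum_wdeg) (use fin in auto)
  also have "\<dots> \<ge> (\<Sum>e\<in>Pow V. w e)"
  proof (rule sum_mono)
    fix e assume e: "e \<in> Pow V"
    show "w e \<le> w e * card {L\<in>(\<lambda>x. {x}) ` V. L \<subseteq> e}"
    proof (cases "w e = 0")
      case False
      then have "card e = Suc r" "w e \<ge> 0" using assms e by (auto simp: whyp_def)
      then obtain x where "x \<in> e" by fastforce
      then have "{x} \<in> {L\<in>(\<lambda>x. {x}) ` V. L \<subseteq> e}" using e by auto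
      moreover have "finite {L\<in>(\<lambda>x. {x}) ` V. L \<subseteq> e}" using fin by simp
      ultimately have "card {L\<in>(\<lambda>x. {x}) ` V. L \<subseteq> e} > 0" unfolding card_gt_0_iff by blast
      then have "card {L\<in>(\<lambda>x. {x}) ` V. L \<subseteq> e} \<ge> 1" by linarith
      then show ?thesis using \<open>w e \<ge> 0\<close>
        by (metis mult.right_neutral mult_left_mono of_nat_1 of_nat_le_iff)
    qed simp
  qed
  finally show ?thesis by (simp add: wdeg_def Pow_def)
qed

section \<open>The scan and the links it collects\<close>

definition saturated :: "'v set \<Rightarrow> (nat \<Rightarrow> real) \<Rightarrow> ('v set \<Rightarrow> real) \<Rightarrow> 'v set \<Rightarrow> bool" where
  "saturated V s w' L \<longleftrightarrow> L \<noteq> {} \<and> s (card L) \<le> wdeg V w' L"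

text \<open>Here \<open>w'\<close> is the sum of the links collected so far. Only edges without a
  saturated subset may feed further links, which keeps the codegrees of \<open>w'\<close>
  bounded.\<close>

definition alive ::
  "'v set \<Rightarrow> (nat \<Rightarrow> real) \<Rightarrow> ('v set \<Rightarrow> real) \<Rightarrow> ('v set \<Rightarrow> real) \<Rightarrow> 'v set \<Rightarrow> real" where
  "alive V s w w' e = (if \<exists>L\<subseteq>e. saturated V s w' L then 0 else w e)"

definition add_link :: "('v set \<Rightarrow> real) \<Rightarrow> 'v \<Rightarrow> ('v set \<Rightarrow> real) \<Rightarrow> 'v set \<Rightarrow> real" where
  "add_link a x w' f = w' f + (if x \<notin> f then a (insert x f) else 0)"

text \<open>The first condition freezes the scan as soon as the links weigh \<open>\<theta>\<close>
  in total; together with the gain of at least \<open>b\<close> per pick it bounds the number of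
  picks.\<close>

definition eligible :: "'v set \<Rightarrow> (nat \<Rightarrow> real) \<Rightarrow> real \<Rightarrow> real \<Rightarrow> ('v set \<Rightarrow> real) \<Rightarrow>
    ('v set \<Rightarrow> real) \<Rightarrow> 'v \<Rightarrow> bool" where
  "eligible V s \<theta> b w w' x \<longleftrightarrow> wdeg V w' {} < \<theta> \<and> b \<le> wdeg V (alive V s w w') {x}"

text \<open>The scan reads the vertices in a fixed order, so that its result can be recomputed from
  the set of picked vertices alone.\<close>

fun scan :: "'v set \<Rightarrow> (nat \<Rightarrow> real) \<Rightarrow> real \<Rightarrow> real \<Rightarrow> ('v set \<Rightarrow> real) \<Rightarrow> 'v set \<Rightarrow> 'v list \<Rightarrow>
    ('v set \<Rightarrow> real) \<Rightarrow> ('v set \<Rightarrow> real)" where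
  "scan V s \<theta> b w I [] w' = w'"
| "scan V s \<theta> b w I (x # xs) w' =
    scan V s \<theta> b w I xs
      (if x \<in> I \<and> eligible V s \<theta> b w w' x then add_link (alive V s w w') x w' else w')"

fun picked :: "'v set \<Rightarrow> (nat \<Rightarrow> real) \<Rightarrow> real \<Rightarrow> real \<Rightarrow> ('v set \<Rightarrow> real) \<Rightarrow> 'v set \<Rightarrow> 'v list \<Rightarrow>
    ('v set \<Rightarrow> real) \<Rightarrow> 'v set" where
  "picked V s \<theta> b w I [] w' = {}"
| "picked V s \<theta> b w I (x # xs) w' =
    (if x \<in> I \<and> eligible V s \<theta> b w w' x
     then insert x (picked V s \<theta> b w I xs (add_link (alive V s w w') x w'))
     else picked V s \<theta> b w I xs w')"

lemma picked_subset: "picked V s \<theta> b w I xs w' \<subseteq> I \<inter> set xs"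
  by (induction xs arbitrary: w') auto

text \<open>This makes fingerprints decodable. The scan consults its set only when it reads an
  eligible vertex, and there the picked set gives the same answer as \<open>I\<close>.\<close>

lemma scan_picked:
  assumes "picked V s \<theta> b w I xs w' \<subseteq> S" "S \<subseteq> I"
  shows "scan V s \<theta> b w S xs w' = scan V s \<theta> b w I xs w'"
  using assms by (induction xs arbitrary: w') (auto split: if_splits)

context
  fixes V :: "'v set" and r :: nat and w :: "'v set \<Rightarrow> real" and s :: "nat \<Rightarrow> real"
    and \<theta> b :: real and I :: "'v set"
  assumes hyp: "whyp V (Suc (Suc r)) w"
begin

private abbreviation "al \<equiv> alive V s w"
private abbreviation "fin \<equiv> scan V s \<theta> b w I"
private abbreviation "pick \<equiv> picked V s \<theta> b w I"

lemma fin_V: "finite V"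
  using hyp by (simp add: whyp_def)

lemma w_nonneg: "e \<subseteq> V \<Longrightarrow> 0 \<le> w e"
  using hyp by (simp add: whyp_def)

lemma alive_nonneg: "e \<subseteq> V \<Longrightarrow> 0 \<le> al w' e"
  using w_nonneg by (simp add: alive_def)

lemma alive_le: "e \<subseteq> V \<Longrightarrow> al w' e \<le> w e"
  using w_nonneg by (simp add: alive_def)

lemma alive_antimono:
  assumes "\<And>e. e \<subseteq> V \<Longrightarrow> w1 e \<le> w2 e" "e \<subseteq> V"
  shows "al w2 e \<le> al w1 e"
proof -
  have "saturated V s w2 L" if "saturated V s w1 L" for L
    using that wdeg_mono[of V w1 w2 L] assms(1) unfolding saturated_def by (meson order_trans)
  then have "(\<exists>L\<subseteq>e. saturated V s w1 L) \<Longrightarrow> (\<exists>L\<subseteq>e. saturated V s w2 L)"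
    by blast
  then show ?thesis
    using w_nonneg[OF assms(2)] unfolding alive_def by (simp split: if_split)
qed

lemma add_link_ge: "x \<in> V \<Longrightarrow> f \<subseteq> V \<Longrightarrow> w' f \<le> add_link (al w') x w' f"
  by (simp add: add_link_def alive_nonneg)

lemma wdeg_add_link:
  "x \<in> V \<Longrightarrow> wdeg V (add_link a x w') L =
    wdeg V w' L + (if x \<in> L then 0 else wdeg V a (insert x L))"
  unfolding add_link_def by (simp only: wdeg_add wdeg_link[OF fin_V])

lemma scan_ge:
  assumes "set xs \<subseteq> V" "f \<subseteq> V"
  shows "w' f \<le> fin xs w' f"
  using assms
proof (induction xs arbitrary: w')
  case (Cons x xs)
  have "add_link (al w') x w' f \<le> fin xs (add_link (al w') x w') f"
    using Cons by auto
  then show ?case using Cons add_link_ge[of x f w'] by fastforce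
qed simp

lemma scan_whyp:
  assumes "set xs \<subseteq> V" "whyp V (Suc r) w'"
  shows "whyp V (Suc r) (fin xs w')"
  using assms
proof (induction xs arbitrary: w')
  case (Cons x xs)
  have "whyp V (Suc r) (add_link (al w') x w')"
    unfolding whyp_def
  proof (intro conjI allI impI)
    fix f assume f: "f \<subseteq> V"
    show "0 \<le> add_link (al w') x w' f"
      using add_link_ge[of x f w'] Cons.prems f
      by (meson list.set_intros(1) order_trans subsetD whyp_def)
    assume "add_link (al w') x w' f \<noteq> 0"
    then have "w' f \<noteq> 0 \<or> x \<notin> f \<and> al w' (insert x f) \<noteq> 0"
      by (simp add: add_link_def split: if_splits)
    then consider "w' f \<noteq> 0" | "x \<notin> f" "w (insert x f) \<noteq> 0"
      unfolding alive_def by metis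
    then show "card f = Suc r"
    proof cases
      case 1
      then show ?thesis using Cons f by (simp add: whyp_def)
    next
      case 2
      then have "card (insert x f) = Suc (Suc r)"
        using hyp f Cons by (auto simp: whyp_def)
      moreover have "finite f" using f fin_V finite_subset by blast
      ultimately show ?thesis using 2 by simp
    qed
  qed (rule fin_V)
  then show ?case using Cons by simp
qed simp

text \<open>If \<open>x \<in> I\<close> and \<open>f \<subseteq> I\<close>, then
  \<open>insert x f \<subseteq> I\<close> carries no weight. So \<open>I\<close> stays independent
  in the links, whose uniformity is lower; this feeds the induction in
  \<open>remove_dense_part\<close>.\<close>

lemma scan_indep:
  assumes "\<And>e. e \<subseteq> I \<Longrightarrow> w e = 0" "\<And>f. f \<subseteq> I \<Longrightarrow> w' f = 0" "f \<subseteq> I"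
  shows "fin xs w' f = 0"
  using assms(2,3)
proof (induction xs arbitrary: w' f)
  case (Cons x xs)
  have "x \<in> I \<Longrightarrow> add_link (al w') x w' f = 0" if "f \<subseteq> I" for f
    using that Cons.prems(1)[of f] assms(1)[of "insert x f"] by (simp add: add_link_def alive_def)
  then show ?case using Cons by simp
qed simp

text \<open>Once \<open>L\<close> is saturated, no alive edge contains it and its degree is frozen.
  Before that its degree is below \<open>s (card L)\<close>, and a single link adds at most the
  codegree of \<open>insert x L\<close> in \<open>w\<close>, again at most
  \<open>s (card L)\<close>; hence the factor 2.\<close>

lemma scan_wdeg_le:
  assumes s: "\<And>L. L \<subseteq> V \<Longrightarrow> L \<noteq> {} \<Longrightarrow> wdeg V w L \<le> s (card L - 1)"
    and "set xs \<subseteq> V" and "\<And>L. L \<subseteq> V \<Longrightarrow> L \<noteq> {} \<Longrightarrow> wdeg V w' L \<le> 2 * s (card L)"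
    and L: "L \<subseteq> V" "L \<noteq> {}"
  shows "wdeg V (fin xs w') L \<le> 2 * s (card L)"
  using assms(2,3) L
proof (induction xs arbitrary: w' L)
  case (Cons x xs)
  have "wdeg V (add_link (al w') x w') L \<le> 2 * s (card L)" if L: "L \<subseteq> V" "L \<noteq> {}" for L
  proof (cases "x \<in> L \<or> saturated V s w' L")
    case True
    have "wdeg V (al w') (insert x L) = 0" if "saturated V s w' L"
      unfolding wdeg_def by (rule sum.neutral) (use that in \<open>auto simp: alive_def\<close>)
    moreover have "wdeg V w' L \<le> 2 * s (card L)" using Cons.prems(2) L by blast
    ultimately show ?thesis
      using True Cons.prems(1) by (auto simp: wdeg_add_link)
  next
    case False
    then have "wdeg V w' L \<le> s (card L)" using L by (simp add: saturated_def)
    moreover have "wdeg V (al w') (insert x L) \<le> wdeg V w (insert x L)"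
      by (rule wdeg_mono) (rule alive_le)
    moreover have "wdeg V w (insert x L) \<le> s (card L)"
      using s[of "insert x L"] L Cons.prems False finite_subset[OF L(1) fin_V] by simp
    ultimately show ?thesis using False Cons.prems by (simp add: wdeg_add_link)
  qed
  then show ?case using Cons by simp
qed simp

text \<open>Each pick adds at least \<open>b\<close> to the total link weight and picking stops at
  \<open>\<theta>\<close>. The extra \<open>b\<close> pays for the last pick, which may overshoot;
  the term \<open>wdeg V w' {}\<close> lets the induction start from any intermediate state.\<close>

lemma picked_card:
  assumes "set xs \<subseteq> V" "wdeg V w' {} < \<theta>" "0 \<le> b"
  shows "b * card (pick xs w') + wdeg V w' {} \<le> \<theta> + b"
  using assms
proof (induction xs arbitrary: w')
  case (Cons x xs)
  show ?case
  proof (cases "x \<in> I \<and> eligible V s \<theta> b w w' x")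
    case True
    let ?u = "add_link (al w') x w'"
    have u: "wdeg V ?u {} \<ge> wdeg V w' {} + b"
      using True Cons.prems by (auto simp: wdeg_add_link eligible_def)
    have c: "real (card (insert x (pick xs ?u))) \<le> card (pick xs ?u) + 1"
      using finite_subset[OF picked_subset[of V s \<theta> b w I xs ?u]] by (simp add: card_insert_if)
    have "b * card (pick xs ?u) + (wdeg V w' {} + b) \<le> \<theta> + b"
    proof (cases "wdeg V ?u {} < \<theta>")
      case True
      then show ?thesis using Cons.IH[of ?u] Cons.prems u by auto
    next
      case False
      have "picked V s \<theta> b w I xs v = {}" if "\<not> wdeg V v {} < \<theta>" for v
        using that by (induction xs) (auto simp: eligible_def)
      then show ?thesis using False Cons.prems by simp
    qed
    then have "b * (card (pick xs ?u) + 1) + wdeg V w' {} \<le> \<theta> + b"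
      by (simp add: algebra_simps)
    then show ?thesis
      using True mult_left_mono[OF c \<open>0 \<le> b\<close>] by simp
  next
    case False
    then show ?thesis using Cons by auto
  qed
qed simp

text \<open>A final total below \<open>\<theta>\<close> was below \<open>\<theta>\<close> at every
  moment, so a vertex of \<open>I\<close> can have been passed over only for its small alive degree,
  and alive degrees never grow afterwards.\<close>

lemma scan_unpicked:
  assumes "set xs \<subseteq> V" "x \<in> set xs" "x \<in> I" "x \<notin> pick xs w'" "wdeg V (fin xs w') {} < \<theta>"
  shows "wdeg V (al (fin xs w')) {x} < b"
  using assms
proof (induction xs arbitrary: w')
  case (Cons y xs)
  show ?case
  proof (cases "x = y")
    case True
    have w': "w' e \<le> fin xs w' e" if "e \<subseteq> V" for e
      using scan_ge that Cons.prems by simp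
    have ne: "\<not> eligible V s \<theta> b w w' x" using True Cons.prems by (auto split: if_splits)
    then have "wdeg V (fin xs w') {} < \<theta>" using True Cons.prems by simp
    then have "wdeg V w' {} < \<theta>" using wdeg_mono[of V w' "fin xs w'" "{}"] w' by auto
    then have "wdeg V (al w') {x} < b" using ne by (simp add: eligible_def)
    moreover have "wdeg V (al (fin xs w')) {x} \<le> wdeg V (al w') {x}"
      by (rule wdeg_mono) (rule alive_antimono[OF w'])
    ultimately show ?thesis using True ne by simp
  next
    case False
    then show ?thesis using Cons by (auto split: if_splits)
  qed
qed simp

text \<open>When \<open>x\<close> was picked, its whole alive degree was added to the link weight,
  and its final alive degree is no larger. So picked vertices carry little alive weight whenever the
  links are light.\<close>

lemma scan_picked_wdeg:
  assumes "set xs \<subseteq> V"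
  shows "(\<Sum>x\<in>pick xs w'. wdeg V (al (fin xs w')) {x}) + wdeg V w' {} \<le> wdeg V (fin xs w') {}"
  using assms
proof (induction xs arbitrary: w')
  case (Cons x xs)
  show ?case
  proof (cases "x \<in> I \<and> eligible V s \<theta> b w w' x")
    case True
    let ?u = "add_link (al w') x w'"
    let ?f = "\<lambda>x. wdeg V (al (fin xs ?u)) {x}"
    have f0: "?f y \<ge> 0" for y by (rule wdeg_nonneg) (rule alive_nonneg)
    have fp: "finite (pick xs ?u)"
      by (rule finite_subset[OF picked_subset]) simp
    have "(\<Sum>x\<in>insert x (pick xs ?u). ?f x) \<le> ?f x + (\<Sum>x\<in>pick xs ?u. ?f x)"
      using fp f0 by (cases "x \<in> pick xs ?u") (auto simp: insert_absorb)
    moreover have "?f x \<le> wdeg V (al w') {x}"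
    proof (intro wdeg_mono alive_antimono)
      fix e assume "e \<subseteq> V"
      then show "w' e \<le> fin xs ?u e"
        using add_link_ge[of x e w'] scan_ge[of xs e ?u] Cons.prems by auto
    qed auto
    moreover have "wdeg V ?u {} = wdeg V w' {} + wdeg V (al w') {x}"
      using Cons.prems by (simp add: wdeg_add_link)
    ultimately show ?thesis using True Cons.IH[of ?u] Cons.prems by simp
  next
    case False
    then have "pick (x # xs) w' = pick xs w'" "fin (x # xs) w' = fin xs w'"
      by (simp_all only: picked.simps scan.simps if_False)
    then show ?thesis using Cons.IH[of w'] Cons.prems by simp
  qed
qed simp

text \<open>Charge each discarded edge to a saturated set \<open>L\<close> inside it. By saturation
  \<open>\<tau>\<close> times the codegree of \<open>L\<close> in \<open>w\<close> is at most its
  degree in \<open>w'\<close>, and an edge of \<open>w'\<close> has only \<open>2 ^ Suc r\<close>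
  subsets through which it can be counted.\<close>

lemma alive_loss:
  assumes w': "whyp V (Suc r) w'" and \<tau>: "0 < \<tau>"
    and s: "\<And>L. L \<subseteq> V \<Longrightarrow> L \<noteq> {} \<Longrightarrow> \<tau> * wdeg V w L \<le> s (card L)"
  shows "\<tau> * (wdeg V w {} - wdeg V (al w') {}) \<le> 2 ^ Suc r * wdeg V w' {}"
proof -
  let ?S = "{L\<in>Pow V. saturated V s w' L}"
  have finS: "finite ?S" using fin_V by simp
  have "wdeg V w {} - wdeg V (al w') {} = (\<Sum>e\<in>Pow V. w e - al w' e)"
    by (simp only: wdeg_empty sum_subtractf)
  also have "\<dots> \<le> (\<Sum>e\<in>Pow V. w e * card {L\<in>?S. L \<subseteq> e})"
  proof (rule sum_mono)
    fix e assume e: "e \<in> Pow V"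
    show "w e - al w' e \<le> w e * card {L\<in>?S. L \<subseteq> e}"
    proof (cases "\<exists>L\<subseteq>e. saturated V s w' L")
      case True
      then obtain L where "L \<in> {L\<in>?S. L \<subseteq> e}" using e by blast
      moreover have "finite {L\<in>?S. L \<subseteq> e}" using finS by (rule rev_finite_subset) blast
      ultimately have "card {L\<in>?S. L \<subseteq> e} > 0" unfolding card_gt_0_iff by blast
      then have "1 \<le> real (card {L\<in>?S. L \<subseteq> e})" by linarith
      then have "w e * 1 \<le> w e * card {L\<in>?S. L \<subseteq> e}"
        using w_nonneg e by (intro mult_left_mono) auto
      moreover have "0 \<le> al w' e" using alive_nonneg e by blast
      ultimately show ?thesis by linarith
    next
      case False
      then have "al w' e = w e" by (simp only: alive_def if_False)
      moreover have "0 \<le> w e" using w_nonneg e by blast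
      ultimately show ?thesis by (metis diff_self mult_nonneg_nonneg of_nat_0_le_iff)
    qed
  qed
  also have "\<dots> = (\<Sum>L\<in>?S. wdeg V w L)"
    by (rule sum_wdeg[symmetric]) (use fin_V in auto)
  finally have "\<tau> * (wdeg V w {} - wdeg V (al w') {}) \<le> \<tau> * (\<Sum>L\<in>?S. wdeg V w L)"
    using \<tau> by simp
  also have "\<dots> \<le> (\<Sum>L\<in>?S. wdeg V w' L)"
    unfolding sum_distrib_left
  proof (rule sum_mono)
    fix L assume "L \<in> ?S"
    then show "\<tau> * wdeg V w L \<le> wdeg V w' L"
      using s[of L] by (auto simp: saturated_def)
  qed
  also have "\<dots> \<le> (\<Sum>L\<in>Pow V. wdeg V w' L)"
    using fin_V w' by (intro sum_mono2) (auto intro!: wdeg_nonneg simp: whyp_def)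
  also have "\<dots> = (\<Sum>e\<in>Pow V. w' e * card {L\<in>Pow V. L \<subseteq> e})"
    by (rule sum_wdeg) (use fin_V in auto)
  also have "\<dots> = (\<Sum>e\<in>Pow V. w' e * 2 ^ Suc r)"
  proof (rule sum.cong)
    fix e assume e: "e \<in> Pow V"
    have "{L\<in>Pow V. L \<subseteq> e} = Pow e" using e by auto
    moreover have "finite e" using e fin_V finite_subset by blast
    ultimately show "w' e * card {L\<in>Pow V. L \<subseteq> e} = w' e * 2 ^ Suc r"
      using w' e by (cases "w' e = 0") (auto simp: whyp_def card_Pow)
  qed simp
  also have "\<dots> = 2 ^ Suc r * wdeg V w' {}"
    by (simp only: wdeg_empty sum_distrib_right[symmetric] mult.commute)
  finally show ?thesis .
qed

end

section \<open>One round of the container procedure\<close>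

definition bounded_codegrees ::
  "'v set \<Rightarrow> ('v set \<Rightarrow> real) \<Rightarrow> real \<Rightarrow> real \<Rightarrow> real \<Rightarrow> bool" where
  "bounded_codegrees V w K \<tau> D \<longleftrightarrow>
     (\<forall>L\<subseteq>V. L \<noteq> {} \<longrightarrow> wdeg V w L \<le> K * \<tau> ^ (card L - 1) * D)"

text \<open>Every scan contributes one entry. The length is fixed so that a decoder can cut the list
  into blocks.\<close>

definition fingerprints :: "'v set \<Rightarrow> nat \<Rightarrow> real \<Rightarrow> 'v set list \<Rightarrow> bool" where
  "fingerprints I l m Ss \<longleftrightarrow> length Ss = l \<and> (\<forall>S\<in>set Ss. S \<subseteq> I \<and> real (card S) \<le> m)"

text \<open>Base case without any scan: with singleton edges, a vertex of positive degree cannot lie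
  in the independent set, and density together with the degree bound \<open>K * D\<close> forces
  many such vertices.\<close>

lemma remove_dense_part_uniform1:
  assumes hyp: "whyp V 1 w" and D: "0 < D" and K: "0 < K"
    and cod: "bounded_codegrees V w K \<tau> D" and dense: "\<epsilon> * v * D \<le> wdeg V w {}"
  shows "\<epsilon> / K * v \<le> card {x\<in>V. wdeg V w {x} > 0}"
    and "\<lbrakk>\<forall>e\<subseteq>I. w e = 0\<rbrakk> \<Longrightarrow> {x\<in>V. wdeg V w {x} > 0} \<inter> I = {}"
proof -
  let ?B = "{x\<in>V. wdeg V w {x} > 0}"
  have fin: "finite V" and nn: "\<And>e. e \<subseteq> V \<Longrightarrow> 0 \<le> w e"
    using hyp by (auto simp: whyp_def)
  have "\<epsilon> * v * D \<le> (\<Sum>x\<in>V. wdeg V w {x})"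
    using dense wdeg_empty_le_sum[of V 0 w] hyp by simp
  also have "\<dots> = (\<Sum>x\<in>?B. wdeg V w {x})"
  proof (rule sum.mono_neutral_right)
    show "\<forall>x\<in>V - ?B. wdeg V w {x} = 0"
    proof
      fix x assume "x \<in> V - ?B"
      then have "wdeg V w {x} \<le> 0" by (simp add: not_less)
      moreover have "0 \<le> wdeg V w {x}" by (rule wdeg_nonneg) (rule nn)
      ultimately show "wdeg V w {x} = 0" by simp
    qed
  qed (use fin in auto)
  also have "\<dots> \<le> (\<Sum>x\<in>?B. K * D)"
  proof (rule sum_mono)
    fix x assume "x \<in> ?B"
    then show "wdeg V w {x} \<le> K * D"
      using cod[unfolded bounded_codegrees_def, rule_format, of "{x}"] by simp
  qed
  also have "\<dots> = card ?B * K * D" by simp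
  finally have "\<epsilon> * v \<le> card ?B * K" using D by simp
  then show "\<epsilon> / K * v \<le> card ?B" using K by (simp add: field_simps)
  assume I: "\<forall>e\<subseteq>I. w e = 0"
  show "?B \<inter> I = {}"
  proof (rule ccontr)
    assume "?B \<inter> I \<noteq> {}"
    then obtain x where x: "x \<in> V" "x \<in> I" "wdeg V w {x} > 0" by blast
    then obtain e where e: "e \<subseteq> V" "{x} \<subseteq> e" "w e \<noteq> 0"
      unfolding wdeg_def by (metis (mono_tags, lifting) less_irrefl mem_Collect_eq sum.neutral)
    then have "card e = 1" using hyp by (auto simp: whyp_def)
    then have "e = {x}" using e by (auto simp: card_1_singleton_iff)
    then show False using I x e by auto
  qed
qed

text \<open>The case of light links. Few edges die, so the alive weight is at least
  \<open>3 * \<epsilon> / 4 * v * D\<close>. Picked vertices account for at most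
  \<open>\<epsilon> / 4 * v * D\<close> of it, vertices of degree below \<open>b\<close> for as much
  again, and each vertex of \<open>B\<close> for at most \<open>K * D\<close>, so \<open>B\<close>
  is large. It misses \<open>I\<close> by \<open>scan_unpicked\<close>.\<close>

lemma high_degree_part:
  assumes hyp: "whyp V (Suc (Suc r)) w" and V: "set xs = V" "real (card V) \<le> v"
    and \<tau>: "0 < \<tau>" "\<tau> \<le> 1" and D: "0 < D" and K: "0 < K" and \<epsilon>: "0 < \<epsilon>"
    and cod: "bounded_codegrees V w K \<tau> D" and dense: "\<epsilon> * v * D \<le> wdeg V w {}"
    and s_def: "s = (\<lambda>l. K * \<tau> ^ l * D)"
    and \<epsilon>': "\<epsilon>' = \<epsilon> / (4 * 2 ^ Suc r)"
    and \<theta>: "\<theta> = \<epsilon>' * v * (\<tau> * D)" and b: "b = \<epsilon> / 4 * D"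
    and S: "S = picked V s \<theta> b w I xs (\<lambda>_. 0)" and W: "W = scan V s \<theta> b w I xs (\<lambda>_. 0)"
    and small: "wdeg V W {} < \<theta>"
  defines "B \<equiv> {x \<in> V - S. b \<le> wdeg V (alive V s w W) {x}}"
  shows "\<epsilon> / (4 * K) * v \<le> card B" and "B \<inter> I = {}"
proof -
  let ?a = "alive V s w W"
  have fin: "finite V" and nn: "\<And>e. e \<subseteq> V \<Longrightarrow> 0 \<le> w e"
    using hyp by (auto simp: whyp_def)
  have W1: "whyp V (Suc r) W"
    unfolding W by (rule scan_whyp[OF hyp]) (use V fin in \<open>auto simp: whyp_def\<close>)
  have v0: "0 \<le> v" using V(2) by (meson of_nat_0_le_iff order_trans)
  have a_le: "?a e \<le> w e" and a0: "0 \<le> ?a e" if "e \<subseteq> V" for e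
    using alive_le[OF hyp that] alive_nonneg[OF hyp that] by auto
  have a1: "whyp V (Suc (Suc r)) ?a"
    using hyp a0 by (auto simp: whyp_def alive_def)
  have deg: "wdeg V w {x} \<le> K * D" if "x \<in> V" for x
    using cod[unfolded bounded_codegrees_def, rule_format, of "{x}"] that by simp
  have sL: "\<tau> * wdeg V w L \<le> s (card L)" if "L \<subseteq> V" "L \<noteq> {}" for L
  proof -
    have "finite L" using that fin finite_subset by blast
    then have "card L \<noteq> 0" using that by simp
    then obtain m where m: "card L = Suc m" using not0_implies_Suc by blast
    have "wdeg V w L \<le> K * \<tau> ^ (card L - 1) * D"
      using cod that unfolding bounded_codegrees_def by blast
    then have "wdeg V w L \<le> K * \<tau> ^ m * D" by (simp only: m diff_Suc_1)
    then have "\<tau> * wdeg V w L \<le> \<tau> * (K * \<tau> ^ m * D)"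
      by (rule mult_left_mono) (use \<tau> in simp)
    also have "\<dots> = s (card L)" by (simp only: m s_def power_Suc mult.assoc mult.left_commute)
    finally show ?thesis .
  qed
  have "\<tau> * (wdeg V w {} - wdeg V ?a {}) \<le> 2 ^ Suc r * wdeg V W {}"
    by (rule alive_loss[OF hyp W1 \<tau>(1) sL])
  also have "\<dots> \<le> 2 ^ Suc r * \<theta>" using small by simp
  \<comment> \<open>The denominator of \<open>\<epsilon>'\<close> is chosen to cancel the factor
    \<open>2 ^ Suc r\<close> from \<open>alive_loss\<close>.\<close>
  also have "\<dots> = \<tau> * (\<epsilon> / 4 * v * D)" by (simp add: \<theta> \<epsilon>')
  finally have "wdeg V w {} - wdeg V ?a {} \<le> \<epsilon> / 4 * v * D" using \<tau> by simp
  then have "3 * \<epsilon> / 4 * v * D \<le> wdeg V ?a {}" using dense by simp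
  also have "\<dots> \<le> (\<Sum>x\<in>V. wdeg V ?a {x})" by (rule wdeg_empty_le_sum[OF a1])
  finally have 1: "3 * \<epsilon> / 4 * v * D \<le> (\<Sum>x\<in>V. wdeg V ?a {x})" .
  have SV: "S \<subseteq> V" using picked_subset S V by fastforce
  have BV: "B \<subseteq> V" by (auto simp: B_def)
  have BS: "B \<inter> S = {}" by (auto simp: B_def)
  have fS: "finite S" and fB: "finite B" using fin SV BV finite_subset by auto
  have "(\<Sum>x\<in>V. wdeg V ?a {x}) = (\<Sum>x\<in>B. wdeg V ?a {x}) + (\<Sum>x\<in>S. wdeg V ?a {x})
      + (\<Sum>x\<in>V - B - S. wdeg V ?a {x})"
  proof -
    have "S \<subseteq> V - B" using SV BS by blast
    then show ?thesis
      using fin sum.subset_diff[OF BV fin, of "\<lambda>x. wdeg V ?a {x}"]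
        sum.subset_diff[of S "V - B" "\<lambda>x. wdeg V ?a {x}"] by (simp add: ac_simps)
  qed
  also have "(\<Sum>x\<in>B. wdeg V ?a {x}) \<le> (\<Sum>x\<in>B. K * D)"
  proof (rule sum_mono)
    fix x assume "x \<in> B"
    have "wdeg V ?a {x} \<le> wdeg V w {x}" by (rule wdeg_mono) (rule a_le)
    also have "\<dots> \<le> K * D" using \<open>x \<in> B\<close> BV deg by blast
    finally show "wdeg V ?a {x} \<le> K * D" .
  qed
  also have "(\<Sum>x\<in>S. wdeg V ?a {x}) \<le> wdeg V W {}"
    using scan_picked_wdeg[OF hyp, of xs s \<theta> b I "\<lambda>_. 0"] V
    by (simp add: S W wdeg_def)
  also have "(\<Sum>x\<in>V - B - S. wdeg V ?a {x}) \<le> (\<Sum>x\<in>V - B - S. b)"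
    by (rule sum_mono) (auto simp: B_def)
  also have "(\<Sum>x\<in>V - B - S. b) \<le> v * b"
  proof -
    have "card (V - B - S) \<le> card V" by (rule card_mono) (use fin in auto)
    then have "real (card (V - B - S)) \<le> v" using V by linarith
    then show ?thesis using \<epsilon> D by (simp add: b mult_right_mono)
  qed
  finally have 2: "(\<Sum>x\<in>V. wdeg V ?a {x}) \<le> card B * (K * D) + wdeg V W {} + v * b" by simp
  have "\<theta> \<le> \<epsilon> / 4 * v * D"
  proof -
    have "(1::real) \<le> 2 ^ Suc r" by (rule one_le_power) simp
    then have "\<epsilon>' \<le> \<epsilon> / 4" using \<epsilon> by (simp add: \<epsilon>' field_simps)
    moreover have "\<tau> * D \<le> 1 * D" by (rule mult_right_mono) (use \<tau> D in auto)
    ultimately have "(\<epsilon>' * v) * (\<tau> * D) \<le> (\<epsilon> / 4 * v) * (1 * D)"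
      using \<epsilon> v0 \<tau> D by (intro mult_mono mult_right_mono mult_nonneg_nonneg) auto
    then show ?thesis by (simp add: \<theta>)
  qed
  then have "\<epsilon> / 4 * v * D \<le> card B * (K * D)" using 1 2 small by (simp add: b algebra_simps)
  then have "(\<epsilon> / 4 * v) * D \<le> (card B * K) * D" by (simp add: mult.assoc)
  then have "\<epsilon> / 4 * v \<le> card B * K" using D by (simp only: mult_le_cancel_right_pos)
  then show "\<epsilon> / (4 * K) * v \<le> card B" using K by (simp add: field_simps)
  show "B \<inter> I = {}"
  proof (rule ccontr)
    assume "B \<inter> I \<noteq> {}"
    then obtain x where x: "x \<in> B" "x \<in> I" by blast
    then have "wdeg V ?a {x} < b"
      using scan_unpicked[OF hyp, of xs x I s \<theta> b "\<lambda>_. 0"] V small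
      by (simp add: B_def flip: S W)
    then show False using x by (simp add: B_def)
  qed
qed

text \<open>\<open>D\<close> is the scale of vertex degrees and \<open>\<tau>\<close> the factor
  gained for each further vertex of a set, as usual in codegree conditions for containers.
  \<open>v\<close> only bounds the number of vertices from above, so it can stay fixed while
  vertices are removed.\<close>

definition admissible ::
  "'v set \<Rightarrow> nat \<Rightarrow> ('v set \<Rightarrow> real) \<Rightarrow> real \<Rightarrow> real \<Rightarrow> real \<Rightarrow> real \<Rightarrow> bool" where
  "admissible V r w v \<tau> D K \<longleftrightarrow> whyp V r w \<and> real (card V) \<le> v \<and> 0 < \<tau> \<and> \<tau> \<le> 1 \<and> 0 < D \<and>
     bounded_codegrees V w K \<tau> D"

text \<open>Induction on the uniformity. If the links reach weight \<open>\<theta>\<close>, they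
  form a dense hypergraph of lower uniformity in which \<open>I\<close> is independent, and the
  induction hypothesis applies with \<open>2 * K\<close>, \<open>\<epsilon>'\<close> and
  \<open>\<tau> * D\<close>. Otherwise \<open>high_degree_part\<close> applies. It is essential that
  \<open>B\<close> is fixed before \<open>I\<close>.\<close>

lemma remove_dense_part:
  fixes r :: nat
  assumes "0 < K" "0 < \<epsilon>"
  shows "\<exists>c\<ge>0. \<exists>\<delta>>0. \<forall>(V :: 'v set) w \<tau> D v.
    admissible V (Suc r) w v \<tau> D K \<longrightarrow> \<epsilon> * v * D \<le> wdeg V w {} \<longrightarrow>
    (\<exists>B. \<forall>I\<subseteq>V. (\<forall>e\<subseteq>I. w e = 0) \<longrightarrow>
      (\<exists>Ss. fingerprints I r (c * \<tau> * v + 1) Ss \<and>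
            B Ss \<subseteq> V \<and> B Ss \<inter> I = {} \<and> \<delta> * v \<le> card (B Ss)))"
  using assms
proof (induction r arbitrary: K \<epsilon>)
  case 0
  show ?case
  proof (rule exI[of _ 0], intro conjI, simp, rule exI[of _ "\<epsilon> / K"], intro conjI allI impI)
    fix V :: "'v set" and w \<tau> D v
    assume "admissible V (Suc 0) w v \<tau> D K" and dense: "\<epsilon> * v * D \<le> wdeg V w {}"
    then have H: "whyp V (Suc 0) w" "0 < D" "bounded_codegrees V w K \<tau> D" "\<epsilon> * v * D \<le> wdeg V w {}"
      by (auto simp: admissible_def)
    note * = remove_dense_part_uniform1[OF H(1)[folded One_nat_def] H(2) 0(1) H(3,4)]
    show "\<exists>B. \<forall>I\<subseteq>V. (\<forall>e\<subseteq>I. w e = 0) \<longrightarrow>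
      (\<exists>Ss. fingerprints I 0 (0 * \<tau> * v + 1) Ss \<and>
            B Ss \<subseteq> V \<and> B Ss \<inter> I = {} \<and> \<epsilon> / K * v \<le> card (B Ss))"
      by (rule exI[of _ "\<lambda>_. {x\<in>V. wdeg V w {x} > 0}"])
         (use * in \<open>auto simp: fingerprints_def\<close>)
  qed (use 0 in auto)
next
  case (Suc r)
  define \<epsilon>' where "\<epsilon>' = \<epsilon> / (4 * 2 ^ Suc r)"
  have \<epsilon>': "0 < \<epsilon>'" using Suc by (simp add: \<epsilon>'_def)
  obtain c \<delta> where c: "c \<ge> 0" and \<delta>: "\<delta> > 0" and IH: "\<forall>(V :: 'v set) w \<tau> D v.
    admissible V (Suc r) w v \<tau> D (2 * K) \<longrightarrow> \<epsilon>' * v * D \<le> wdeg V w {} \<longrightarrow>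
    (\<exists>B. \<forall>I\<subseteq>V. (\<forall>e\<subseteq>I. w e = 0) \<longrightarrow>
      (\<exists>Ss. fingerprints I r (c * \<tau> * v + 1) Ss \<and>
            B Ss \<subseteq> V \<and> B Ss \<inter> I = {} \<and> \<delta> * v \<le> card (B Ss)))"
    using Suc.IH[OF _ \<epsilon>', of "2 * K"] Suc.prems by auto
  \<comment> \<open>The second bound comes from the number of picks: \<open>\<theta> / b\<close>
    equals \<open>4 * \<epsilon>' / \<epsilon> * \<tau> * v\<close>.\<close>
  define c' where "c' = max c (4 * \<epsilon>' / \<epsilon>)"
  define \<delta>' where "\<delta>' = min \<delta> (\<epsilon> / (4 * K))"
  show ?case
  proof (rule exI[of _ c'], intro conjI, goal_cases)
    case 1
    show ?case using c by (simp add: c'_def)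
  next
    case 2
    show ?case
    proof (rule exI[of _ \<delta>'], intro conjI allI impI)
      show "0 < \<delta>'" using \<delta> Suc.prems by (auto simp: \<delta>'_def)
    next
      fix V :: "'v set" and w \<tau> D v
      assume "admissible V (Suc (Suc r)) w v \<tau> D K" "\<epsilon> * v * D \<le> wdeg V w {}"
      then have H: "whyp V (Suc (Suc r)) w" "real (card V) \<le> v" "0 < \<tau>" "\<tau> \<le> 1" "0 < D"
        "bounded_codegrees V w K \<tau> D" "\<epsilon> * v * D \<le> wdeg V w {}"
        by (auto simp: admissible_def)
      have fin: "finite V" using H(1) by (simp add: whyp_def)
      then obtain xs where xs: "set xs = V" using finite_list by blast
      have v0: "0 \<le> v" using H(2) by (meson of_nat_0_le_iff order_trans)
      define s where "s = (\<lambda>l. K * \<tau> ^ l * D)"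
      define \<theta> where "\<theta> = \<epsilon>' * v * (\<tau> * D)"
      define b where "b = \<epsilon> / 4 * D"
      have b: "b > 0" using Suc.prems H by (simp add: b_def)
      define W where "W I = scan V s \<theta> b w I xs (\<lambda>_. 0)" for I
      define good where "good W' B \<longleftrightarrow> (\<forall>I\<subseteq>V. (\<forall>e\<subseteq>I. W' e = 0) \<longrightarrow>
        (\<exists>Ss. fingerprints I r (c * \<tau> * v + 1) Ss \<and>
              B Ss \<subseteq> V \<and> B Ss \<inter> I = {} \<and> \<delta> * v \<le> card (B Ss)))"
        for W' :: "'v set \<Rightarrow> real" and B
      have ex: "\<exists>B. good (W I) B" if "\<theta> \<le> wdeg V (W I) {}" for I
      proof -
        have 1: "whyp V (Suc r) (W I)"
          unfolding W_def by (rule scan_whyp[OF H(1)]) (use xs fin in \<open>auto simp: whyp_def\<close>)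
        have 2: "bounded_codegrees V (W I) (2 * K) \<tau> (\<tau> * D)"
          unfolding bounded_codegrees_def
        proof (intro allI impI)
          fix L assume L: "L \<subseteq> V" "L \<noteq> {}"
          then have "card L \<noteq> 0" using fin finite_subset by fastforce
          then obtain m where m: "card L = Suc m" using not0_implies_Suc by blast
          have "wdeg V (W I) L \<le> 2 * s (card L)"
            unfolding W_def
            by (rule scan_wdeg_le[OF H(1)])
               (use H xs L Suc.prems in \<open>auto simp: s_def bounded_codegrees_def wdeg_def\<close>)
          then show "wdeg V (W I) L \<le> 2 * K * \<tau> ^ (card L - 1) * (\<tau> * D)"
            by (simp add: m s_def algebra_simps)
        qed
        have 3: "\<epsilon>' * v * (\<tau> * D) \<le> wdeg V (W I) {}" using that by (simp add: \<theta>_def)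
        have 4: "admissible V (Suc r) (W I) v \<tau> (\<tau> * D) (2 * K)"
          using 1 2 H by (simp add: admissible_def)
        show ?thesis unfolding good_def by (rule IH[rule_format, OF 4 3])
      qed
      \<comment> \<open>The choice depends on the link hypergraph only, so it is available to a
        decoder that knows \<open>S\<close> but not \<open>I\<close>.\<close>
      define B1 where "B1 W' = (SOME B. good W' B)" for W'
      define B where "B Ss = (let S = hd Ss in
          if \<theta> \<le> wdeg V (W S) {} then B1 (W S) (tl Ss)
          else {x \<in> V - S. b \<le> wdeg V (alive V s w (W S)) {x}})" for Ss
      have cc: "c * \<tau> * v + 1 \<le> c' * \<tau> * v + 1"
        using H v0 by (intro add_right_mono mult_right_mono) (auto simp: c'_def)
      show "\<exists>B. \<forall>I\<subseteq>V. (\<forall>e\<subseteq>I. w e = 0) \<longrightarrow>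
        (\<exists>Ss. fingerprints I (Suc r) (c' * \<tau> * v + 1) Ss \<and>
              B Ss \<subseteq> V \<and> B Ss \<inter> I = {} \<and> \<delta>' * v \<le> card (B Ss))"
      proof (intro exI[of _ B] allI impI)
        fix I assume I: "I \<subseteq> V" "\<forall>e\<subseteq>I. w e = 0"
        define S where "S = picked V s \<theta> b w I xs (\<lambda>_. 0)"
        have SI: "S \<subseteq> I" using picked_subset S_def by fast
        have WS: "W S = W I"
          unfolding W_def by (rule scan_picked) (use SI in \<open>auto simp: S_def\<close>)
        have "b * card S \<le> \<theta> + b"
        \<comment> \<open>\<open>picked_card\<close> needs a start strictly below
          \<open>\<theta>\<close>; if \<open>\<theta> = 0\<close>, which happens for
          \<open>v = 0\<close>, no vertex is ever eligible.\<close>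
        proof (cases "0 < \<theta>")
          case True
          then show ?thesis
            using picked_card[OF H(1), of xs "\<lambda>_. 0" \<theta> b s I] xs b by (simp add: wdeg_def S_def)
        next
          case False
          moreover have "0 \<le> \<theta>" using \<epsilon>' v0 H by (simp add: \<theta>_def)
          ultimately have "\<theta> = 0" by simp
          have "picked V s \<theta> b w I xs (\<lambda>_. 0) = {}" if "set xs \<subseteq> V" for xs
            using that \<open>\<theta> = 0\<close> by (induction xs) (auto simp: eligible_def wdeg_def)
          then show ?thesis using b xs \<open>\<theta> = 0\<close> by (simp add: S_def)
        qed
        then have "card S \<le> \<theta> / b + 1" using b by (simp add: field_simps)
        also have "\<theta> / b = 4 * \<epsilon>' / \<epsilon> * \<tau> * v"
          using H Suc.prems by (simp add: \<theta>_def b_def field_simps)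
        also have "\<dots> \<le> c' * \<tau> * v"
          using H v0 by (intro mult_right_mono) (auto simp: c'_def)
        finally have cS: "real (card S) \<le> c' * \<tau> * v + 1" by simp
        show "\<exists>Ss. fingerprints I (Suc r) (c' * \<tau> * v + 1) Ss \<and>
              B Ss \<subseteq> V \<and> B Ss \<inter> I = {} \<and> \<delta>' * v \<le> card (B Ss)"
        proof (cases "\<theta> \<le> wdeg V (W I) {}")
          case True
          have "good (W I) (B1 (W I))"
            unfolding B1_def by (rule someI_ex[OF ex[OF True]])
          moreover have "\<forall>e\<subseteq>I. W I e = 0"
            unfolding W_def using scan_indep[OF H(1), of I "\<lambda>_. 0"] I by blast
          ultimately obtain Ss where Ss: "fingerprints I r (c * \<tau> * v + 1) Ss"
            "B1 (W I) Ss \<subseteq> V" "B1 (W I) Ss \<inter> I = {}" "\<delta> * v \<le> card (B1 (W I) Ss)"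
            using I(1) unfolding good_def by blast
          have "B (S # Ss) = B1 (W I) Ss" using True WS by (simp add: B_def Let_def)
          moreover have "fingerprints I (Suc r) (c' * \<tau> * v + 1) (S # Ss)"
            using Ss(1) cc SI cS unfolding fingerprints_def by fastforce
          moreover have "\<delta>' * v \<le> \<delta> * v" by (rule mult_right_mono) (use v0 in \<open>auto simp: \<delta>'_def\<close>)
          ultimately show ?thesis using Ss
            by (intro exI[of _ "S # Ss"]) auto
        next
          case False
          \<comment> \<open>Empty sets pad the list to length \<open>Suc r\<close>; in this case the
            decoder reads only its head.\<close>
          let ?Ss = "S # replicate r {}"
          have B: "B ?Ss = {x \<in> V - S. b \<le> wdeg V (alive V s w (W I)) {x}}"
            using False WS by (simp add: B_def Let_def)
          have "wdeg V (W I) {} < \<theta>" using False by simp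
          note * = high_degree_part[OF H(1) xs H(2-5) Suc.prems H(6,7) s_def \<epsilon>'_def
              \<theta>_def b_def S_def W_def this]
          have "fingerprints I (Suc r) (c' * \<tau> * v + 1) ?Ss"
            using SI cS H v0 c by (auto simp: fingerprints_def c'_def)
          moreover have "\<delta>' * v \<le> \<epsilon> / (4 * K) * v"
            by (rule mult_right_mono) (use v0 in \<open>auto simp: \<delta>'_def\<close>)
          ultimately show ?thesis using * B
            by (intro exI[of _ ?Ss]) auto
        qed
      qed
    qed
  qed
qed

text \<open>Parts that miss \<open>I\<close> are removed until the remaining set is sparse. Each
  round takes at least \<open>\<delta> * v\<close> vertices, so about \<open>1 / \<delta>\<close>
  rounds suffice, each contributing \<open>r\<close> fingerprints.\<close>

theorem hypergraph_containers:
  fixes r :: nat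
  assumes "0 < K" "0 < \<epsilon>"
  shows "\<exists>c\<ge>0. \<exists>l. \<forall>(V :: 'v set) w \<tau> D v.
    admissible V (Suc r) w v \<tau> D K \<longrightarrow>
    (\<exists>C. \<forall>I\<subseteq>V. (\<forall>e\<subseteq>I. w e = 0) \<longrightarrow>
      (\<exists>Ss. fingerprints I l (c * \<tau> * v + 1) Ss \<and>
            I \<subseteq> C Ss \<and> C Ss \<subseteq> V \<and> wdeg (C Ss) w {} \<le> \<epsilon> * v * D))"
proof -
  obtain c \<delta> where c: "c \<ge> 0" and \<delta>: "\<delta> > 0" and step: "\<forall>(V :: 'v set) w \<tau> D v.
    admissible V (Suc r) w v \<tau> D K \<longrightarrow> \<epsilon> * v * D \<le> wdeg V w {} \<longrightarrow>
    (\<exists>B. \<forall>I\<subseteq>V. (\<forall>e\<subseteq>I. w e = 0) \<longrightarrow>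
      (\<exists>Ss. fingerprints I r (c * \<tau> * v + 1) Ss \<and>
            B Ss \<subseteq> V \<and> B Ss \<inter> I = {} \<and> \<delta> * v \<le> card (B Ss)))"
    using remove_dense_part[OF assms, of r, where ?'v = 'v] by auto
  define t where "t = nat \<lceil>1 / \<delta>\<rceil>"
  have "1 / \<delta> \<le> t" by (simp add: t_def real_nat_ceiling_ge)
  then have t: "1 \<le> t * \<delta>" using \<delta> by (simp add: field_simps)
  show ?thesis
  proof (rule exI[of _ c], intro conjI c, rule exI[of _ "t * r"], intro allI impI)
    fix V :: "'v set" and w \<tau> D v
    assume "admissible V (Suc r) w v \<tau> D K"
    then have H: "whyp V (Suc r) w" "real (card V) \<le> v" "0 < \<tau>" "\<tau> \<le> 1" "0 < D"
      "bounded_codegrees V w K \<tau> D"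
      by (auto simp: admissible_def)
    have v0: "0 \<le> v" using H(2) by (meson of_nat_0_le_iff order_trans)
    define m where "m = c * \<tau> * v + 1"
    have m0: "m \<ge> 0" using c H v0 by (simp add: m_def)
    \<comment> \<open>Induction on the number \<open>j\<close> of rounds still available, for all
      subsets \<open>U\<close> at once, since the set that remains depends on the fingerprints seen
      so far.\<close>
    have "\<exists>C. \<forall>I\<subseteq>U. (\<forall>e\<subseteq>I. w e = 0) \<longrightarrow>
      (\<exists>Ss. fingerprints I (j * r) m Ss \<and>
            I \<subseteq> C Ss \<and> C Ss \<subseteq> U \<and> wdeg (C Ss) w {} \<le> \<epsilon> * v * D)"
      if "U \<subseteq> V" "card U \<le> j * \<delta> * v" for U j
      using that
    proof (induction j arbitrary: U)
      case 0
      have "finite U" using H(1) 0 finite_subset by (auto simp: whyp_def)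
      then have "U = {}" using 0 by simp
      moreover have "w {} = 0" using H(1) by (force simp: whyp_def)
      ultimately have "wdeg U w {} \<le> \<epsilon> * v * D"
        using assms v0 H by (simp add: wdeg_empty)
      then show ?case
        by (intro exI[of _ "\<lambda>_. U"]) (auto simp: fingerprints_def)
    next
      case (Suc j)
      have fV: "finite V" using H(1) by (simp add: whyp_def)
      have fU: "finite U" using fV Suc.prems finite_subset by auto
      show ?case
      proof (cases "wdeg U w {} \<le> \<epsilon> * v * D")
        case True
        \<comment> \<open>Here \<open>U\<close> itself is the container, and empty fingerprints pad
          the list.\<close>
        then show ?thesis
          using m0 by (intro exI[of _ "\<lambda>_. U"] allI impI exI[of _ "replicate (Suc j * r) {}"])
            (auto simp: fingerprints_def)
      next
        case False
        have "\<exists>B. \<forall>I\<subseteq>U. (\<forall>e\<subseteq>I. w e = 0) \<longrightarrow>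
          (\<exists>Ss. fingerprints I r (c * \<tau> * v + 1) Ss \<and>
            B Ss \<subseteq> U \<and> B Ss \<inter> I = {} \<and> \<delta> * v \<le> card (B Ss))"
        proof (rule step[rule_format])
          have "card U \<le> card V" by (rule card_mono) (use fV Suc.prems in auto)
          then have "real (card U) \<le> v" using H(2) by linarith
          moreover have "whyp U (Suc r) w" using H(1) Suc.prems fU by (auto simp: whyp_def)
          moreover have "bounded_codegrees U w K \<tau> D"
            unfolding bounded_codegrees_def
          proof (intro allI impI)
            fix L assume L: "L \<subseteq> U" "L \<noteq> {}"
            have "wdeg U w L \<le> wdeg V w L"
              by (rule wdeg_antimono) (use H(1) Suc.prems in \<open>auto simp: whyp_def\<close>)
            also have "\<dots> \<le> K * \<tau> ^ (card L - 1) * D"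
              using H(6) L Suc.prems by (simp add: bounded_codegrees_def)
            finally show "wdeg U w L \<le> K * \<tau> ^ (card L - 1) * D" .
          qed
          ultimately show "admissible U (Suc r) w v \<tau> D K" using H by (simp add: admissible_def)
        qed (use False in auto)
        then obtain B where B: "\<And>I. I \<subseteq> U \<Longrightarrow> (\<forall>e\<subseteq>I. w e = 0) \<Longrightarrow>
          (\<exists>Ss. fingerprints I r m Ss \<and>
            B Ss \<subseteq> U \<and> B Ss \<inter> I = {} \<and> \<delta> * v \<le> card (B Ss))"
          unfolding m_def by blast
        define ok where "ok U' C \<longleftrightarrow> (\<forall>I\<subseteq>U'. (\<forall>e\<subseteq>I. w e = 0) \<longrightarrow>
            (\<exists>Ss. fingerprints I (j * r) m Ss \<and>
              I \<subseteq> C Ss \<and> C Ss \<subseteq> U' \<and> wdeg (C Ss) w {} \<le> \<epsilon> * v * D))" for U' C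
        define C1 where "C1 U' = (SOME C. ok U' C)" for U'
        show ?thesis
        \<comment> \<open>The first \<open>r\<close> entries determine the part to delete; the
          others encode a container in what is left.\<close>
        proof (intro exI[of _ "\<lambda>Ss. C1 (U - B (take r Ss)) (drop r Ss)"] allI impI)
          fix I assume I: "I \<subseteq> U" "\<forall>e\<subseteq>I. w e = 0"
          obtain Ss where Ss: "fingerprints I r m Ss"
            "B Ss \<subseteq> U" "B Ss \<inter> I = {}" "\<delta> * v \<le> card (B Ss)" using B[OF I] by blast
          let ?U = "U - B Ss"
          have "real (card ?U) = real (card U) - real (card (B Ss))"
            using Ss(2) fU by (simp add: card_Diff_subset finite_subset card_mono of_nat_diff)
          moreover have "real (Suc j) * \<delta> * v = j * \<delta> * v + \<delta> * v" by (simp add: algebra_simps)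
          ultimately have "card ?U \<le> j * \<delta> * v" using Ss(4) Suc.prems(2) by linarith
          then have "\<exists>C. ok ?U C" unfolding ok_def using Suc.prems by (intro Suc.IH) auto
          then have "ok ?U (C1 ?U)" unfolding C1_def by (rule someI_ex)
          moreover have "I \<subseteq> ?U" using I(1) Ss(3) by blast
          ultimately obtain Ts where Ts: "fingerprints I (j * r) m Ts" "I \<subseteq> C1 ?U Ts"
            "C1 ?U Ts \<subseteq> ?U" "wdeg (C1 ?U Ts) w {} \<le> \<epsilon> * v * D"
            using I(2) unfolding ok_def by blast
          have len: "length Ss = r" using Ss(1) by (simp add: fingerprints_def)
          have "fingerprints I (Suc j * r) m (Ss @ Ts)"
            using Ss(1) Ts(1) by (auto simp: fingerprints_def)
          then show "\<exists>Ss. fingerprints I (Suc j * r) m Ss \<and>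
              I \<subseteq> C1 (U - B (take r Ss)) (drop r Ss) \<and>
              C1 (U - B (take r Ss)) (drop r Ss) \<subseteq> U \<and>
              wdeg (C1 (U - B (take r Ss)) (drop r Ss)) w {} \<le> \<epsilon> * v * D"
            using Ts len by (intro exI[of _ "Ss @ Ts"]) auto
        qed
      qed
    qed
    moreover have "card V \<le> t * \<delta> * v"
      using H(2) mult_right_mono[OF t v0] by simp
    ultimately show "\<exists>C. \<forall>I\<subseteq>V. (\<forall>e\<subseteq>I. w e = 0) \<longrightarrow>
      (\<exists>Ss. fingerprints I (t * r) (c * \<tau> * v + 1) Ss \<and>
            I \<subseteq> C Ss \<and> C Ss \<subseteq> V \<and> wdeg (C Ss) w {} \<le> \<epsilon> * v * D)"
      unfolding m_def by blast
  qed
qed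

section \<open>Coloured copies as a weighted hypergraph\<close>

text \<open>\<open>h\<close> gives the cluster of a vertex and \<open>\<phi>\<close> prescribes a
  cluster for each vertex of \<open>H\<close>. Extensional functions keep these sets finite and easy
  to count.\<close>

definition class_maps :: "'a ugraph \<Rightarrow> nat \<Rightarrow> (nat \<Rightarrow> nat) \<Rightarrow> ('a \<Rightarrow> nat) \<Rightarrow> ('a \<Rightarrow> nat) set" where
  "class_maps H n h \<phi> = {f \<in> verts H \<rightarrow>\<^sub>E {..<n}. \<forall>u\<in>verts H. h (f u) = \<phi> u}"

definition patterns :: "'a ugraph \<Rightarrow> nat \<Rightarrow> (colour \<times> ('a \<Rightarrow> nat)) set" where
  "patterns H M = UNIV \<times> {\<phi> \<in> verts H \<rightarrow>\<^sub>E {..<M}. inj_on \<phi> (verts H)}"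

text \<open>The hypergraph lives on coloured pairs: a colouring \<open>c\<close> of \<open>G\<close>
  becomes the set of all \<open>(e, c e)\<close>, and a monochromatic copy becomes a hyperedge. A
  container may hold a pair in both colours.\<close>

definition coloured_edges :: "'a ugraph \<Rightarrow> colour \<Rightarrow> ('a \<Rightarrow> nat) \<Rightarrow> (nat set \<times> colour) set" where
  "coloured_edges H col f = (\<lambda>e. (f ` e, col)) ` edges H"

definition placements ::
  "'a ugraph \<Rightarrow> nat \<Rightarrow> (nat \<Rightarrow> nat) \<Rightarrow> (colour \<times> ('a \<Rightarrow> nat)) set \<Rightarrow> ((colour \<times> ('a \<Rightarrow> nat)) \<times> ('a \<Rightarrow> nat)) set" where
  "placements H n h Fr = (SIGMA t:Fr. class_maps H n h (snd t))"

text \<open>Weights rather than sets of hyperedges, because maps that differ only on isolated vertices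
  of \<open>H\<close> have the same coloured edges.\<close>

definition copy_weight ::
  "'a ugraph \<Rightarrow> nat \<Rightarrow> (nat \<Rightarrow> nat) \<Rightarrow> (colour \<times> ('a \<Rightarrow> nat)) set \<Rightarrow> (nat set \<times> colour) set \<Rightarrow> real" where
  "copy_weight H n h Fr s =
     card {t \<in> placements H n h Fr. coloured_edges H (fst (fst t)) (snd t) = s}"

abbreviation coloured_pairs :: "nat \<Rightarrow> (nat set \<times> colour) set" where
  "coloured_pairs n \<equiv> nsets {..<n} 2 \<times> UNIV"

section \<open>Uniformity and codegrees of the hypergraph of copies\<close>

lemma UNIV_colour: "(UNIV :: colour set) = {Red, Blue}"
  by (auto intro: colour.exhaust)

lemma finite_UNIV_colour [simp]: "finite (UNIV :: colour set)"
  by (simp add: UNIV_colour)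

lemma card_UNIV_colour [simp]: "card (UNIV :: colour set) = 2"
  by (simp add: UNIV_colour)

lemma finite_patterns: "fin_graph H \<Longrightarrow> finite (patterns H M)"
  by (auto simp: patterns_def fin_graph_def intro!: finite_cartesian_product
      finite_subset[OF _ finite_PiE[of "verts H" "\<lambda>_. {..<M}"]])

lemma finite_class_maps: "fin_graph H \<Longrightarrow> finite (class_maps H n h \<phi>)"
  by (rule finite_subset[OF _ finite_PiE[of "verts H" "\<lambda>_. {..<n}"]])
     (auto simp: class_maps_def fin_graph_def)

lemma finite_placements:
  "fin_graph H \<Longrightarrow> Fr \<subseteq> patterns H M \<Longrightarrow> finite (placements H n h Fr)"
  unfolding placements_def
  by (intro finite_SigmaI finite_class_maps) (auto intro: finite_subset finite_patterns)

lemma fin_graph_finite_edges: "fin_graph H \<Longrightarrow> finite (edges H)"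
  by (auto simp: fin_graph_def intro: finite_subset finite_imp_finite_nsets)

lemma class_maps_inj:
  assumes "f \<in> class_maps H n h \<phi>" "inj_on \<phi> (verts H)"
  shows "inj_on f (verts H)"
  using assms by (auto simp: class_maps_def inj_on_def) metis

lemma card_coloured_edges:
  assumes "fin_graph H" "inj_on f (verts H)"
  shows "card (coloured_edges H col f) = card (edges H)"
  unfolding coloured_edges_def
proof (rule card_image)
  have "edges H \<subseteq> Pow (verts H)" using assms(1) by (auto simp: fin_graph_def nsets_def)
  then have "inj_on ((`) f) (edges H)" using inj_on_image_Pow[OF assms(2)] inj_on_subset by blast
  then show "inj_on (\<lambda>e. (f ` e, col)) (edges H)" by (auto simp: inj_on_def)
qed

lemma wdeg_copy_weight:
  assumes H: "fin_graph H" "Fr \<subseteq> patterns H M" and U: "finite U"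
  shows "wdeg U (copy_weight H n h Fr) L =
    card {t \<in> placements H n h Fr. coloured_edges H (fst (fst t)) (snd t) \<subseteq> U \<and>
            L \<subseteq> coloured_edges H (fst (fst t)) (snd t)}"
proof -
  let ?g = "\<lambda>t. coloured_edges H (fst (fst t)) (snd t)"
  let ?S = "{t \<in> placements H n h Fr. ?g t \<subseteq> U \<and> L \<subseteq> ?g t}"
  have "(\<Sum>s | s \<subseteq> U \<and> L \<subseteq> s. sum (\<lambda>_. 1) {t \<in> ?S. ?g t = s}) = sum (\<lambda>_. 1::real) ?S"
    by (rule sum.group) (use finite_placements[OF H] U in auto)
  moreover have "sum (\<lambda>_. 1) {t \<in> ?S. ?g t = s} = copy_weight H n h Fr s"
    if "s \<subseteq> U \<and> L \<subseteq> s" for s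
  proof -
    have "{t \<in> ?S. ?g t = s} = {t \<in> placements H n h Fr. ?g t = s}" using that by auto
    then show ?thesis by (simp add: copy_weight_def)
  qed
  ultimately show ?thesis unfolding wdeg_def by simp
qed

lemma whyp_copy_weight:
  assumes H: "fin_graph H" "Fr \<subseteq> patterns H M"
  shows "whyp (coloured_pairs n) (card (edges H)) (copy_weight H n h Fr)"
  unfolding whyp_def
proof (intro conjI allI impI)
  show "finite (coloured_pairs n)" by (simp add: finite_imp_finite_nsets)
  fix s
  show "0 \<le> copy_weight H n h Fr s" by (simp add: copy_weight_def)
  assume "copy_weight H n h Fr s \<noteq> 0"
  then have "{t \<in> placements H n h Fr. coloured_edges H (fst (fst t)) (snd t) = s} \<noteq> {}"
    unfolding copy_weight_def by (metis card.empty of_nat_0)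
  then obtain col \<phi> f where t: "(col, \<phi>) \<in> Fr" "f \<in> class_maps H n h \<phi>" "s = coloured_edges H col f"
    by (auto simp: placements_def)
  then have "inj_on f (verts H)" using H(2) by (auto simp: patterns_def intro: class_maps_inj)
  then show "card s = card (edges H)" using card_coloured_edges[OF H(1)] t by simp
qed

text \<open>Two distinct edges span at least three vertices, so the graph spanned by
  \<open>F\<close> is then one of those over which \<open>m2\<close> takes its maximum. For a single
  edge the left side of the inequality is 0.\<close>

lemma m2_bound:
  assumes H: "fin_graph H" and F: "F \<subseteq> edges H" "F \<noteq> {}"
  shows "\<Union>F \<subseteq> verts H" "2 \<le> card (\<Union>F)"
    and "real (card F) - 1 \<le> max (m2 H) 1 * (real (card (\<Union>F)) - 2)"
proof -
  have finV: "finite (verts H)" and E: "edges H \<subseteq> nsets (verts H) 2"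
    using H by (auto simp: fin_graph_def)
  show sub: "\<Union>F \<subseteq> verts H" using E F by (auto simp: nsets_def)
  have finF: "finite F" using F fin_graph_finite_edges[OF H] finite_subset by blast
  have finU: "finite (\<Union>F)" using sub finV finite_subset by blast
  obtain e where e: "e \<in> F" using F by blast
  have ce: "card e = 2" "finite e" if "e \<in> F" for e using that E F by (auto simp: nsets_def)
  show two: "2 \<le> card (\<Union>F)"
    using card_mono[OF finU, of e] e ce[OF e] by auto
  show "real (card F) - 1 \<le> max (m2 H) 1 * (real (card (\<Union>F)) - 2)"
  proof (cases "card F \<le> 1")
    case True
    then have "real (card F) - 1 \<le> 0" by simp
    also have "0 \<le> max (m2 H) 1 * (real (card (\<Union>F)) - 2)"
      by (rule mult_nonneg_nonneg) (use two in auto)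
    finally show ?thesis .
  next
    case False
    have "\<not> F \<subseteq> {e}"
      using False card_mono[of "{e}" F] by auto
    then obtain e' where e': "e' \<in> F" "e' \<noteq> e" by blast
    have three: "3 \<le> card (\<Union>F)"
    proof (rule ccontr)
      assume "\<not> 3 \<le> card (\<Union>F)"
      then have "card (\<Union>F) = 2" using two by simp
      then have "x = \<Union>F" if "x \<in> F" for x
        using that ce by (intro card_subset_eq[OF finU]) auto
      then have "e = \<Union>F" "e' = \<Union>F" using e e' by blast+
      then show False using e' by simp
    qed
    let ?R = "{(real (card (edges F)) - 1) / (real (card (verts F)) - 2) | F.
                  subgraph F H \<and> card (verts F) \<ge> 3}"
    have "{F. subgraph F H} \<subseteq> Pow (verts H) \<times> Pow (edges H)"
      by (auto simp: subgraph_def)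
    then have "finite {F. subgraph F H}"
      using finV fin_graph_finite_edges[OF H] finite_subset by (meson finite_Pow_iff finite_SigmaI)
    then have "finite ((\<lambda>F. (real (card (edges F)) - 1) / (real (card (verts F)) - 2)) ` {F. subgraph F H})"
      by (rule finite_imageI)
    then have finR: "finite ?R" by (rule rev_finite_subset) blast
    have "subgraph (\<Union>F, F) H"
      using sub F E finU by (auto simp: subgraph_def fin_graph_def nsets_def)
    then have "(real (card F) - 1) / (real (card (\<Union>F)) - 2) \<in> ?R"
      using three by (intro CollectI exI[of _ "(\<Union>F, F)"]) auto
    then have "(real (card F) - 1) / (real (card (\<Union>F)) - 2) \<le> Max ?R"
      by (rule Max_ge[OF finR])
    moreover have "card (edges H) \<ge> 2"
      using False card_mono[OF fin_graph_finite_edges[OF H] F(1)] by simp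
    ultimately have "(real (card F) - 1) / (real (card (\<Union>F)) - 2) \<le> max (m2 H) 1"
      unfolding m2_def by auto
    then show ?thesis using three by (simp add: field_simps)
  qed
qed

lemma card_PiE_image_subset_le:
  assumes "finite A" "X \<subseteq> A" "finite Y"
  shows "card {f \<in> A \<rightarrow>\<^sub>E {..<n}. f ` X \<subseteq> Y} \<le> card Y ^ card X * n ^ (card A - card X)"
proof -
  have fX: "finite X" using assms finite_subset by auto
  have "{f \<in> A \<rightarrow>\<^sub>E {..<n}. f ` X \<subseteq> Y} \<subseteq> (\<Pi>\<^sub>E u\<in>A. if u \<in> X then Y else {..<n})"
  proof
    fix f assume "f \<in> {f \<in> A \<rightarrow>\<^sub>E {..<n}. f ` X \<subseteq> Y}"
    then show "f \<in> (\<Pi>\<^sub>E u\<in>A. if u \<in> X then Y else {..<n})"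
      by (intro PiE_I) (auto intro: PiE_arb)
  qed
  then have "card {f \<in> A \<rightarrow>\<^sub>E {..<n}. f ` X \<subseteq> Y} \<le> card (\<Pi>\<^sub>E u\<in>A. if u \<in> X then Y else {..<n})"
    by (rule card_mono[rotated]) (use assms in \<open>auto intro!: finite_PiE\<close>)
  also have "\<dots> = (\<Prod>u\<in>A. if u \<in> X then card Y else n)"
    using assms(1) by (subst card_PiE) (auto intro!: prod.cong)
  also have "\<dots> = card Y ^ card X * n ^ (card A - card X)"
    using assms fX by (simp add: prod.If_cases Int_absorb1 card_Diff_subset flip: Diff_eq)
  finally show ?thesis .
qed

text \<open>The edges of \<open>H\<close> that land in \<open>L\<close> span a set \<open>X\<close>
  which is mapped onto the vertices of \<open>L\<close>. Given \<open>X\<close>, there are at most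
  \<open>k ^ k\<close> choices on \<open>X\<close> and \<open>n ^ (k - card X)\<close> elsewhere. By
  \<open>m2_bound\<close>, \<open>X\<close> is so large that the latter is at most
  \<open>\<tau> ^ (card L - 1) * n ^ (k - 2)\<close>; this dictates the value of
  \<open>\<tau>\<close>.\<close>

lemma copies_containing_le:
  fixes H :: "'a ugraph" and n :: nat
  assumes H: "fin_graph H" and L: "L \<noteq> {}" and n: "1 \<le> n"
  defines "k \<equiv> card (verts H)" and "\<tau> \<equiv> real n powr (- (1 / max (m2 H) 1))"
  shows "real (card {f \<in> verts H \<rightarrow>\<^sub>E {..<n}. L \<subseteq> coloured_edges H col f})
    \<le> 2 ^ k * real k ^ k * (\<tau> ^ (card L - 1) * real n ^ (k - 2))"
proof -
  let ?A = "verts H"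
  let ?S = "{f \<in> ?A \<rightarrow>\<^sub>E {..<n}. L \<subseteq> coloured_edges H col f}"
  let ?d = "max (m2 H) 1"
  let ?Y = "\<Union>(fst ` L)"
  let ?\<X> = "{X \<in> Pow ?A. 2 \<le> card X \<and> real (card L) - 1 \<le> ?d * (real (card X) - 2)}"
  have finA: "finite ?A" using H by (simp add: fin_graph_def)
  show ?thesis
  proof (cases "?S = {}")
    case True
    then show ?thesis by (simp only: card.empty) (simp add: \<tau>_def)
  next
    case False
    have key: "\<exists>X\<in>?\<X>. f ` X = ?Y \<and> finite L" if f: "f \<in> ?S" for f
    proof -
      let ?F = "{e \<in> edges H. (f ` e, col) \<in> L}"
      have Leq: "L = (\<lambda>e. (f ` e, col)) ` ?F"
        using f by (auto simp: coloured_edges_def)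
      have finF: "finite ?F" using fin_graph_finite_edges[OF H] by simp
      have "card L \<le> card ?F" by (subst Leq) (rule card_image_le[OF finF])
      moreover have "?F \<noteq> {}" using L Leq by blast
      ultimately have "\<Union>?F \<in> ?\<X>" using m2_bound[OF H, of ?F] by auto
      moreover have "f ` \<Union>?F = ?Y" by (subst (2) Leq) auto
      moreover have "finite L" by (subst Leq) (use finF in simp)
      ultimately show ?thesis by blast
    qed
    obtain f where "f \<in> ?S" using False by blast
    from key[OF this] obtain X where X: "X \<subseteq> ?A" "f ` X = ?Y" and finL: "finite L" by auto
    have fX: "finite X" using X(1) finA by (rule finite_subset)
    have fY: "finite ?Y" unfolding X(2)[symmetric] using fX by (rule finite_imageI)
    have "card ?Y \<le> card X" unfolding X(2)[symmetric] using fX by (rule card_image_le)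
    also have "\<dots> \<le> k" unfolding k_def using finA X(1) by (rule card_mono)
    finally have cY: "card ?Y \<le> k" .
    have cL: "card L \<ge> 1" using L finL by (simp add: Suc_leI card_gt_0_iff)
    have "real (card ?S) \<le> card (\<Union>X\<in>?\<X>. {f \<in> ?A \<rightarrow>\<^sub>E {..<n}. f ` X \<subseteq> ?Y})"
    proof (intro of_nat_mono card_mono)
      show "finite (\<Union>X\<in>?\<X>. {f \<in> ?A \<rightarrow>\<^sub>E {..<n}. f ` X \<subseteq> ?Y})"
        using finA by (auto intro!: finite_PiE)
      show "?S \<subseteq> (\<Union>X\<in>?\<X>. {f \<in> ?A \<rightarrow>\<^sub>E {..<n}. f ` X \<subseteq> ?Y})"
      proof
        fix f assume f: "f \<in> ?S"
        from key[OF f] obtain X where "X \<in> ?\<X>" "f ` X = ?Y" by blast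
        then show "f \<in> (\<Union>X\<in>?\<X>. {f \<in> ?A \<rightarrow>\<^sub>E {..<n}. f ` X \<subseteq> ?Y})"
          using f by blast
      qed
    qed
    also have "\<dots> \<le> (\<Sum>X\<in>?\<X>. real (card {f \<in> ?A \<rightarrow>\<^sub>E {..<n}. f ` X \<subseteq> ?Y}))"
      unfolding of_nat_sum[symmetric] of_nat_le_iff
      by (rule card_UN_le) (use finA in auto)
    also have "\<dots> \<le> (\<Sum>X\<in>?\<X>. real k ^ k * (\<tau> ^ (card L - 1) * real n ^ (k - 2)))"
    proof (rule sum_mono)
      fix X assume X: "X \<in> ?\<X>"
      then have cX: "card X \<le> k" "2 \<le> card X" using finA by (auto simp: k_def card_mono)
      have "card {f \<in> ?A \<rightarrow>\<^sub>E {..<n}. f ` X \<subseteq> ?Y} \<le> card ?Y ^ card X * n ^ (k - card X)"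
        unfolding k_def by (rule card_PiE_image_subset_le) (use finA fY X in auto)
      also have "\<dots> \<le> k ^ k * n ^ (k - card X)"
        using cX cY by (intro mult_right_mono order_trans[OF power_mono power_increasing]) auto
      finally have "real (card {f \<in> ?A \<rightarrow>\<^sub>E {..<n}. f ` X \<subseteq> ?Y}) \<le> real (k ^ k * n ^ (k - card X))"
        by (simp only: of_nat_le_iff)
      also have "\<dots> = real k ^ k * real n ^ (k - card X)" by simp
      also have "\<dots> \<le> real k ^ k * (\<tau> ^ (card L - 1) * real n ^ (k - 2))"
      proof (rule mult_left_mono)
        have d: "0 < ?d" by (rule less_le_trans[OF zero_less_one max.cobounded2])
        have n0: "0 < real n" using n by simp
        have "(real (card L) - 1) / ?d \<le> real (card X) - 2"
          using X d by (simp only: pos_divide_le_eq mult.commute) simp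
        moreover have "real (card L - 1) = real (card L) - 1" using cL by (simp add: of_nat_diff)
        ultimately have "real k - real (card X) \<le> - (1 / ?d) * real (card L - 1) + (real k - 2)"
          by simp
        then have "real n powr (real k - real (card X))
            \<le> real n powr (- (1 / ?d) * real (card L - 1) + (real k - 2))"
          using n by (intro powr_mono) auto
        also have "\<dots> = real n powr (- (1 / ?d) * real (card L - 1)) * real n powr (real k - 2)"
          by (rule powr_add)
        also have "real n powr (- (1 / ?d) * real (card L - 1)) = \<tau> ^ (card L - 1)"
          using n0 by (simp only: \<tau>_def powr_powr[symmetric]) (simp add: powr_realpow)
        also have "real n powr (real k - 2) = real n ^ (k - 2)"
          using n0 cX by (simp flip: powr_realpow add: of_nat_diff)
        finally show "real n ^ (k - card X) \<le> \<tau> ^ (card L - 1) * real n ^ (k - 2)"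
          using n0 cX by (simp add: of_nat_diff flip: powr_realpow)
      qed simp
      finally show "real (card {f \<in> ?A \<rightarrow>\<^sub>E {..<n}. f ` X \<subseteq> ?Y})
          \<le> real k ^ k * (\<tau> ^ (card L - 1) * real n ^ (k - 2))" .
    qed
    also have "\<dots> = card ?\<X> * (real k ^ k * (\<tau> ^ (card L - 1) * real n ^ (k - 2)))" by simp
    also have "\<dots> \<le> 2 ^ k * (real k ^ k * (\<tau> ^ (card L - 1) * real n ^ (k - 2)))"
    proof (rule mult_right_mono)
      have "card ?\<X> \<le> card (Pow ?A)" by (rule card_mono) (use finA in auto)
      then have "card ?\<X> \<le> 2 ^ k" using finA by (simp add: k_def card_Pow)
      then have "real (card ?\<X>) \<le> real (2 ^ k)" by (simp only: of_nat_le_iff)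
      then show "real (card ?\<X>) \<le> 2 ^ k" by simp
    qed (simp add: \<tau>_def)
    finally show ?thesis by (simp add: mult.assoc)
  qed
qed

lemma bounded_codegrees_copy_weight:
  fixes H :: "'a ugraph" and n :: nat
  assumes H: "fin_graph H" "Fr \<subseteq> patterns H M" and n: "1 \<le> n"
  defines "k \<equiv> card (verts H)" and "\<tau> \<equiv> real n powr (- (1 / max (m2 H) 1))"
  shows "bounded_codegrees (coloured_pairs n) (copy_weight H n h Fr)
    (card (patterns H M) * (2 ^ k * real k ^ k)) \<tau> (real n ^ (k - 2))"
  unfolding bounded_codegrees_def
proof (intro allI impI)
  fix L :: "(nat set \<times> colour) set" assume L: "L \<noteq> {}"
  let ?S = "\<lambda>col. {f \<in> verts H \<rightarrow>\<^sub>E {..<n}. L \<subseteq> coloured_edges H col f}"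
  have finS: "finite (?S col)" for col
    using H(1) by (auto simp: fin_graph_def intro!: finite_PiE)
  have finFr: "finite Fr" using H finite_patterns finite_subset by blast
  have "wdeg (coloured_pairs n) (copy_weight H n h Fr) L \<le> card (SIGMA t:Fr. ?S (fst t))"
    unfolding wdeg_copy_weight[OF H finite_cartesian_product[OF
        finite_imp_finite_nsets[OF finite_lessThan] finite_UNIV_colour]]
    by (intro of_nat_mono card_mono finite_SigmaI finFr finS)
       (auto simp: placements_def class_maps_def)
  also have "\<dots> = (\<Sum>t\<in>Fr. real (card (?S (fst t))))"
    using finFr finS by simp
  also have "\<dots> \<le> (\<Sum>t\<in>Fr. 2 ^ k * real k ^ k * (\<tau> ^ (card L - 1) * real n ^ (k - 2)))"
    unfolding k_def \<tau>_def by (intro sum_mono copies_containing_le H L n)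
  also have "\<dots> = card Fr * (2 ^ k * real k ^ k * (\<tau> ^ (card L - 1) * real n ^ (k - 2)))" by simp
  also have "\<dots> \<le> card (patterns H M) * (2 ^ k * real k ^ k * (\<tau> ^ (card L - 1) * real n ^ (k - 2)))"
    using card_mono[OF finite_patterns[OF H(1)] H(2)]
    by (intro mult_right_mono) (auto simp: \<tau>_def)
  finally show "wdeg (coloured_pairs n) (copy_weight H n h Fr) L
      \<le> card (patterns H M) * (2 ^ k * real k ^ k) * \<tau> ^ (card L - 1) * real n ^ (k - 2)"
    by (simp only: mult.assoc)
qed

section \<open>Containers and uncovered pairs of vertices\<close>

lemma card_PiE_fixed_le:
  assumes "\<And>i. i < M \<Longrightarrow> finite (cl i) \<and> card (cl i) = q" "P \<subseteq> {..<M}"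
  shows "card {\<omega> \<in> Pi\<^sub>E {..<M} cl. \<forall>i\<in>P. \<omega> i = z i} \<le> q ^ (M - card P)"
proof -
  have "{\<omega> \<in> Pi\<^sub>E {..<M} cl. \<forall>i\<in>P. \<omega> i = z i} \<subseteq> (\<Pi>\<^sub>E i\<in>{..<M}. if i \<in> P then {z i} else cl i)"
  proof
    fix \<omega> assume "\<omega> \<in> {\<omega> \<in> Pi\<^sub>E {..<M} cl. \<forall>i\<in>P. \<omega> i = z i}"
    then show "\<omega> \<in> (\<Pi>\<^sub>E i\<in>{..<M}. if i \<in> P then {z i} else cl i)"
      by (intro PiE_I) (auto intro: PiE_arb)
  qed
  then have "card {\<omega> \<in> Pi\<^sub>E {..<M} cl. \<forall>i\<in>P. \<omega> i = z i}
      \<le> card (\<Pi>\<^sub>E i\<in>{..<M}. if i \<in> P then {z i} else cl i)"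
    by (rule card_mono[rotated]) (use assms in \<open>auto intro!: finite_PiE\<close>)
  also have "\<dots> = (\<Prod>i<M. if i \<in> P then 1 else q)"
    using assms(1) by (subst card_PiE) (auto intro!: prod.cong)
  also have "\<dots> = q ^ card ({..<M} - P)"
    by (simp add: prod.If_cases flip: Diff_eq)
  also have "card ({..<M} - P) = M - card P"
    using assms(2) finite_subset by (subst card_Diff_subset) auto
  finally show ?thesis .
qed

lemma card_ordered_pairs_le:
  assumes "D \<subseteq> nsets {..<n::nat} 2"
  shows "card {p. {fst p, snd p} \<in> D} \<le> 2 * card D" and "finite {p. {fst p, snd p} \<in> D}"
proof -
  have finD: "finite D" using assms finite_subset finite_imp_finite_nsets by blast
  have *: "card {p. {fst p, snd p} = d} \<le> 2 \<and> finite {p. {fst p, snd p} = d}" if "d \<in> D" for d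
  proof -
    have "d \<in> nsets {..<n} 2" using that assms by blast
    then obtain a b where "d = {a, b}" by (auto simp: nsets_def card_2_iff)
    have sub: "{p. {fst p, snd p} = d} \<subseteq> {(a, b), (b, a)}"
    proof
      fix p assume "p \<in> {p. {fst p, snd p} = d}"
      then have "fst p = a \<and> snd p = b \<or> fst p = b \<and> snd p = a"
        using \<open>d = {a, b}\<close> by (simp add: doubleton_eq_iff)
      then show "p \<in> {(a, b), (b, a)}" by (cases p) auto
    qed
    have "card {p. {fst p, snd p} = d} \<le> card {(a, b), (b, a)}"
      by (rule card_mono[OF _ sub]) simp
    also have "\<dots> \<le> 2" using card_length[of "[(a, b), (b, a)]"] by simp
    finally show ?thesis using finite_subset[OF sub] by simp
  qed
  have eq: "{p. {fst p, snd p} \<in> D} = (\<Union>d\<in>D. {p. {fst p, snd p} = d})" by auto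
  show "finite {p. {fst p, snd p} \<in> D}" unfolding eq using finD * by auto
  have "card {p. {fst p, snd p} \<in> D} \<le> (\<Sum>d\<in>D. card {p. {fst p, snd p} = d})"
    unfolding eq by (rule card_UN_le[OF finD])
  also have "\<dots> \<le> (\<Sum>d\<in>D. 2)" by (rule sum_mono) (use * in blast)
  finally show "card {p. {fst p, snd p} \<in> D} \<le> 2 * card D" by simp
qed

lemma patternsD:
  assumes "t \<in> patterns H M"
  shows "snd t ` verts H \<subseteq> {..<M}" "inj_on (snd t) (verts H)"
  using assms by (auto simp: patterns_def)

text \<open>No colouring of the pairs of clusters escapes such a family. The patterns left
  unrealised by a colouring that violates \<open>ramsey_good\<close> form one.\<close>

definition hitting :: "'a ugraph \<Rightarrow> (colour \<times> ('a \<Rightarrow> nat)) set \<Rightarrow> bool" where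
  "hitting H Fr \<longleftrightarrow> (\<forall>\<kappa> :: nat set \<Rightarrow> colour. \<exists>t\<in>Fr. \<forall>e\<in>edges H. \<kappa> (snd t ` e) = fst t)"

text \<open>Choose one vertex from every cluster. If \<open>C\<close> covers all chosen pairs,
  colours that \<open>C\<close> offers for them colour the pairs of clusters, and hitting gives a
  copy inside \<open>C\<close>. By \<open>few\<close>, at most half of the \<open>q ^ M\<close>
  choices contain such a copy. The other half contain an uncovered pair, and two prescribed vertices
  in two prescribed clusters occur in at most \<open>q ^ (M - 2)\<close> choices.\<close>

lemma few_copies_imp_many_uncovered_pairs:
  fixes H :: "'a ugraph"
  assumes H: "fin_graph H" "Fr \<subseteq> patterns H M" and E: "edges H \<noteq> {}"
    and cl: "\<forall>i<M. card {x\<in>{..<n}. h x = i} = q" and q: "0 < q"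
    and hit: "hitting H Fr" and C: "C \<subseteq> coloured_pairs n"
    and few: "2 * wdeg C (copy_weight H n h Fr) {} \<le> real q ^ card (verts H)"
  shows "q ^ 2 \<le> 4 * M ^ 2 * card (nsets {..<n} 2 - fst ` C)"
proof -
  define k where "k = card (verts H)"
  define cl' where "cl' i = {x\<in>{..<n}. h x = i}" for i
  define \<Omega> where "\<Omega> = Pi\<^sub>E {..<M} cl'"
  define D where "D = nsets {..<n} 2 - fst ` C"
  define Bad where "Bad = {t \<in> placements H n h Fr. coloured_edges H (fst (fst t)) (snd t) \<subseteq> C}"
  have finA: "finite (verts H)" using H(1) by (simp add: fin_graph_def)
  have finC: "finite C" using C by (rule finite_subset) (simp add: finite_imp_finite_nsets)
  have finB: "finite Bad" using finite_placements[OF H] by (simp add: Bad_def)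
  have cl': "\<And>i. i < M \<Longrightarrow> finite (cl' i) \<and> card (cl' i) = q" using cl by (simp add: cl'_def)
  have card\<Omega>: "card \<Omega> = q ^ M" unfolding \<Omega>_def using cl' by (subst card_PiE) auto
  have kM: "k \<le> M"
  proof -
    obtain t where "t \<in> Fr" using hit by (auto simp: hitting_def)
    then have "snd t ` verts H \<subseteq> {..<M}" "inj_on (snd t) (verts H)"
      using patternsD H(2) by blast+
    then show ?thesis unfolding k_def
      by (metis card_image card_lessThan card_mono finite_lessThan)
  qed
  have M2: "2 \<le> M"
  proof -
    obtain e where "e \<in> edges H" using E by blast
    then have "e \<subseteq> verts H" "card e = 2" using H(1) by (auto simp: fin_graph_def nsets_def)
    then have "2 \<le> k" using card_mono[OF finA, of e] by (simp add: k_def)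
    then show ?thesis using kM by simp
  qed
  have cardB: "wdeg C (copy_weight H n h Fr) {} = card Bad"
    using wdeg_copy_weight[OF H finC, of n h "{}"] by (simp add: Bad_def)
  define Pr where "Pr = {p. {fst p, snd p} \<in> D}"
  define Ix where "Ix = {p \<in> {..<M} \<times> {..<M}. fst p \<noteq> snd p}"
  have Pr: "card Pr \<le> 2 * card D" "finite Pr"
    using card_ordered_pairs_le[of D n] by (auto simp: Pr_def D_def)
  have Ix: "finite Ix" "card Ix \<le> M ^ 2"
    using card_mono[of "{..<M} \<times> {..<M}" Ix] by (auto simp: Ix_def power2_eq_square)
  \<comment> \<open>\<open>?Z1\<close> collects the choices through a given pair of vertices at two
    given clusters, \<open>?Z2\<close> those that extend a given copy in \<open>Bad\<close>;
    \<open>inv_into\<close> recovers the vertex of \<open>H\<close> from its cluster.\<close>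
  let ?Z1 = "\<lambda>(i, p). {\<omega> \<in> \<Omega>. \<forall>l\<in>{fst i, snd i}. \<omega> l = (if l = fst i then fst p else snd p)}"
  let ?Z2 = "\<lambda>t. {\<omega> \<in> \<Omega>. \<forall>l\<in>snd (fst t) ` verts H.
      \<omega> l = snd t (inv_into (verts H) (snd (fst t)) l)}"
  have cover: "\<Omega> \<subseteq> (\<Union>ip\<in>Ix \<times> Pr. ?Z1 ip) \<union> (\<Union>t\<in>Bad. ?Z2 t)"
  proof
    fix \<omega> assume \<omega>: "\<omega> \<in> \<Omega>"
    have w: "\<omega> i < n" "h (\<omega> i) = i" if "i < M" for i
      using \<omega> that by (auto simp: \<Omega>_def cl'_def PiE_iff)
    have w2: "{\<omega> i, \<omega> j} \<in> nsets {..<n} 2" if "i < M" "j < M" "i \<noteq> j" for i j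
    proof -
      have "\<omega> i \<noteq> \<omega> j" using w that by metis
      then show ?thesis using w that by (auto simp: nsets_def)
    qed
    show "\<omega> \<in> (\<Union>ip\<in>Ix \<times> Pr. ?Z1 ip) \<union> (\<Union>t\<in>Bad. ?Z2 t)"
    proof (cases "\<exists>i<M. \<exists>j<M. i \<noteq> j \<and> {\<omega> i, \<omega> j} \<in> D")
      case True
      then obtain i j where "i < M" "j < M" "i \<noteq> j" "{\<omega> i, \<omega> j} \<in> D" by blast
      then have "((i, j), (\<omega> i, \<omega> j)) \<in> Ix \<times> Pr" "\<omega> \<in> ?Z1 ((i, j), (\<omega> i, \<omega> j))"
        using \<omega> by (auto simp: Ix_def Pr_def)
      then show ?thesis by blast
    next
      case False
      \<comment> \<open>If the container offers both colours for the chosen pair, either one will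
        do.\<close>
      define \<kappa> where "\<kappa> s = (SOME col. (\<omega> ` s, col) \<in> C)" for s
      obtain col \<phi> where t: "(col, \<phi>) \<in> Fr" "\<And>e. e \<in> edges H \<Longrightarrow> \<kappa> (\<phi> ` e) = col"
        using hit unfolding hitting_def by (metis prod.collapse)
      have \<phi>: "\<phi> \<in> verts H \<rightarrow>\<^sub>E {..<M}" "inj_on \<phi> (verts H)"
        using t(1) H(2) by (auto simp: patterns_def)
      define f where "f = restrict (\<lambda>u. \<omega> (\<phi> u)) (verts H)"
      have f: "f \<in> class_maps H n h \<phi>"
        using \<phi>(1) w by (auto simp: class_maps_def f_def PiE_iff)
      have "(f ` e, col) \<in> C" if e: "e \<in> edges H" for e
      proof -
        obtain u v where uv: "e = {u, v}" "u \<noteq> v" "u \<in> verts H" "v \<in> verts H"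
          using e H(1) by (auto simp: fin_graph_def nsets_def card_2_iff)
        have lt: "\<phi> u < M" "\<phi> v < M" using \<phi>(1) uv by auto
        have ne: "\<phi> u \<noteq> \<phi> v" using \<phi>(2) uv by (auto dest: inj_onD)
        have fe: "f ` e = \<omega> ` (\<phi> ` e)" using uv by (auto simp: f_def)
        have "{\<omega> (\<phi> u), \<omega> (\<phi> v)} \<in> fst ` C"
          using False lt ne w2[OF lt ne] by (auto simp: D_def)
        then have "\<exists>col. (\<omega> ` (\<phi> ` e), col) \<in> C" using uv by auto
        then have "(\<omega> ` (\<phi> ` e), \<kappa> (\<phi> ` e)) \<in> C" unfolding \<kappa>_def by (rule someI_ex)
        then show ?thesis using t(2)[OF e] fe by simp
      qed
      then have "((col, \<phi>), f) \<in> Bad"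
        using t(1) f by (auto simp: Bad_def placements_def coloured_edges_def)
      moreover have "\<omega> \<in> ?Z2 ((col, \<phi>), f)"
        using \<omega> \<phi>(2) by (auto simp: f_def)
      ultimately show ?thesis by blast
    qed
  qed
  have Z1: "card (?Z1 ip) \<le> q ^ (M - 2)" if ip: "ip \<in> Ix \<times> Pr" for ip
  proof -
    obtain i j p where eq: "ip = ((i, j), p)" by (metis prod.collapse)
    have ij: "i < M" "j < M" "i \<noteq> j" using ip by (auto simp: eq Ix_def)
    have "card (?Z1 ip) \<le> q ^ (M - card {i, j})"
      unfolding eq \<Omega>_def prod.case fst_conv snd_conv
      by (rule card_PiE_fixed_le[OF cl']) (use ij in auto)
    then show ?thesis using ij by (simp add: numeral_2_eq_2)
  qed
  have Z2: "card (?Z2 t) \<le> q ^ (M - k)" if t: "t \<in> Bad" for t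
  proof -
    have ft: "fst t \<in> patterns H M"
      using t H(2) by (cases t) (auto simp: Bad_def placements_def)
    have \<phi>: "snd (fst t) ` verts H \<subseteq> {..<M}" "inj_on (snd (fst t)) (verts H)"
      using patternsD[OF ft] by blast+
    have "card (?Z2 t) \<le> q ^ (M - card (snd (fst t) ` verts H))"
      unfolding \<Omega>_def by (rule card_PiE_fixed_le[OF cl' \<phi>(1)])
    then show ?thesis using \<phi>(2) by (simp add: k_def card_image)
  qed
  have fin\<Omega>: "finite \<Omega>" unfolding \<Omega>_def using cl' by (intro finite_PiE) auto
  have "card \<Omega> \<le> card ((\<Union>ip\<in>Ix \<times> Pr. ?Z1 ip) \<union> (\<Union>t\<in>Bad. ?Z2 t))"
    by (rule card_mono[OF _ cover]) (use fin\<Omega> Ix Pr finB in auto)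
  also have "\<dots> \<le> card (\<Union>ip\<in>Ix \<times> Pr. ?Z1 ip) + card (\<Union>t\<in>Bad. ?Z2 t)"
    by (rule card_Un_le)
  also have "card (\<Union>ip\<in>Ix \<times> Pr. ?Z1 ip) \<le> (\<Sum>ip\<in>Ix \<times> Pr. card (?Z1 ip))"
    by (rule card_UN_le) (use Ix Pr in auto)
  also have "\<dots> \<le> (\<Sum>ip\<in>Ix \<times> Pr. q ^ (M - 2))" by (rule sum_mono) (rule Z1)
  also have "\<dots> = card Ix * card Pr * q ^ (M - 2)"
    by (simp only: sum_constant card_cartesian_product of_nat_id)
  also have "\<dots> \<le> M ^ 2 * (2 * card D) * q ^ (M - 2)"
    using Ix Pr by (intro mult_right_mono mult_mono) auto
  also have "card (\<Union>t\<in>Bad. ?Z2 t) \<le> (\<Sum>t\<in>Bad. card (?Z2 t))"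
    by (rule card_UN_le[OF finB])
  also have "\<dots> \<le> (\<Sum>t\<in>Bad. q ^ (M - k))" by (rule sum_mono) (rule Z2)
  also have "\<dots> = card Bad * q ^ (M - k)" by simp
  finally have 1: "q ^ M \<le> M ^ 2 * (2 * card D) * q ^ (M - 2) + card Bad * q ^ (M - k)"
    using card\<Omega> by simp
  have "real (2 * card Bad) \<le> real (q ^ k)" using few by (simp add: cardB k_def)
  then have "2 * card Bad \<le> q ^ k" by (simp only: of_nat_le_iff)
  then have "2 * card Bad * q ^ (M - k) \<le> q ^ k * q ^ (M - k)" by (rule mult_right_mono) simp
  also have "\<dots> = q ^ M" using kM by (simp flip: power_add)
  finally have "q ^ M \<le> 2 * (M ^ 2 * (2 * card D) * q ^ (M - 2))" using 1 by linarith
  moreover have "q ^ M = q ^ 2 * q ^ (M - 2)"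
    by (simp only: power_add[symmetric] le_add_diff_inverse[OF M2])
  ultimately have "q ^ 2 * q ^ (M - 2) \<le> (4 * M ^ 2 * card D) * q ^ (M - 2)"
    by (simp add: mult.assoc mult.left_commute)
  then have "q ^ 2 \<le> 4 * M ^ 2 * card D"
    using q by (simp only: mult_le_cancel2 zero_less_power)
  then show ?thesis by (simp add: D_def)
qed

section \<open>The random graph\<close>

text \<open>Independence of the pairs and \<open>1 - p \<le> exp (- p)\<close>; if \<open>U\<close>
  meets \<open>D\<close> the event is empty.\<close>

lemma prob_binomial_random_graph_le:
  assumes p: "0 \<le> p" "p \<le> 1" and U: "U \<subseteq> nsets {..<n} 2" and D: "D \<subseteq> nsets {..<n} 2"
  shows "measure_pmf.prob (binomial_random_graph n p) {G. U \<subseteq> edges G \<and> D \<inter> edges G = {}}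
    \<le> p ^ card U * exp (- p * card D)"
proof (cases "U \<inter> D = {}")
  case True
  let ?E = "nsets {..<n} 2"
  let ?B = "\<lambda>e. if e \<in> U then {True} else if e \<in> D then {False} else UNIV"
  have finE: "finite ?E" by (simp add: finite_imp_finite_nsets)
  have finU: "finite U" and finD: "finite D" using U D finE finite_subset by blast+
  have "(\<lambda>present. ({..<n}, {e \<in> ?E. present e})) -` {G. U \<subseteq> edges G \<and> D \<inter> edges G = {}} = Pi ?E ?B"
    using U D True by (auto simp: Pi_def split: if_splits)
  then have "measure_pmf.prob (binomial_random_graph n p) {G. U \<subseteq> edges G \<and> D \<inter> edges G = {}}
      = measure_pmf.prob (Pi_pmf ?E False (\<lambda>_. bernoulli_pmf p)) (Pi ?E ?B)"
    by (simp add: binomial_random_graph_def)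
  also have "\<dots> = (\<Prod>e\<in>?E. measure_pmf.prob (bernoulli_pmf p) (?B e))"
    by (rule measure_Pi_pmf_Pi[OF finE])
  also have "\<dots> = (\<Prod>e\<in>?E. (if e \<in> U then p else 1) * (if e \<in> D then 1 - p else 1))"
    by (rule prod.cong) (use p True in \<open>auto simp: measure_pmf_single\<close>)
  also have "\<dots> = (\<Prod>e\<in>?E. if e \<in> U then p else 1) * (\<Prod>e\<in>?E. if e \<in> D then 1 - p else 1)"
    by (rule prod.distrib)
  also have "(\<Prod>e\<in>?E. if e \<in> U then p else 1) = p ^ card U"
    using U finE by (simp add: prod.If_cases Int_absorb1)
  also have "(\<Prod>e\<in>?E. if e \<in> D then 1 - p else 1) = (1 - p) ^ card D"
    using D finE by (simp add: prod.If_cases Int_absorb1)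
  also have "(1 - p) ^ card D \<le> exp (- p) ^ card D"
    using exp_ge_add_one_self[of "- p"] p by (intro power_mono) auto
  also have "exp (- p) ^ card D = exp (- p * card D)"
    by (simp only: exp_of_nat2_mult)
  finally show ?thesis using p by (simp add: mult_left_mono)
next
  case False
  then have empty: "{G :: nat ugraph. U \<subseteq> edges G \<and> D \<inter> edges G = {}} = {}" by blast
  show ?thesis unfolding empty using p by simp
qed

text \<open>An exponential-moment bound: each term is multiplied by
  \<open>exp (a * (m - card U))\<close>, which is at least 1, and then the sum is extended to all
  subsets and evaluated by the binomial theorem.\<close>

lemma sum_power_card_le:
  fixes x a m :: real
  assumes "finite E" "0 \<le> x" "0 \<le> a"
  shows "(\<Sum>U | U \<subseteq> E \<and> real (card U) \<le> m. x ^ card U) \<le> exp (a * m + exp (- a) * x * card E)"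
proof -
  let ?y = "exp (- a) * x"
  have "(\<Sum>U | U \<subseteq> E \<and> real (card U) \<le> m. x ^ card U)
      \<le> (\<Sum>U | U \<subseteq> E \<and> real (card U) \<le> m. exp (a * m) * ?y ^ card U)"
  proof (rule sum_mono)
    fix U assume "U \<in> {U. U \<subseteq> E \<and> real (card U) \<le> m}"
    then have "exp (a * card U) \<le> exp (a * m)" using assms(3) by (simp add: mult_left_mono)
    moreover have "x ^ card U = exp (a * card U) * ?y ^ card U"
    proof -
      have "exp (a * card U) * ?y ^ card U = (exp a * ?y) ^ card U"
        by (simp only: exp_of_nat2_mult power_mult_distrib)
      also have "exp a * ?y = x" by (simp add: exp_minus)
      finally show ?thesis ..
    qed
    ultimately show "x ^ card U \<le> exp (a * m) * ?y ^ card U"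
      using assms(2) by (simp add: mult_right_mono)
  qed
  also have "\<dots> \<le> (\<Sum>U\<in>Pow E. exp (a * m) * ?y ^ card U)"
    by (rule sum_mono2) (use assms in auto)
  also have "\<dots> = exp (a * m) * (\<Sum>U\<in>Pow E. ?y ^ card U)" by (rule sum_distrib_left[symmetric])
  also have "(\<Sum>U\<in>Pow E. ?y ^ card U) = (1 + ?y) ^ card E"
    using prod_add[OF assms(1), of "\<lambda>_. ?y" "\<lambda>_. 1"] by (simp add: add.commute)
  also have "(1 + ?y) ^ card E \<le> exp ?y ^ card E"
    using assms by (intro power_mono exp_ge_add_one_self) auto
  also have "exp ?y ^ card E = exp (?y * card E)"
    by (simp only: exp_of_nat2_mult)
  finally show ?thesis by (simp add: exp_add)
qed

text \<open>The fingerprints lie in \<open>G\<close> and the pairs missed by the container do not,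
  so a list \<open>Ss\<close> has probability at most
  \<open>p ^ card (U Ss) * exp (- p * b)\<close>. The first factor is kept because it pays for the
  number of lists: a set \<open>W\<close> of pairs underlies at most \<open>(4 ^ card W) ^ l\<close>
  of them.\<close>

lemma prob_fingerprint_union_bound:
  fixes n l :: nat and p a m b :: real and C :: "(nat set \<times> colour) set list \<Rightarrow> (nat set \<times> colour) set"
  assumes p: "0 \<le> p" "p \<le> 1" and a: "0 \<le> a"
    and B: "\<And>G. G \<in> B \<Longrightarrow> edges G \<subseteq> nsets {..<n} 2 \<Longrightarrow>
      \<exists>I Ss. I \<subseteq> coloured_pairs n \<and> fst ` I = edges G \<and> fingerprints I l m Ss \<and> I \<subseteq> C Ss \<and>
             b \<le> card (nsets {..<n} 2 - fst ` C Ss)"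
  shows "measure_pmf.prob (binomial_random_graph n p) B
    \<le> exp (- p * b) * exp (a * (l * m) + exp (- a) * (4 ^ l * p) * card (nsets {..<n} 2))"
proof -
  let ?E = "nsets {..<n} 2"
  let ?\<mu> = "measure_pmf.prob (binomial_random_graph n p)"
  define \<L> where "\<L> = {Ss. set Ss \<subseteq> Pow (coloured_pairs n) \<and> length Ss = l \<and>
      (\<forall>S\<in>set Ss. real (card S) \<le> m) \<and> b \<le> card (?E - fst ` C Ss)}"
  define U where "U Ss = fst ` \<Union>(set Ss)" for Ss :: "(nat set \<times> colour) set list"
  have finE: "finite ?E" by (simp add: finite_imp_finite_nsets)
  have fin\<L>: "finite \<L>"
    by (rule finite_subset[OF _ finite_lists_length_eq[of "Pow (coloured_pairs n)" l]])
       (use finE in \<open>auto simp: \<L>_def\<close>)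
  have U\<L>: "U Ss \<subseteq> ?E \<and> real (card (U Ss)) \<le> l * m" if "Ss \<in> \<L>" for Ss
  proof
    show "U Ss \<subseteq> ?E" using that by (force simp: U_def \<L>_def)
    have fin: "finite S" if "S \<in> set Ss" for S
    proof (rule finite_subset)
      show "S \<subseteq> coloured_pairs n" using that \<open>Ss \<in> \<L>\<close> by (auto simp: \<L>_def)
    qed (use finE in simp)
    have "card (U Ss) \<le> card (\<Union>(set Ss))"
      unfolding U_def by (rule card_image_le) (use fin in auto)
    also have "\<dots> \<le> (\<Sum>S\<in>set Ss. card S)" by (rule card_Union_le_sum_card)
    finally have "real (card (U Ss)) \<le> (\<Sum>S\<in>set Ss. real (card S))"
      by (simp flip: of_nat_sum)
    also have "\<dots> \<le> (\<Sum>S\<in>set Ss. m)" by (rule sum_mono) (use that in \<open>auto simp: \<L>_def\<close>)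
    also have "\<dots> = card (set Ss) * m" by simp
    also have "\<dots> \<le> l * m"
    proof (cases "set Ss = {}")
      case True
      then show ?thesis using that by (simp add: \<L>_def)
    next
      case False
      then obtain S where "S \<in> set Ss" unfolding ex_in_conv[symmetric] ..
      then have "real (card S) \<le> m" using that by (auto simp: \<L>_def)
      then have "0 \<le> m" by (rule order_trans[rotated]) simp
      moreover have "card (set Ss) \<le> l" using card_length[of Ss] that by (simp add: \<L>_def)
      ultimately show ?thesis by (intro mult_right_mono) auto
    qed
    finally show "real (card (U Ss)) \<le> l * m" .
  qed
  let ?Ev = "\<lambda>Ss. {G :: nat ugraph. U Ss \<subseteq> edges G \<and> (?E - fst ` C Ss) \<inter> edges G = {}}"
  have "?\<mu> B = ?\<mu> (B \<inter> set_pmf (binomial_random_graph n p))" by (simp add: measure_Int_set_pmf)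
  also have "\<dots> \<le> ?\<mu> (\<Union>Ss\<in>\<L>. ?Ev Ss)"
  proof (rule measure_pmf.finite_measure_mono)
    show "B \<inter> set_pmf (binomial_random_graph n p) \<subseteq> (\<Union>Ss\<in>\<L>. ?Ev Ss)"
    proof
      fix G assume G: "G \<in> B \<inter> set_pmf (binomial_random_graph n p)"
      then have "edges G \<subseteq> ?E" by (auto simp: binomial_random_graph_def)
      then obtain I Ss where I: "I \<subseteq> coloured_pairs n" "fst ` I = edges G" "fingerprints I l m Ss"
        "I \<subseteq> C Ss" "b \<le> card (?E - fst ` C Ss)" using B[of G] G by blast
      have S: "S \<subseteq> I" if "S \<in> set Ss" for S using I(3) that by (auto simp: fingerprints_def)
      have "set Ss \<subseteq> Pow (coloured_pairs n)" using S I(1) by blast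
      then have "Ss \<in> \<L>" using I(3,5) by (simp add: \<L>_def fingerprints_def)
      moreover have "U Ss \<subseteq> edges G" unfolding U_def I(2)[symmetric] using S by blast
      moreover have "edges G \<subseteq> fst ` C Ss" unfolding I(2)[symmetric] using I(4) by blast
      ultimately show "G \<in> (\<Union>Ss\<in>\<L>. ?Ev Ss)" by blast
    qed
  qed simp
  also have "\<dots> \<le> (\<Sum>Ss\<in>\<L>. ?\<mu> (?Ev Ss))"
    by (rule measure_pmf.finite_measure_subadditive_finite[OF fin\<L>]) simp
  also have "\<dots> \<le> (\<Sum>Ss\<in>\<L>. exp (- p * b) * p ^ card (U Ss))"
  proof (rule sum_mono)
    fix Ss assume Ss: "Ss \<in> \<L>"
    have "?\<mu> (?Ev Ss) \<le> p ^ card (U Ss) * exp (- p * card (?E - fst ` C Ss))"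
      by (rule prob_binomial_random_graph_le[OF p]) (use U\<L>[OF Ss] in auto)
    also have "\<dots> \<le> p ^ card (U Ss) * exp (- p * b)"
    proof (intro mult_left_mono)
      have "b \<le> card (?E - fst ` C Ss)" using Ss by (simp add: \<L>_def)
      then have "p * b \<le> p * card (?E - fst ` C Ss)" using p(1) by (rule mult_left_mono)
      then show "exp (- p * card (?E - fst ` C Ss)) \<le> exp (- p * b)" by simp
    qed (use p in auto)
    finally show "?\<mu> (?Ev Ss) \<le> exp (- p * b) * p ^ card (U Ss)" by (simp only: mult.commute)
  qed
  also have "\<dots> = exp (- p * b) * (\<Sum>Ss\<in>\<L>. p ^ card (U Ss))" by (rule sum_distrib_left[symmetric])
  also have "(\<Sum>Ss\<in>\<L>. p ^ card (U Ss))
      = (\<Sum>W | W \<subseteq> ?E \<and> real (card W) \<le> l * m. \<Sum>Ss | Ss \<in> \<L> \<and> U Ss = W. p ^ card (U Ss))"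
    by (rule sum.group[symmetric, OF fin\<L>]) (use finE U\<L> in auto)
  also have "\<dots> \<le> (\<Sum>W | W \<subseteq> ?E \<and> real (card W) \<le> l * m. (4 ^ l * p) ^ card W)"
  proof (rule sum_mono)
    fix W assume W: "W \<in> {W. W \<subseteq> ?E \<and> real (card W) \<le> l * m}"
    then have finW: "finite W" using finE finite_subset by blast
    have fin: "finite {Ss. set Ss \<subseteq> Pow (W \<times> (UNIV :: colour set)) \<and> length Ss = l}"
      using finW by (intro finite_lists_length_eq) simp
    have "{Ss. Ss \<in> \<L> \<and> U Ss = W} \<subseteq> {Ss. set Ss \<subseteq> Pow (W \<times> UNIV) \<and> length Ss = l}"
    proof
      fix Ss assume Ss: "Ss \<in> {Ss. Ss \<in> \<L> \<and> U Ss = W}"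
      have "S \<subseteq> W \<times> UNIV" if "S \<in> set Ss" for S
      proof
        fix x assume "x \<in> S"
        then have "fst x \<in> U Ss" unfolding U_def using that by blast
        then show "x \<in> W \<times> UNIV" using Ss by (simp add: mem_Times_iff)
      qed
      then show "Ss \<in> {Ss. set Ss \<subseteq> Pow (W \<times> UNIV) \<and> length Ss = l}"
        using Ss by (auto simp: \<L>_def)
    qed
    then have "card {Ss. Ss \<in> \<L> \<and> U Ss = W} \<le> card {Ss. set Ss \<subseteq> Pow (W \<times> (UNIV :: colour set)) \<and> length Ss = l}"
      by (rule card_mono[OF fin])
    also have "\<dots> = card (Pow (W \<times> (UNIV :: colour set))) ^ l"
      by (rule card_lists_length_eq) (use finW in simp)
    also have "card (Pow (W \<times> (UNIV :: colour set))) = 4 ^ card W"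
    proof -
      have "card (W \<times> (UNIV :: colour set)) = 2 * card W"
        by (simp only: card_cartesian_product card_UNIV_colour mult.commute)
      then have "card (Pow (W \<times> (UNIV :: colour set))) = 2 ^ (2 * card W)"
        using finW by (simp only: card_Pow finite_cartesian_product finite_UNIV_colour)
      also have "\<dots> = 4 ^ card W" by (simp only: power_mult) simp
      finally show ?thesis .
    qed
    also have "((4::nat) ^ card W) ^ l = (4 ^ l) ^ card W"
      by (simp only: power_mult[symmetric] mult.commute)
    finally have c: "card {Ss. Ss \<in> \<L> \<and> U Ss = W} \<le> (4 ^ l) ^ card W" .
    have "(\<Sum>Ss | Ss \<in> \<L> \<and> U Ss = W. p ^ card (U Ss)) = card {Ss. Ss \<in> \<L> \<and> U Ss = W} * p ^ card W"
      by simp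
    also have "\<dots> \<le> real ((4 ^ l) ^ card W) * p ^ card W"
      using c p by (intro mult_right_mono) (simp_all only: of_nat_le_iff zero_le_power)
    also have "\<dots> = (4 ^ l * p) ^ card W" by (simp add: power_mult_distrib)
    finally show "(\<Sum>Ss | Ss \<in> \<L> \<and> U Ss = W. p ^ card (U Ss)) \<le> (4 ^ l * p) ^ card W" .
  qed
  also have "\<dots> \<le> exp (a * (l * m) + exp (- a) * (4 ^ l * p) * card ?E)"
    by (rule sum_power_card_le[OF finE]) (use p a in auto)
  finally show ?thesis by (simp add: mult_left_mono)
qed

section \<open>The probability that some colouring avoids a hitting family\<close>

definition avoids ::
  "'a ugraph \<Rightarrow> nat \<Rightarrow> (nat \<Rightarrow> nat) \<Rightarrow> nat ugraph \<Rightarrow> (nat set \<Rightarrow> colour) \<Rightarrow>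
    (colour \<times> ('a \<Rightarrow> nat)) set \<Rightarrow> bool" where
  "avoids H n h G c Fr \<longleftrightarrow> (\<forall>t\<in>Fr. \<forall>f\<in>class_maps H n h (snd t). \<exists>e\<in>edges H.
      \<not> (f ` e \<in> edges G \<and> c (f ` e) = fst t))"

lemma avoids_imp_independent:
  assumes "avoids H n h G c Fr" "s \<subseteq> (\<lambda>e. (e, c e)) ` edges G"
  shows "copy_weight H n h Fr s = 0"
proof -
  have False if t: "t \<in> placements H n h Fr" "coloured_edges H (fst (fst t)) (snd t) = s" for t
  proof -
    have "fst t \<in> Fr" "snd t \<in> class_maps H n h (snd (fst t))"
      using t(1) by (auto simp: placements_def)
    then obtain e where e: "e \<in> edges H"
      "\<not> (snd t ` e \<in> edges G \<and> c (snd t ` e) = fst (fst t))"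
      using assms(1) unfolding avoids_def by blast
    have "(snd t ` e, fst (fst t)) \<in> s" using e(1) t(2) unfolding coloured_edges_def by blast
    then show False using assms(2) e(2) by auto
  qed
  then have "{t \<in> placements H n h Fr. coloured_edges H (fst (fst t)) (snd t) = s} = {}" by blast
  then show ?thesis by (simp only: copy_weight_def card.empty of_nat_0)
qed

lemma bounded_codegrees_mono:
  assumes "bounded_codegrees V w K \<tau> D" "K \<le> K'" "0 \<le> \<tau>" "0 \<le> D"
  shows "bounded_codegrees V w K' \<tau> D"
  unfolding bounded_codegrees_def
proof (intro allI impI)
  fix L assume L: "L \<subseteq> V" "L \<noteq> {}"
  have "wdeg V w L \<le> K * \<tau> ^ (card L - 1) * D"
    using assms(1) L unfolding bounded_codegrees_def by blast
  also have "\<dots> \<le> K' * \<tau> ^ (card L - 1) * D"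
    using assms(2-4) by (intro mult_right_mono) auto
  finally show "wdeg V w L \<le> K' * \<tau> ^ (card L - 1) * D" .
qed

lemma card_pairs_le: "real (card (nsets {..<n} 2)) \<le> (real n)\<^sup>2 / 2"
proof -
  have "2 * card (nsets {..<n} 2) = n * (n - 1)"
    using dvd_mult_div_cancel[of 2 "n * (n - 1)"] by (cases n) (auto simp: card_nsets choose_two)
  also have "\<dots> \<le> n * n" by simp
  finally have "real (2 * card (nsets {..<n} 2)) \<le> real (n * n)" by (simp only: of_nat_le_iff)
  then show ?thesis by (simp add: power2_eq_square)
qed

text \<open>Each of the at most \<open>n\<^sup>2 / 2\<close> pairs occurs in two colours, hence
  \<open>v = n\<^sup>2\<close>. The \<open>+ 1\<close> makes the constant positive even if there are
  no patterns, as \<open>hypergraph_containers\<close> requires.\<close>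

lemma admissible_copy_weight:
  fixes H :: "'a ugraph" and n :: nat
  assumes H: "fin_graph H" "Fr \<subseteq> patterns H M" and n: "1 \<le> n"
  defines "k \<equiv> card (verts H)" and "\<tau> \<equiv> real n powr (- (1 / max (m2 H) 1))"
  shows "admissible (coloured_pairs n) (card (edges H)) (copy_weight H n h Fr) ((real n)\<^sup>2) \<tau>
    (real n ^ (k - 2)) (card (patterns H M) * (2 ^ k * real k ^ k) + 1)"
  unfolding admissible_def
proof (intro conjI)
  show "whyp (coloured_pairs n) (card (edges H)) (copy_weight H n h Fr)"
    by (rule whyp_copy_weight[OF H])
  have "real (card (coloured_pairs n)) = 2 * real (card (nsets {..<n} 2))"
    by (simp add: card_cartesian_product)
  then show "real (card (coloured_pairs n)) \<le> (real n)\<^sup>2" using card_pairs_le[of n] by simp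
  show \<tau>0: "0 < \<tau>" using n by (simp add: \<tau>_def)
  have "max (m2 H) 1 > 0" by (rule less_le_trans[OF zero_less_one max.cobounded2])
  then have "real n powr (- (1 / max (m2 H) 1)) \<le> real n powr 0"
    using n by (intro powr_mono) auto
  then show "\<tau> \<le> 1" using n by (simp add: \<tau>_def)
  show D0: "0 < real n ^ (k - 2)" using n by simp
  show "bounded_codegrees (coloured_pairs n) (copy_weight H n h Fr)
     (card (patterns H M) * (2 ^ k * real k ^ k) + 1) \<tau> (real n ^ (k - 2))"
    by (rule bounded_codegrees_mono[OF bounded_codegrees_copy_weight[OF H n, of h, folded k_def \<tau>_def]])
       (use \<tau>0 D0 in auto)
qed

text \<open>The sparsity \<open>\<xi> ^ k / 2\<close> is what brings the weight of a container below
  \<open>q ^ k / 2\<close>, the threshold of \<open>few_copies_imp_many_uncovered_pairs\<close>; so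
  every container misses at least \<open>\<xi>\<^sup>2 / (4 * M\<^sup>2) * n\<^sup>2\<close>
  pairs.\<close>

lemma prob_avoids_le_container:
  fixes H :: "'a ugraph" and n M :: nat and p \<xi> a c :: real and l :: nat
  assumes H: "fin_graph H" "Fr \<subseteq> patterns H M" and E: "edges H \<noteq> {}" and n: "1 \<le> n"
    and M: "0 < M" and \<xi>: "0 < \<xi>" and p: "0 \<le> p" "p \<le> 1" and a: "0 \<le> a" and c: "0 \<le> c"
    and hit: "hitting H Fr" and q: "\<xi> * n \<le> real q" and cl: "\<forall>i<M. card {x\<in>{..<n}. h x = i} = q"
  defines "k \<equiv> card (verts H)" and "\<tau> \<equiv> real n powr (- (1 / max (m2 H) 1))"
  assumes cont: "\<exists>C. \<forall>I\<subseteq>coloured_pairs n. (\<forall>e\<subseteq>I. copy_weight H n h Fr e = 0) \<longrightarrow>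
      (\<exists>Ss. fingerprints I l (c * \<tau> * (real n)\<^sup>2 + 1) Ss \<and> I \<subseteq> C Ss \<and> C Ss \<subseteq> coloured_pairs n \<and>
         wdeg (C Ss) (copy_weight H n h Fr) {} \<le> \<xi> ^ k / 2 * (real n)\<^sup>2 * real n ^ (k - 2))"
  shows "measure_pmf.prob (binomial_random_graph n p) {G. \<exists>c. avoids H n h G c Fr}
    \<le> exp (- p * (\<xi>\<^sup>2 / (4 * M\<^sup>2) * (real n)\<^sup>2) + a * (l * (c * \<tau> * (real n)\<^sup>2 + 1))
          + exp (- a) * (4 ^ l * p) * (real n)\<^sup>2)"
proof -
  let ?m = "c * \<tau> * (real n)\<^sup>2 + 1"
  let ?b = "\<xi>\<^sup>2 / (4 * M\<^sup>2) * (real n)\<^sup>2"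
  obtain C where C: "\<And>I. I \<subseteq> coloured_pairs n \<Longrightarrow> (\<forall>e\<subseteq>I. copy_weight H n h Fr e = 0) \<Longrightarrow>
      (\<exists>Ss. fingerprints I l ?m Ss \<and> I \<subseteq> C Ss \<and> C Ss \<subseteq> coloured_pairs n \<and>
         wdeg (C Ss) (copy_weight H n h Fr) {} \<le> \<xi> ^ k / 2 * (real n)\<^sup>2 * real n ^ (k - 2))"
    using cont by blast
  have finA: "finite (verts H)" using H(1) by (simp add: fin_graph_def)
  have k2: "2 \<le> k"
  proof -
    obtain e where "e \<in> edges H" using E by blast
    then have "e \<subseteq> verts H" "card e = 2" using H(1) by (auto simp: fin_graph_def nsets_def)
    then show ?thesis using card_mono[OF finA, of e] by (simp add: k_def)
  qed
  have "0 < \<xi> * n" using \<xi> n by simp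
  then have "0 < real q" using q by linarith
  then have q0: "0 < q" by simp
  have nk: "(real n)\<^sup>2 * real n ^ (k - 2) = real n ^ k"
    using k2 by (simp only: power_add[symmetric] le_add_diff_inverse)
  have "measure_pmf.prob (binomial_random_graph n p) {G. \<exists>c. avoids H n h G c Fr}
    \<le> exp (- p * ?b) * exp (a * (l * ?m) + exp (- a) * (4 ^ l * p) * card (nsets {..<n} 2))"
  proof (rule prob_fingerprint_union_bound[OF p a])
    fix G :: "nat ugraph" assume "G \<in> {G. \<exists>c. avoids H n h G c Fr}" and G: "edges G \<subseteq> nsets {..<n} 2"
    then obtain c' where c': "avoids H n h G c' Fr" by blast
    let ?I = "(\<lambda>e. (e, c' e)) ` edges G"
    have I: "?I \<subseteq> coloured_pairs n" using G by auto
    have "\<forall>s\<subseteq>?I. copy_weight H n h Fr s = 0" using avoids_imp_independent[OF c'] by blast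
    from C[OF I this] obtain Ss where Ss: "fingerprints ?I l ?m Ss" "?I \<subseteq> C Ss"
      "C Ss \<subseteq> coloured_pairs n"
      "wdeg (C Ss) (copy_weight H n h Fr) {} \<le> \<xi> ^ k / 2 * (real n)\<^sup>2 * real n ^ (k - 2)" by blast
    have "2 * wdeg (C Ss) (copy_weight H n h Fr) {} \<le> \<xi> ^ k * ((real n)\<^sup>2 * real n ^ (k - 2))"
      using Ss(4) by simp
    also have "\<dots> = (\<xi> * n) ^ k" by (simp only: nk power_mult_distrib)
    also have "\<dots> \<le> real q ^ k" using q \<xi> by (intro power_mono) auto
    finally have "q ^ 2 \<le> 4 * M ^ 2 * card (nsets {..<n} 2 - fst ` C Ss)"
      unfolding k_def by (rule few_copies_imp_many_uncovered_pairs[OF H E cl q0 hit Ss(3)])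
    then have "real (q ^ 2) \<le> real (4 * M ^ 2 * card (nsets {..<n} 2 - fst ` C Ss))"
      by (simp only: of_nat_le_iff)
    then have "(real q)\<^sup>2 \<le> 4 * (real M)\<^sup>2 * card (nsets {..<n} 2 - fst ` C Ss)" by simp
    moreover have "(\<xi> * n)\<^sup>2 \<le> (real q)\<^sup>2" using q \<xi> by (intro power_mono) auto
    ultimately have "(\<xi> * n)\<^sup>2 \<le> 4 * (real M)\<^sup>2 * card (nsets {..<n} 2 - fst ` C Ss)" by simp
    then have "?b \<le> card (nsets {..<n} 2 - fst ` C Ss)"
      using M by (simp add: field_simps power_mult_distrib)
    moreover have "fst ` ?I = edges G" by (simp add: image_image)
    ultimately show "\<exists>I Ss. I \<subseteq> coloured_pairs n \<and> fst ` I = edges G \<and> fingerprints I l ?m Ss \<and>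
        I \<subseteq> C Ss \<and> ?b \<le> card (nsets {..<n} 2 - fst ` C Ss)"
      using I Ss by blast
  qed
  also have "\<dots> = exp (- p * ?b + a * (l * ?m) + exp (- a) * (4 ^ l * p) * card (nsets {..<n} 2))"
    by (simp only: exp_add mult.assoc)
  also have "\<dots> \<le> exp (- p * ?b + a * (l * ?m) + exp (- a) * (4 ^ l * p) * (real n)\<^sup>2)"
  proof -
    have "real (card (nsets {..<n} 2)) \<le> (real n)\<^sup>2"
      using card_pairs_le[of n] zero_le_power2[of "real n"] by linarith
    then have "exp (- a) * (4 ^ l * p) * card (nsets {..<n} 2) \<le> exp (- a) * (4 ^ l * p) * (real n)\<^sup>2"
      using p by (intro mult_left_mono) auto
    then show ?thesis by simp
  qed
  finally show ?thesis .
qed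

text \<open>Each of the two counting terms costs at most a quarter of
  \<open>\<beta> * p * n\<^sup>2\<close>, and the remaining half is at least
  \<open>n * (1 + ln (M + 1))\<close>. The latter uses \<open>\<tau> * n\<^sup>2 \<ge> n\<close>,
  which follows from \<open>d \<ge> 1\<close>; here the maximum with 1 in the exponent
  matters.\<close>

lemma exponent_bound:
  fixes n M :: nat and p \<beta> a c C \<tau> d :: real and l :: nat
  assumes n: "1 \<le> n" and d: "1 \<le> d" and \<tau>: "\<tau> = real n powr (- (1 / d))" and p: "0 \<le> p"
    and \<beta>: "0 < \<beta>" and a: "0 \<le> a" "4 ^ l * exp (- a) \<le> \<beta> / 4" and c: "0 \<le> c"
    and C: "0 < C" "4 * a * l * (c + 1) \<le> \<beta> * C" "2 * (1 + ln (real M + 1)) \<le> \<beta> * C"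
    and pC: "C * \<tau> \<le> p"
  shows "- p * (\<beta> * (real n)\<^sup>2) + a * (l * (c * \<tau> * (real n)\<^sup>2 + 1)) + exp (- a) * (4 ^ l * p) * (real n)\<^sup>2
    \<le> - real n * (1 + ln (real M + 1))"
proof -
  have n0: "0 < real n" using n by simp
  have "real n powr (- 1) \<le> \<tau>"
    unfolding \<tau> using n d by (intro powr_mono) (auto simp: field_simps)
  then have \<tau>1: "1 / real n \<le> \<tau>" using n0 by (simp add: powr_minus_divide)
  then have \<tau>n: "real n \<le> \<tau> * (real n)\<^sup>2"
    using mult_right_mono[OF \<tau>1, of "(real n)\<^sup>2"] n0 by (simp add: power2_eq_square)
  have \<tau>0: "0 \<le> \<tau>" by (simp add: \<tau>)
  have 1: "a * (l * (c * \<tau> * (real n)\<^sup>2 + 1)) \<le> \<beta> / 4 * p * (real n)\<^sup>2"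
  proof -
    have "1 \<le> \<tau> * (real n)\<^sup>2" using \<tau>n n by linarith
    then have "c * \<tau> * (real n)\<^sup>2 + 1 \<le> (c + 1) * (\<tau> * (real n)\<^sup>2)" by (simp add: algebra_simps)
    then have "(a * l) * (c * \<tau> * (real n)\<^sup>2 + 1) \<le> (a * l) * ((c + 1) * (\<tau> * (real n)\<^sup>2))"
      using a by (intro mult_left_mono) auto
    also have "\<dots> = (4 * a * l * (c + 1)) / 4 * (\<tau> * (real n)\<^sup>2)" by simp
    also have "\<dots> \<le> (\<beta> * C) / 4 * (\<tau> * (real n)\<^sup>2)"
      using C(2) \<tau>0 by (intro mult_right_mono divide_right_mono) auto
    also have "\<dots> = \<beta> / 4 * ((C * \<tau>) * (real n)\<^sup>2)" by simp
    also have "\<dots> \<le> \<beta> / 4 * (p * (real n)\<^sup>2)"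
      using pC \<beta> by (intro mult_left_mono mult_right_mono) auto
    finally show ?thesis by (simp only: mult.assoc)
  qed
  have "(4 ^ l * exp (- a)) * (p * (real n)\<^sup>2) \<le> \<beta> / 4 * (p * (real n)\<^sup>2)"
    using a(2) p by (intro mult_right_mono) auto
  then have 2: "exp (- a) * (4 ^ l * p) * (real n)\<^sup>2 \<le> \<beta> / 4 * p * (real n)\<^sup>2"
    by (simp only: mult_ac)
  have "C * real n \<le> C * (\<tau> * (real n)\<^sup>2)" using \<tau>n C(1) by (intro mult_left_mono) auto
  also have "\<dots> = (C * \<tau>) * (real n)\<^sup>2" by simp
  also have "\<dots> \<le> p * (real n)\<^sup>2" using pC by (intro mult_right_mono) auto
  finally have "\<beta> / 2 * (C * real n) \<le> \<beta> / 2 * (p * (real n)\<^sup>2)" using \<beta> by (intro mult_left_mono) auto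
  moreover have "(2 * (1 + ln (real M + 1))) / 2 * real n \<le> (\<beta> * C) / 2 * real n"
    using C(3) n0 by (intro mult_right_mono divide_right_mono) auto
  moreover have "(2 * (1 + ln (real M + 1))) / 2 * real n = real n * (1 + ln (real M + 1))" by simp
  moreover have "(\<beta> * C) / 2 * real n = \<beta> / 2 * (C * real n)" by simp
  ultimately have 3: "real n * (1 + ln (real M + 1)) \<le> \<beta> / 2 * (p * (real n)\<^sup>2)"
    by linarith
  have "- p * (\<beta> * (real n)\<^sup>2) + \<beta> / 4 * p * (real n)\<^sup>2 + \<beta> / 4 * p * (real n)\<^sup>2
      = - (\<beta> / 2 * (p * (real n)\<^sup>2))" by (simp add: algebra_simps)
  moreover have "- real n * (1 + ln (real M + 1)) = - (real n * (1 + ln (real M + 1)))" by simp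
  ultimately show ?thesis using 1 2 3 by linarith
qed

text \<open>The factor \<open>1 / (M + 1) ^ n\<close> is there to survive a union bound over all
  labellings of the vertices by clusters.\<close>

lemma prob_avoids_le:
  fixes H :: "'a ugraph" and M :: nat and \<xi> :: real
  assumes H: "fin_graph H" and E: "edges H \<noteq> {}" and M: "0 < M" and \<xi>: "0 < \<xi>"
  shows "\<exists>C>0. \<forall>n\<ge>1. \<forall>p. 0 \<le> p \<longrightarrow> p \<le> 1 \<longrightarrow> C * real n powr (- (1 / max (m2 H) 1)) \<le> p \<longrightarrow>
    (\<forall>h q Fr. \<xi> * n \<le> real q \<longrightarrow> (\<forall>i<M. card {x\<in>{..<n}. h x = i} = q) \<longrightarrow> Fr \<subseteq> patterns H M \<longrightarrow>
      hitting H Fr \<longrightarrow>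
      measure_pmf.prob (binomial_random_graph n p) {G. \<exists>c. avoids H n h G c Fr}
        \<le> exp (- real n) / real (M + 1) ^ n)"
proof -
  define k where "k = card (verts H)"
  define K where "K = card (patterns H M) * (2 ^ k * real k ^ k) + 1"
  have "0 \<le> card (patterns H M) * (2 ^ k * real k ^ k)" by simp
  then have K: "0 < K" unfolding K_def by linarith
  have \<epsilon>: "0 < \<xi> ^ k / 2" using \<xi> by simp
  have "card (edges H) \<noteq> 0" using E fin_graph_finite_edges[OF H] by simp
  then obtain r where r: "card (edges H) = Suc r" using not0_implies_Suc by blast
  obtain c l where c: "0 \<le> c" and cont: "\<forall>(V :: (nat set \<times> colour) set) w \<tau> D v.
    admissible V (Suc r) w v \<tau> D K \<longrightarrow>
    (\<exists>C. \<forall>I\<subseteq>V. (\<forall>e\<subseteq>I. w e = 0) \<longrightarrow>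
      (\<exists>Ss. fingerprints I l (c * \<tau> * v + 1) Ss \<and>
            I \<subseteq> C Ss \<and> C Ss \<subseteq> V \<and> wdeg (C Ss) w {} \<le> \<xi> ^ k / 2 * v * D))"
    using hypergraph_containers[OF K \<epsilon>, of r, where ?'v = "nat set \<times> colour"] by auto
  define \<beta> where "\<beta> = \<xi>\<^sup>2 / (4 * (real M)\<^sup>2)"
  have \<beta>: "0 < \<beta>" using \<xi> M by (simp add: \<beta>_def)
  \<comment> \<open>First \<open>a\<close> is chosen to make \<open>4 ^ l * exp (- a)\<close> small;
    then \<open>C\<close> is taken large enough to outweigh the cost that \<open>a\<close> puts on
    the size of the fingerprints.\<close>
  define a where "a = max 0 (ln (4 ^ l * 4 / \<beta>))"
  have a: "0 \<le> a" "4 ^ l * exp (- a) \<le> \<beta> / 4"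
  proof -
    have "exp (- a) \<le> exp (- ln (4 ^ l * 4 / \<beta>))" by (simp add: a_def)
    also have "\<dots> = \<beta> / (4 ^ l * 4)" using \<beta> by (simp add: exp_minus)
    finally show "4 ^ l * exp (- a) \<le> \<beta> / 4" using \<beta> by (simp add: field_simps)
  qed (simp add: a_def)
  define C where "C = (4 * a * l * (c + 1) + 2 * (1 + ln (real M + 1))) / \<beta>"
  have l1: "0 \<le> ln (real M + 1)" by simp
  have l2: "0 \<le> 4 * a * l * (c + 1)" using a c by simp
  have \<beta>C: "\<beta> * C = 4 * a * l * (c + 1) + 2 * (1 + ln (real M + 1))" using \<beta> by (simp add: C_def)
  have C: "0 < C" "4 * a * l * (c + 1) \<le> \<beta> * C" "2 * (1 + ln (real M + 1)) \<le> \<beta> * C"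
  proof -
    have "0 < 4 * a * l * (c + 1) + 2 * (1 + ln (real M + 1))"
    proof (rule add_nonneg_pos[OF l2])
      have "0 < 1 + ln (real M + 1)" using l1 by linarith
      then show "0 < 2 * (1 + ln (real M + 1))" by simp
    qed
    then show "0 < C" unfolding C_def using \<beta> by (rule divide_pos_pos)
    show "4 * a * l * (c + 1) \<le> \<beta> * C" unfolding \<beta>C using l1 by simp
    show "2 * (1 + ln (real M + 1)) \<le> \<beta> * C" unfolding \<beta>C using l2 by simp
  qed
  show ?thesis
  proof (rule exI[of _ C], intro conjI C(1) allI impI)
    fix n :: nat and p :: real and h q Fr
    assume n: "1 \<le> n" and p: "0 \<le> p" "p \<le> 1" and pC: "C * real n powr (- (1 / max (m2 H) 1)) \<le> p"
      and q: "\<xi> * n \<le> real q" and cl: "\<forall>i<M. card {x\<in>{..<n}. h x = i} = q"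
      and Fr: "Fr \<subseteq> patterns H M" and hit: "hitting H Fr"
    define \<tau> where "\<tau> = real n powr (- (1 / max (m2 H) 1))"
    have adm: "admissible (coloured_pairs n) (Suc r) (copy_weight H n h Fr) ((real n)\<^sup>2)
        (real n powr (- (1 / max (m2 H) 1))) (real n ^ (k - 2)) K"
      unfolding K_def k_def r[symmetric] by (rule admissible_copy_weight[OF H Fr n])
    have "measure_pmf.prob (binomial_random_graph n p) {G. \<exists>c. avoids H n h G c Fr}
      \<le> exp (- p * (\<xi>\<^sup>2 / (4 * M\<^sup>2) * (real n)\<^sup>2) + a * (l * (c * \<tau> * (real n)\<^sup>2 + 1))
          + exp (- a) * (4 ^ l * p) * (real n)\<^sup>2)"
      unfolding \<tau>_def
    proof (rule prob_avoids_le_container[OF H Fr E n M \<xi> p a(1) c hit q cl])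
      show "\<exists>C. \<forall>I\<subseteq>coloured_pairs n. (\<forall>e\<subseteq>I. copy_weight H n h Fr e = 0) \<longrightarrow>
      (\<exists>Ss. fingerprints I l (c * real n powr - (1 / max (m2 H) 1) * (real n)\<^sup>2 + 1) Ss \<and>
        I \<subseteq> C Ss \<and> C Ss \<subseteq> coloured_pairs n \<and>
         wdeg (C Ss) (copy_weight H n h Fr) {}
           \<le> \<xi> ^ card (verts H) / 2 * (real n)\<^sup>2 * real n ^ (card (verts H) - 2))"
        by (rule cont[rule_format, OF adm, unfolded k_def])
    qed
    also have "\<dots> \<le> exp (- real n * (1 + ln (real M + 1)))"
    proof -
      have "- p * (\<beta> * (real n)\<^sup>2) + a * (l * (c * \<tau> * (real n)\<^sup>2 + 1)) + exp (- a) * (4 ^ l * p) * (real n)\<^sup>2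
          \<le> - real n * (1 + ln (real M + 1))"
        by (rule exponent_bound[OF n _ \<tau>_def p(1) \<beta> a c C]) (use pC in \<open>auto simp: \<tau>_def\<close>)
      then show ?thesis by (simp add: \<beta>_def)
    qed
    also have "\<dots> = exp (- real n) / exp (real n * ln (real M + 1))"
      by (simp add: algebra_simps flip: exp_diff)
    also have "exp (real n * ln (real M + 1)) = real (M + 1) ^ n"
      by (simp add: exp_of_nat_mult add.commute)
    finally show "measure_pmf.prob (binomial_random_graph n p) {G. \<exists>c. avoids H n h G c Fr}
        \<le> exp (- real n) / real (M + 1) ^ n" .
  qed
qed

text \<open>The map \<open>h\<close> labels each vertex with the index of its cluster; the label \<open>M\<close> is for the
  vertices outside all clusters.\<close>

definition ramsey_good :: "'a ugraph \<Rightarrow> nat \<Rightarrow> real \<Rightarrow> nat \<Rightarrow> nat ugraph \<Rightarrow> bool" where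
  "ramsey_good H M \<xi> n G \<longleftrightarrow>
    (\<forall>c. \<forall>h \<in> {..<n} \<rightarrow>\<^sub>E {..M}. \<forall>q. \<xi> * n \<le> real q \<longrightarrow>
      (\<forall>i<M. card {x\<in>{..<n}. h x = i} = q) \<longrightarrow>
      (\<exists>\<kappa> :: nat set \<Rightarrow> colour. \<forall>t\<in>patterns H M. (\<forall>e\<in>edges H. \<kappa> (snd t ` e) = fst t) \<longrightarrow>
        (\<exists>f\<in>class_maps H n h (snd t). \<forall>e\<in>edges H. f ` e \<in> edges G \<and> c (f ` e) = fst t)))"

text \<open>Treated separately because the copies would form a hypergraph of uniformity 0. One
  vertex from each cluster realises every pattern.\<close>

lemma ramsey_good_no_edges:
  assumes H: "edges H = {}" and n: "1 \<le> n" and \<xi>: "0 < \<xi>"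
  shows "ramsey_good H M \<xi> n G"
proof -
  have "\<exists>f. f \<in> class_maps H n h (snd t)"
    if q: "\<xi> * n \<le> real q" "\<forall>i<M. card {x\<in>{..<n}. h x = i} = q" and t: "t \<in> patterns H M" for h q t
  proof -
    have "0 < \<xi> * n" using \<xi> n by simp
    then have "0 < real q" using q(1) by linarith
    then have "0 < q" by simp
    have ex: "\<exists>x. x < n \<and> h x = i" if "i < M" for i
    proof (rule ccontr)
      assume "\<not> (\<exists>x. x < n \<and> h x = i)"
      then have "{x\<in>{..<n}. h x = i} = {}" by auto
      then show False using q(2) that \<open>0 < q\<close> by (metis card.empty less_irrefl)
    qed
    have lt: "snd t u < M" if "u \<in> verts H" for u using patternsD(1)[OF t] that by auto
    have "restrict (\<lambda>u. SOME x. x < n \<and> h x = snd t u) (verts H) \<in> class_maps H n h (snd t)"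
      using someI_ex[OF ex[OF lt]] by (auto simp: class_maps_def)
    then show ?thesis by blast
  qed
  then show ?thesis unfolding ramsey_good_def H by blast
qed

text \<open>\<open>Fr\<close> consists of all patterns that \<open>G\<close> with the colouring
  \<open>c\<close> does not realise. That every \<open>\<kappa>\<close> fails says that this family
  is hitting.\<close>

lemma not_ramsey_goodD:
  assumes "\<not> ramsey_good H M \<xi> n G"
  obtains c h q Fr where "h \<in> {..<n} \<rightarrow>\<^sub>E {..M}" "\<xi> * n \<le> real q"
    "\<forall>i<M. card {x\<in>{..<n}. h x = i} = q" "Fr \<subseteq> patterns H M" "hitting H Fr" "avoids H n h G c Fr"
proof -
  obtain c h q where 1: "h \<in> {..<n} \<rightarrow>\<^sub>E {..M}" "\<xi> * n \<le> real q"
    "\<forall>i<M. card {x\<in>{..<n}. h x = i} = q" and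
    2: "\<not> (\<exists>\<kappa> :: nat set \<Rightarrow> colour. \<forall>t\<in>patterns H M. (\<forall>e\<in>edges H. \<kappa> (snd t ` e) = fst t) \<longrightarrow>
        (\<exists>f\<in>class_maps H n h (snd t). \<forall>e\<in>edges H. f ` e \<in> edges G \<and> c (f ` e) = fst t))"
    using assms unfolding ramsey_good_def by blast
  define Fr where "Fr = {t \<in> patterns H M. \<not> (\<exists>f\<in>class_maps H n h (snd t).
      \<forall>e\<in>edges H. f ` e \<in> edges G \<and> c (f ` e) = fst t)}"
  have "Fr \<subseteq> patterns H M" by (auto simp: Fr_def)
  moreover have "hitting H Fr"
    unfolding hitting_def
  proof
    fix \<kappa> :: "nat set \<Rightarrow> colour"
    obtain t where "t \<in> patterns H M" "\<forall>e\<in>edges H. \<kappa> (snd t ` e) = fst t"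
      "\<not> (\<exists>f\<in>class_maps H n h (snd t). \<forall>e\<in>edges H. f ` e \<in> edges G \<and> c (f ` e) = fst t)"
      using 2 by blast
    then show "\<exists>t\<in>Fr. \<forall>e\<in>edges H. \<kappa> (snd t ` e) = fst t" unfolding Fr_def by blast
  qed
  moreover have "avoids H n h G c Fr" unfolding avoids_def Fr_def by blast
  ultimately show ?thesis using 1 that by blast
qed

text \<open>Union bound over the labellings \<open>h\<close> and the families \<open>Fr\<close>. The
  edge colourings stay inside the event, where the containers have already dealt with them.\<close>

lemma prob_not_ramsey_good_le:
  fixes H :: "'a ugraph" and M :: nat and \<xi> :: real
  assumes H: "fin_graph H" and M: "0 < M" and \<xi>: "0 < \<xi>"
  shows "\<exists>C>0. \<exists>A. \<forall>n\<ge>1. \<forall>p. 0 \<le> p \<longrightarrow> p \<le> 1 \<longrightarrow> C * real n powr (- (1 / max (m2 H) 1)) \<le> p \<longrightarrow>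
    measure_pmf.prob (binomial_random_graph n p) {G. \<not> ramsey_good H M \<xi> n G} \<le> A * exp (- real n)"
proof (cases "edges H = {}")
  case True
  show ?thesis
  proof (rule exI[of _ 1], intro conjI, simp, rule exI[of _ 0], intro allI impI)
    fix n p assume "1 \<le> (n::nat)"
    then have empty: "{G. \<not> ramsey_good H M \<xi> n G} = {}" using ramsey_good_no_edges[OF True _ \<xi>] by blast
    show "measure_pmf.prob (binomial_random_graph n p) {G. \<not> ramsey_good H M \<xi> n G} \<le> 0 * exp (- real n)"
      unfolding empty by simp
  qed
next
  case False
  obtain C where C: "C > 0" and bound: "\<forall>n\<ge>1. \<forall>p. 0 \<le> p \<longrightarrow> p \<le> 1 \<longrightarrow>
    C * real n powr (- (1 / max (m2 H) 1)) \<le> p \<longrightarrow>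
    (\<forall>h q Fr. \<xi> * n \<le> real q \<longrightarrow> (\<forall>i<M. card {x\<in>{..<n}. h x = i} = q) \<longrightarrow> Fr \<subseteq> patterns H M \<longrightarrow>
      hitting H Fr \<longrightarrow>
      measure_pmf.prob (binomial_random_graph n p) {G. \<exists>c. avoids H n h G c Fr}
        \<le> exp (- real n) / real (M + 1) ^ n)"
    using prob_avoids_le[OF H False M \<xi>] by (elim exE conjE) (rule that; assumption)
  define P where "P = Pow (patterns H M)"
  have finP: "finite P" using finite_patterns[OF H] by (simp add: P_def)
  show ?thesis
  proof (rule exI[of _ C], intro conjI C, rule exI[of _ "real (card P)"], intro allI impI)
    fix n :: nat and p :: real
    assume np: "1 \<le> n" "0 \<le> p" "p \<le> 1" "C * real n powr (- (1 / max (m2 H) 1)) \<le> p"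
    let ?\<mu> = "measure_pmf.prob (binomial_random_graph n p)"
    define \<Theta> where "\<Theta> = {(h, Fr). h \<in> {..<n} \<rightarrow>\<^sub>E {..M} \<and> Fr \<in> P \<and> hitting H Fr \<and>
      (\<exists>q. \<xi> * n \<le> real q \<and> (\<forall>i<M. card {x\<in>{..<n}. h x = i} = q))}"
    have sub: "\<Theta> \<subseteq> ({..<n} \<rightarrow>\<^sub>E {..M}) \<times> P" by (auto simp: \<Theta>_def)
    have fin: "finite (({..<n} \<rightarrow>\<^sub>E {..M}) \<times> P)" using finP by (intro finite_cartesian_product finite_PiE) auto
    have fin\<Theta>: "finite \<Theta>" by (rule finite_subset[OF sub fin])
    have "card \<Theta> \<le> card (({..<n} \<rightarrow>\<^sub>E {..M}) \<times> P)" by (rule card_mono[OF fin sub])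
    also have "\<dots> = (M + 1) ^ n * card P" by (simp add: card_cartesian_product card_PiE)
    finally have card\<Theta>: "card \<Theta> \<le> (M + 1) ^ n * card P" .
    have "?\<mu> {G. \<not> ramsey_good H M \<xi> n G} \<le> ?\<mu> (\<Union>t\<in>\<Theta>. {G. \<exists>c. avoids H n (fst t) G c (snd t)})"
    proof (rule measure_pmf.finite_measure_mono)
      show "{G. \<not> ramsey_good H M \<xi> n G} \<subseteq> (\<Union>t\<in>\<Theta>. {G. \<exists>c. avoids H n (fst t) G c (snd t)})"
      proof
        fix G assume "G \<in> {G. \<not> ramsey_good H M \<xi> n G}"
        then have ng: "\<not> ramsey_good H M \<xi> n G" by simp
        obtain c h q Fr where *: "h \<in> {..<n} \<rightarrow>\<^sub>E {..M}" "\<xi> * n \<le> real q"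
          "\<forall>i<M. card {x\<in>{..<n}. h x = i} = q" "Fr \<subseteq> patterns H M" "hitting H Fr"
          "avoids H n h G c Fr" by (rule not_ramsey_goodD[OF ng])
        then have "(h, Fr) \<in> \<Theta>" unfolding \<Theta>_def P_def by blast
        then show "G \<in> (\<Union>t\<in>\<Theta>. {G. \<exists>c. avoids H n (fst t) G c (snd t)})"
          using *(6) by (intro UN_I[of "(h, Fr)"]) auto
      qed
    qed simp
    also have "\<dots> \<le> (\<Sum>t\<in>\<Theta>. ?\<mu> {G. \<exists>c. avoids H n (fst t) G c (snd t)})"
      by (rule measure_pmf.finite_measure_subadditive_finite[OF fin\<Theta>]) simp
    also have "\<dots> \<le> (\<Sum>t\<in>\<Theta>. exp (- real n) / real (M + 1) ^ n)"
    proof (rule sum_mono)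
      fix t assume "t \<in> \<Theta>"
      then obtain q where *: "\<xi> * n \<le> real q" "\<forall>i<M. card {x\<in>{..<n}. fst t x = i} = q"
        "snd t \<subseteq> patterns H M" "hitting H (snd t)"
        by (auto simp: \<Theta>_def P_def)
      show "?\<mu> {G. \<exists>c. avoids H n (fst t) G c (snd t)} \<le> exp (- real n) / real (M + 1) ^ n"
        by (rule bound[rule_format, OF np, where h = "fst t" and q = q]) (use * in auto)
    qed
    also have "\<dots> = card \<Theta> * (exp (- real n) / real (M + 1) ^ n)" by simp
    also have "\<dots> \<le> real ((M + 1) ^ n * card P) * (exp (- real n) / real (M + 1) ^ n)"
      using card\<Theta> by (intro mult_right_mono) (auto simp only: of_nat_le_iff divide_nonneg_nonneg exp_ge_zero zero_le_power of_nat_0_le_iff)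
    also have "\<dots> = card P * exp (- real n)" by simp
    finally show "?\<mu> {G. \<not> ramsey_good H M \<xi> n G} \<le> card P * exp (- real n)" .
  qed
qed

section \<open>Tilings\<close>

definition coloured_embedding ::
  "'a ugraph \<Rightarrow> 'b ugraph \<Rightarrow> ('b set \<Rightarrow> colour) \<Rightarrow> colour \<Rightarrow> ('a \<Rightarrow> 'b) \<Rightarrow> bool" where
  "coloured_embedding H G c col f \<longleftrightarrow> inj_on f (verts H) \<and> f ` verts H \<subseteq> verts G \<and>
     (\<forall>e\<in>edges H. f ` e \<in> edges G \<and> c (f ` e) = col)"

text \<open>The colour is fixed and the tiling is confined to \<open>Z\<close>, so that tilings of
  disjoint sets can be added and the two colours compared on the same set.\<close>

definition tileable ::
  "'a ugraph \<Rightarrow> 'b ugraph \<Rightarrow> ('b set \<Rightarrow> colour) \<Rightarrow> colour \<Rightarrow> 'b set \<Rightarrow> nat \<Rightarrow> bool" where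
  "tileable H G c col Z m \<longleftrightarrow>
     (\<exists>T. is_tiling H G T \<and> card T = m \<and> (\<forall>F\<in>T. verts F \<subseteq> Z \<and> (\<forall>e\<in>edges F. c e = col)))"

lemma is_tilingD:
  assumes "is_tiling H G T"
  shows "finite T" "F \<in> T \<Longrightarrow> is_copy H G F"
    "F \<in> T \<Longrightarrow> F' \<in> T \<Longrightarrow> F \<noteq> F' \<Longrightarrow> verts F \<inter> verts F' = {}"
  using assms by (simp_all add: is_tiling_def)

lemma tileable_0: "tileable H G c col Z 0"
  unfolding tileable_def by (rule exI[of _ "{}"]) (simp add: is_tiling_def)

lemma tileable_mono:
  assumes "tileable H G c col Z m" "Z \<subseteq> Z'" "m' \<le> m"
  shows "tileable H G c col Z' m'"
proof -
  obtain T where T: "is_tiling H G T" "card T = m" "\<forall>F\<in>T. verts F \<subseteq> Z \<and> (\<forall>e\<in>edges F. c e = col)"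
    using assms(1) unfolding tileable_def by blast
  obtain T' where T': "T' \<subseteq> T" "card T' = m'"
    using obtain_subset_with_card_n[of m' T] assms(3) T(2) by auto
  have "is_tiling H G T'"
    unfolding is_tiling_def
  proof (intro conjI ballI impI)
    show "finite T'" by (rule finite_subset[OF T'(1) is_tilingD(1)[OF T(1)]])
  qed (use is_tilingD(2,3)[OF T(1)] subsetD[OF T'(1)] in blast)+
  then show ?thesis using T(3) T' assms(2) unfolding tileable_def by blast
qed

lemma is_copy_verts_nonempty:
  assumes "is_copy H G F" "verts H \<noteq> {}"
  shows "verts F \<noteq> {}"
  using assms unfolding is_copy_def graph_iso_def bij_betw_def by blast

lemma tileable_Un:
  assumes H: "verts H \<noteq> {}" and 1: "tileable H G c col Z1 a" and 2: "tileable H G c col Z2 b"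
    and disj: "Z1 \<inter> Z2 = {}"
  shows "tileable H G c col (Z1 \<union> Z2) (a + b)"
proof -
  obtain T1 where T1: "is_tiling H G T1" "card T1 = a"
    "\<forall>F\<in>T1. verts F \<subseteq> Z1 \<and> (\<forall>e\<in>edges F. c e = col)"
    using 1 unfolding tileable_def by blast
  obtain T2 where T2: "is_tiling H G T2" "card T2 = b"
    "\<forall>F\<in>T2. verts F \<subseteq> Z2 \<and> (\<forall>e\<in>edges F. c e = col)"
    using 2 unfolding tileable_def by blast
  have fin: "finite T1" "finite T2" using T1(1) T2(1) by (auto simp: is_tiling_def)
  have cross: "verts F \<inter> verts F' = {}" if "F \<in> T1" "F' \<in> T2" for F F'
    using T1(3) T2(3) disj that by blast
  \<comment> \<open>A common copy would have no vertices, but \<open>H\<close> has one; hence the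
    sizes add up.\<close>
  have "T1 \<inter> T2 = {}"
  proof (rule ccontr)
    assume "T1 \<inter> T2 \<noteq> {}"
    then obtain F where F: "F \<in> T1" "F \<in> T2" by blast
    then have "is_copy H G F" using T1(1) by (simp add: is_tiling_def)
    then show False using cross[OF F] is_copy_verts_nonempty[OF _ H] by blast
  qed
  then have "card (T1 \<union> T2) = a + b" using fin T1(2) T2(2) by (simp add: card_Un_disjoint)
  moreover have "is_tiling H G (T1 \<union> T2)"
    unfolding is_tiling_def
  proof (intro conjI ballI impI)
    show "finite (T1 \<union> T2)" using fin by simp
    show "is_copy H G F" if "F \<in> T1 \<union> T2" for F
      using that is_tilingD(2)[OF T1(1)] is_tilingD(2)[OF T2(1)] by (elim UnE)
    fix F F' assume F: "F \<in> T1 \<union> T2" "F' \<in> T1 \<union> T2" "F \<noteq> F'"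
    consider "F \<in> T1" "F' \<in> T1" | "F \<in> T1" "F' \<in> T2" | "F \<in> T2" "F' \<in> T1" | "F \<in> T2" "F' \<in> T2"
      using F by blast
    then show "verts F \<inter> verts F' = {}"
    proof cases
      case 1
      then show ?thesis using F(3) by (rule is_tilingD(3)[OF T1(1)])
    next
      case 2
      then show ?thesis by (rule cross)
    next
      case 3
      then show ?thesis using cross by blast
    next
      case 4
      then show ?thesis using F(3) by (rule is_tilingD(3)[OF T2(1)])
    qed
  qed
  ultimately show ?thesis using T1(3) T2(3) unfolding tileable_def by blast
qed

lemma tileable_embedding:
  assumes H: "fin_graph H" and f: "coloured_embedding H G c col f"
  shows "tileable H G c col (f ` verts H) 1"
proof -
  let ?F = "(f ` verts H, (\<lambda>e. f ` e) ` edges H)"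
  have inj: "inj_on f (verts H)" using f by (simp add: coloured_embedding_def)
  have E: "e \<subseteq> verts H \<and> finite e \<and> card e = 2" if "e \<in> edges H" for e
    using H that by (auto simp: fin_graph_def nsets_def)
  have "f ` e \<in> nsets (f ` verts H) 2" if "e \<in> edges H" for e
    using E[OF that] card_image[OF inj_on_subset[OF inj]] by (auto simp: nsets_def)
  then have "subgraph ?F G"
    using f H by (auto simp: subgraph_def fin_graph_def coloured_embedding_def)
  moreover have "graph_iso H ?F"
    unfolding graph_iso_def
  proof (intro exI[of _ f] conjI ballI)
    show "bij_betw f (verts H) (verts ?F)" using inj by (simp add: bij_betw_def)
    fix u v assume uv: "u \<in> verts H" "v \<in> verts H"
    show "{u, v} \<in> edges H \<longleftrightarrow> {f u, f v} \<in> edges ?F"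
    proof
      assume "{u, v} \<in> edges H"
      then have "f ` {u, v} \<in> (\<lambda>e. f ` e) ` edges H" by (rule imageI)
      then show "{f u, f v} \<in> edges ?F" by simp
    next
      assume "{f u, f v} \<in> edges ?F"
      then obtain e where e: "e \<in> edges H" "f ` {u, v} = f ` e" by auto
      then have "{u, v} = e"
        using inj_on_image_eq_iff[OF inj, of "{u, v}" e] uv E[OF e(1)] by blast
      then show "{u, v} \<in> edges H" using e by simp
    qed
  qed
  ultimately have "is_copy H G ?F" by (simp add: is_copy_def)
  then have "is_tiling H G {?F}" by (simp add: is_tiling_def)
  then show ?thesis
    unfolding tileable_def using f
    by (intro exI[of _ "{?F}"]) (auto simp: coloured_embedding_def)
qed

lemma greedy_tiling:
  assumes H: "fin_graph H" "verts H \<noteq> {}" and "finite W"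
  shows "\<exists>m W'. W' \<subseteq> W \<and> tileable H G c col (W - W') m \<and>
    card W = card W' + card (verts H) * m \<and>
    \<not> (\<exists>f. coloured_embedding H G c col f \<and> f ` verts H \<subseteq> W')"
  using assms(3)
proof (induction W rule: finite_psubset_induct)
  case (psubset W)
  show ?case
  proof (cases "\<exists>f. coloured_embedding H G c col f \<and> f ` verts H \<subseteq> W")
    case True
    then obtain f where f: "coloured_embedding H G c col f" "f ` verts H \<subseteq> W" by blast
    let ?X = "f ` verts H"
    have cX: "card ?X = card (verts H)"
      using f(1) by (intro card_image) (simp add: coloured_embedding_def)
    have "W - ?X \<subset> W" using H(2) f(2) by blast
    from psubset.IH[OF this] obtain m W' where IH: "W' \<subseteq> W - ?X"
      "tileable H G c col (W - ?X - W') m" "card (W - ?X) = card W' + card (verts H) * m"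
      "\<not> (\<exists>f. coloured_embedding H G c col f \<and> f ` verts H \<subseteq> W')" by blast
    have "tileable H G c col (?X \<union> (W - ?X - W')) (1 + m)"
      by (rule tileable_Un[OF H(2) tileable_embedding[OF H(1) f(1)] IH(2)]) blast
    moreover have "?X \<union> (W - ?X - W') = W - W'" using f(2) IH(1) by blast
    moreover have "card W = card (W - ?X) + card ?X"
      using f(2) psubset.hyps
      by (metis card_Diff_subset card_mono finite_subset le_add_diff_inverse2)
    ultimately have "W' \<subseteq> W" "tileable H G c col (W - W') (1 + m)"
      "card W = card W' + card (verts H) * (1 + m)"
      using IH(1,3) cX by auto
    then show ?thesis using IH(4) by blast
  next
    case False
    then show ?thesis by (intro exI[of _ 0] exI[of _ W]) (simp add: tileable_0)
  qed
qed

section \<open>Copies along patterns of clusters\<close>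

definition along ::
  "'a ugraph \<Rightarrow> 'b ugraph \<Rightarrow> ('b set \<Rightarrow> colour) \<Rightarrow> colour \<Rightarrow> ('a \<Rightarrow> nat) \<Rightarrow> (nat \<Rightarrow> 'b set) \<Rightarrow> ('a \<Rightarrow> 'b) \<Rightarrow> bool" where
  "along H G c col \<phi> U f \<longleftrightarrow> (\<forall>u\<in>verts H. f u \<in> U (\<phi> u)) \<and>
     (\<forall>e\<in>edges H. f ` e \<in> edges G \<and> c (f ` e) = col)"

definition clusters :: "nat \<Rightarrow> nat \<Rightarrow> 'b set \<Rightarrow> (nat \<Rightarrow> 'b set) \<Rightarrow> bool" where
  "clusters M q W U \<longleftrightarrow> (\<forall>i<M. U i \<subseteq> W \<and> finite (U i) \<and> card (U i) = q) \<and>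
     (\<forall>i<M. \<forall>j<M. i \<noteq> j \<longrightarrow> U i \<inter> U j = {})"

text \<open>\<open>along\<close> does not ask for injectivity: it is automatic, as distinct vertices
  of \<open>H\<close> go to disjoint clusters.\<close>

lemma along_imp_embedding:
  assumes "along H G c col \<phi> U' f" "clusters M q W U" "W \<subseteq> verts G"
    "\<phi> ` verts H \<subseteq> {..<M}" "inj_on \<phi> (verts H)" "\<And>i. i < M \<Longrightarrow> U' i \<subseteq> U i"
  shows "coloured_embedding H G c col f"
proof -
  have f: "f u \<in> U (\<phi> u)" "\<phi> u < M" if "u \<in> verts H" for u
    using assms(1,4,6) that unfolding along_def by (blast, blast)
  have "inj_on f (verts H)"
  proof (rule inj_onI)
    fix u v assume uv: "u \<in> verts H" "v \<in> verts H" "f u = f v"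
    then have "U (\<phi> u) \<inter> U (\<phi> v) \<noteq> {}" using f[OF uv(1)] f[OF uv(2)] by auto
    then have "\<phi> u = \<phi> v" using assms(2) f uv unfolding clusters_def by blast
    then show "u = v" using assms(5) uv by (simp add: inj_on_eq_iff)
  qed
  moreover have "f ` verts H \<subseteq> verts G"
  proof
    fix x assume "x \<in> f ` verts H"
    then obtain u where u: "u \<in> verts H" "x = f u" by blast
    have "U (\<phi> u) \<subseteq> W" using assms(2) f(2)[OF u(1)] by (simp add: clusters_def)
    then show "x \<in> verts G" using f(1)[OF u(1)] u(2) assms(3) by blast
  qed
  ultimately show ?thesis using assms(1) by (simp add: coloured_embedding_def along_def)
qed

text \<open>Greedy search along one pattern. A copy takes at most one vertex from each cluster, so
  while fewer than \<open>t\<close> copies have been found, fewer than \<open>t\<close> vertices are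
  gone from any cluster.\<close>

lemma pattern_tiling:
  assumes H: "fin_graph H" "verts H \<noteq> {}" and U: "clusters M q W U" and W: "W \<subseteq> verts G"
    and \<phi>: "\<phi> ` verts H \<subseteq> {..<M}" "inj_on \<phi> (verts H)" and t: "t \<le> q"
  shows "tileable H G c col (\<Union>i\<in>\<phi> ` verts H. U i) t \<or>
    (\<exists>U'. (\<forall>i<M. U' i \<subseteq> U i \<and> q < card (U' i) + t) \<and> \<not> (\<exists>f. along H G c col \<phi> U' f))"
proof -
  \<comment> \<open>Strengthened for the induction: the copies found so far live in the removed
    parts \<open>U i - U' i\<close>, hence are disjoint from any new copy along
    \<open>U'\<close>.\<close>
  have "(\<exists>U'. (\<forall>i<M. U' i \<subseteq> U i \<and> card (U i) \<le> card (U' i) + t) \<and>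
      tileable H G c col (\<Union>i\<in>\<phi> ` verts H. U i - U' i) t) \<or>
    (\<exists>U'. (\<forall>i<M. U' i \<subseteq> U i \<and> q < card (U' i) + t) \<and> \<not> (\<exists>f. along H G c col \<phi> U' f))" (is "?A t \<or> ?B t")
    using t
  proof (induction t)
    case 0
    have "?A 0" by (intro exI[of _ U]) (simp add: tileable_0)
    then show ?case ..
  next
    case (Suc t)
    then have "?A t \<or> ?B t" using Suc_leD by blast
    then consider "?A t" | "?B t" by blast
    then show ?case
    proof cases
      case 1
      then obtain U' where U': "\<And>i. i < M \<Longrightarrow> U' i \<subseteq> U i \<and> card (U i) \<le> card (U' i) + t"
        "tileable H G c col (\<Union>i\<in>\<phi> ` verts H. U i - U' i) t" by blast
      show ?thesis
      proof (cases "\<exists>f. along H G c col \<phi> U' f")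
        case False
        have "?B (Suc t)"
        proof (intro exI[of _ U'] conjI allI impI False)
          fix i assume "i < M"
          then show "U' i \<subseteq> U i" "q < card (U' i) + Suc t"
            using U'(1)[of i] U unfolding clusters_def by auto
        qed
        then show ?thesis ..
      next
        case True
        then obtain f where f: "along H G c col \<phi> U' f" by blast
        have emb: "coloured_embedding H G c col f"
          by (rule along_imp_embedding[OF f U W \<phi>]) (use U'(1) in blast)
        let ?X = "f ` verts H"
        let ?Z = "\<Union>i\<in>\<phi> ` verts H. U i - U' i"
        have fu: "f u \<in> U' (\<phi> u)" "\<phi> u < M" if "u \<in> verts H" for u
          using f \<phi>(1) that unfolding along_def by (blast, blast)
        have sub: "?Z \<inter> ?X = {}"
        proof (rule ccontr)
          assume "?Z \<inter> ?X \<noteq> {}"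
          then obtain u v where uv: "u \<in> verts H" "v \<in> verts H" "f v \<in> U (\<phi> u)" "f v \<notin> U' (\<phi> u)"
            by blast
          have "f v \<in> U (\<phi> v)" using fu[OF uv(2)] U'(1) by blast
          then have "\<phi> u = \<phi> v"
            using U fu uv unfolding clusters_def by blast
          then show False using uv fu[OF uv(2)] by simp
        qed
        have one: "card (U' i) \<le> card (U' i - ?X) + 1" if i: "i < M" for i
        proof -
          have fin: "finite (U' i)" using U'(1)[OF i] U i finite_subset unfolding clusters_def by blast
          have eq: "x = y" if xy: "x \<in> U' i \<inter> ?X" "y \<in> U' i \<inter> ?X" for x y
          proof -
            obtain u v where uv: "u \<in> verts H" "v \<in> verts H" "x = f u" "y = f v" using xy by blast
            have "f u \<in> U (\<phi> u)" "f v \<in> U (\<phi> v)" "f u \<in> U i" "f v \<in> U i"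
              using fu uv U'(1) i xy by blast+
            then have "\<phi> u = i" "\<phi> v = i" using U fu uv i unfolding clusters_def by blast+
            then have "\<phi> u = \<phi> v" by simp
            then have "u = v" by (rule inj_onD[OF \<phi>(2) _ uv(1,2)])
            then show ?thesis using uv by simp
          qed
          have "card (U' i \<inter> ?X) \<le> 1"
            using eq fin card_le_Suc0_iff_eq[of "U' i \<inter> ?X"] by auto
          moreover have "card (U' i) = card (U' i - ?X) + card (U' i \<inter> ?X)"
            using card_Int_Diff[OF fin, of ?X] by simp
          ultimately show ?thesis by linarith
        qed
        have "tileable H G c col (?Z \<union> ?X) (t + 1)"
          by (rule tileable_Un[OF H(2) U'(2) tileable_embedding[OF H(1) emb] sub])
        moreover have "?Z \<union> ?X \<subseteq> (\<Union>i\<in>\<phi> ` verts H. U i - (U' i - ?X))"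
        proof
          fix x assume "x \<in> ?Z \<union> ?X"
          then show "x \<in> (\<Union>i\<in>\<phi> ` verts H. U i - (U' i - ?X))"
          proof
            assume "x \<in> ?X"
            then obtain u where u: "u \<in> verts H" "x = f u" by blast
            have "f u \<in> U (\<phi> u)" using fu[OF u(1)] U'(1) by blast
            then show ?thesis using u by blast
          qed blast
        qed
        ultimately have tl: "tileable H G c col (\<Union>i\<in>\<phi> ` verts H. U i - (U' i - ?X)) (Suc t)"
          using tileable_mono[of H G c col _ "t + 1" _ "Suc t"] by simp
        have "?A (Suc t)"
        proof (intro exI[of _ "\<lambda>i. U' i - ?X"] conjI allI impI tl)
          fix i assume i: "i < M"
          show "U' i - ?X \<subseteq> U i" using U'(1)[OF i] by blast
          show "card (U i) \<le> card (U' i - ?X) + Suc t" using U'(1)[OF i] one[OF i] by linarith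
        qed
        then show ?thesis ..
      qed
    next
      case 2
      then obtain U' where U': "\<forall>i<M. U' i \<subseteq> U i \<and> q < card (U' i) + t"
        "\<not> (\<exists>f. along H G c col \<phi> U' f)" by blast
      have "?B (Suc t)" by (rule exI[of _ U']) (use U' in auto)
      then show ?thesis ..
    qed
  qed
  then show ?thesis
  proof
    assume "?A t"
    then obtain U' where "tileable H G c col (\<Union>i\<in>\<phi> ` verts H. U i - U' i) t" by blast
    then have "tileable H G c col (\<Union>i\<in>\<phi> ` verts H. U i) t" by (rule tileable_mono) auto
    then show ?thesis ..
  qed blast
qed

section \<open>Bowties\<close>

text \<open>\<open>b\<close> will be \<open>2 * k - \<alpha>\<close>. The empty set must be
  excluded, since it satisfies the rest with \<open>m = 0\<close>.\<close>

definition bowtie_free ::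
  "'a ugraph \<Rightarrow> 'b ugraph \<Rightarrow> ('b set \<Rightarrow> colour) \<Rightarrow> nat \<Rightarrow> real \<Rightarrow> 'b set \<Rightarrow> bool" where
  "bowtie_free H G c b \<delta> W \<longleftrightarrow> (\<forall>Z\<subseteq>W. Z \<noteq> {} \<longrightarrow>
     \<not> (\<exists>m. tileable H G c Red Z m \<and> tileable H G c Blue Z m \<and> (1 - \<delta>) * card Z \<le> real (b * m)))"

definition freed ::
  "'a ugraph \<Rightarrow> 'b ugraph \<Rightarrow> ('b set \<Rightarrow> colour) \<Rightarrow> (nat \<Rightarrow> 'b set) \<Rightarrow> ('a \<Rightarrow> nat) \<times> ('a \<Rightarrow> nat) \<Rightarrow> bool" where
  "freed H G c U P \<longleftrightarrow> \<not> ((\<exists>f. along H G c Red (fst P) U f) \<and> (\<exists>f. along H G c Blue (snd P) U f))"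

text \<open>The first component is meant for red copies and the second for blue ones. The bound on
  the clusters used is what makes simultaneous tilings of both kinds a bowtie set.\<close>

definition bowtie_patterns :: "'a ugraph \<Rightarrow> nat \<Rightarrow> nat \<Rightarrow> (('a \<Rightarrow> nat) \<times> ('a \<Rightarrow> nat)) set" where
  "bowtie_patterns H M b = {P. (Red, fst P) \<in> patterns H M \<and> (Blue, snd P) \<in> patterns H M \<and>
     card (fst P ` verts H \<union> snd P ` verts H) \<le> b}"

lemma finite_bowtie_patterns:
  assumes "fin_graph H"
  shows "finite (bowtie_patterns H M b)"
proof (rule finite_subset)
  show "bowtie_patterns H M b \<subseteq> snd ` patterns H M \<times> snd ` patterns H M"
    by (force simp: bowtie_patterns_def)
qed (use finite_patterns[OF assms] in simp)

lemma freed_mono: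
  assumes "freed H G c U P" "P \<in> bowtie_patterns H M b" "\<And>i. i < M \<Longrightarrow> U' i \<subseteq> U i"
  shows "freed H G c U' P"
proof -
  have P: "fst P ` verts H \<subseteq> {..<M}" "snd P ` verts H \<subseteq> {..<M}"
    using assms(2) patternsD(1)[of "(Red, fst P)" H M] patternsD(1)[of "(Blue, snd P)" H M]
    by (auto simp: bowtie_patterns_def)
  have "along H G c col \<phi> U f" if "along H G c col \<phi> U' f" "\<phi> ` verts H \<subseteq> {..<M}" for col \<phi> f
    unfolding along_def
  proof (intro conjI ballI)
    fix u assume "u \<in> verts H"
    then show "f u \<in> U (\<phi> u)" using that assms(3)[of "\<phi> u"] unfolding along_def by blast
  qed (use that(1) in \<open>auto simp: along_def\<close>)
  then show ?thesis using assms(1) P unfolding freed_def by blast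
qed

lemma clusters_subset:
  assumes U: "clusters M q W U" and U': "\<And>i. i < M \<Longrightarrow> U' i \<subseteq> U i \<and> card (U' i) = q'"
  shows "clusters M q' W U'"
  unfolding clusters_def
proof (intro conjI allI impI)
  fix i assume i: "i < M"
  have Ui: "U i \<subseteq> W" "finite (U i)" using U i by (simp_all add: clusters_def)
  show "U' i \<subseteq> W" "card (U' i) = q'" "finite (U' i)"
    using U'[OF i] Ui finite_subset by auto
  fix j assume j: "j < M" "i \<noteq> j"
  then have "U i \<inter> U j = {}" using U i by (simp add: clusters_def)
  then show "U' i \<inter> U' j = {}" using U'[OF i] U'[OF j(1)] by blast
qed

lemma shrink_clusters:
  assumes U: "clusters M q W U" and U': "\<And>i. i < M \<Longrightarrow> U' i \<subseteq> U i \<and> q' \<le> card (U' i)"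
  obtains U'' where "clusters M q' W U''" "\<And>i. i < M \<Longrightarrow> U'' i \<subseteq> U' i"
proof -
  have "\<exists>X. X \<subseteq> U' i \<and> card X = q'" if "i < M" for i
    using obtain_subset_with_card_n[of q' "U' i"] U'[OF that] by blast
  then obtain U'' where U'': "\<And>i. i < M \<Longrightarrow> U'' i \<subseteq> U' i \<and> card (U'' i) = q'"
    by metis
  have "clusters M q' W U''"
    by (rule clusters_subset[OF U]) (use U' U'' in blast)
  then show thesis using that U'' by blast
qed

lemma free_one_pattern:
  assumes H: "fin_graph H" "verts H \<noteq> {}" and W: "W \<subseteq> verts G"
    and bf: "bowtie_free H G c b \<delta> W" and \<delta>: "0 < \<delta>" "\<delta> < 1"
    and P: "P \<in> bowtie_patterns H M b" and U: "clusters M q W U" and q: "1 \<le> q"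
  shows "\<exists>U' q'. clusters M q' W U' \<and> (\<forall>i<M. U' i \<subseteq> U i) \<and> \<delta> * q \<le> real q' \<and> freed H G c U' P"
proof -
  define q' where "q' = nat \<lceil>\<delta> * q\<rceil>"
  have pos: "0 < \<delta> * q" using \<delta> q by simp
  have q'1: "\<delta> * q \<le> real q'" "real q' < \<delta> * q + 1"
    unfolding q'_def using pos by linarith+
  have "0 < real q'" using q'1(1) pos by linarith
  then have q'0: "1 \<le> q'" by simp
  have "\<delta> * q \<le> 1 * real q" using \<delta> by (intro mult_right_mono) auto
  then have "real q' < real q + 1" using q'1 by linarith
  then have q'q: "q' \<le> q" by linarith
  \<comment> \<open>Losing fewer than \<open>t\<close> vertices leaves at least \<open>q'\<close> in
    a cluster, and the \<open>+ 1\<close> makes up for the rounding in \<open>q'\<close>.\<close>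
  define t where "t = q - q' + 1"
  have t: "t \<le> q" using q'0 q'q by (simp add: t_def)
  have treal: "(1 - \<delta>) * q \<le> real t"
  proof -
    have "real t = real q - real q' + 1" using q'q by (simp add: t_def of_nat_diff)
    then show ?thesis using q'1(2) by (simp add: algebra_simps)
  qed
  have \<phi>: "fst P ` verts H \<subseteq> {..<M}" "inj_on (fst P) (verts H)"
    "snd P ` verts H \<subseteq> {..<M}" "inj_on (snd P) (verts H)"
    using P patternsD[of "(Red, fst P)" H M] patternsD[of "(Blue, snd P)" H M]
    by (auto simp: bowtie_patterns_def)
  let ?J = "fst P ` verts H \<union> snd P ` verts H"
  let ?Z = "\<Union>i\<in>?J. U i"
  have J: "?J \<subseteq> {..<M}" "card ?J \<le> b" using \<phi> P by (auto simp: bowtie_patterns_def)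
  have finJ: "finite ?J" using J(1) finite_subset by blast
  have Ui: "U i \<subseteq> W" "finite (U i)" "card (U i) = q" if "i < M" for i
    using U that by (simp_all add: clusters_def)
  have ZW: "?Z \<subseteq> W" using Ui(1) J(1) by blast
  have Zne: "?Z \<noteq> {}"
  proof -
    obtain u where "u \<in> verts H" using H(2) by blast
    then have "fst P u \<in> ?J" by blast
    moreover have "U (fst P u) \<noteq> {}"
      using Ui(3)[of "fst P u"] \<phi>(1) \<open>u \<in> verts H\<close> q by fastforce
    ultimately show ?thesis by blast
  qed
  have cZ: "card ?Z \<le> b * q"
  proof -
    have "card ?Z \<le> (\<Sum>i\<in>?J. card (U i))" by (rule card_UN_le[OF finJ])
    also have "\<dots> = (\<Sum>i\<in>?J. q)" by (rule sum.cong) (use Ui(3) J(1) in auto)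
    also have "\<dots> \<le> b * q" using J(2) by simp
    finally show ?thesis .
  qed
  have no: "\<not> (tileable H G c Red ?Z t \<and> tileable H G c Blue ?Z t)"
  proof
    assume tl: "tileable H G c Red ?Z t \<and> tileable H G c Blue ?Z t"
    have "(1 - \<delta>) * card ?Z \<le> (1 - \<delta>) * real (b * q)"
    proof (rule mult_left_mono)
      show "real (card ?Z) \<le> real (b * q)" using cZ by (simp only: of_nat_le_iff)
    qed (use \<delta> in simp)
    also have "\<dots> = b * ((1 - \<delta>) * q)" by simp
    also have "\<dots> \<le> b * real t" using treal by (intro mult_left_mono) auto
    also have "\<dots> = real (b * t)" by simp
    finally show False using bf ZW Zne tl unfolding bowtie_free_def by blast
  qed
  have tred: "tileable H G c Red ?Z t" if "tileable H G c Red (\<Union>i\<in>fst P ` verts H. U i) t"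
    by (rule tileable_mono[OF that]) auto
  have tblue: "tileable H G c Blue ?Z t" if "tileable H G c Blue (\<Union>i\<in>snd P ` verts H. U i) t"
    by (rule tileable_mono[OF that]) auto
  have "\<exists>U'. (\<forall>i<M. U' i \<subseteq> U i \<and> q < card (U' i) + t) \<and> freed H G c U' P"
    using pattern_tiling[OF H U W \<phi>(1,2) t, of c Red] pattern_tiling[OF H U W \<phi>(3,4) t, of c Blue]
      no tred tblue unfolding freed_def by blast
  then obtain U' where U': "\<And>i. i < M \<Longrightarrow> U' i \<subseteq> U i \<and> q < card (U' i) + t" "freed H G c U' P"
    by blast
  have "U' i \<subseteq> U i \<and> q' \<le> card (U' i)" if "i < M" for i
    using U'(1)[OF that] q'q by (auto simp: t_def)
  from shrink_clusters[OF U this] obtain U'' where U'': "clusters M q' W U''"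
    "\<And>i. i < M \<Longrightarrow> U'' i \<subseteq> U' i" by blast
  have "freed H G c U'' P" by (rule freed_mono[OF U'(2) P U''(2)])
  moreover have "\<forall>i<M. U'' i \<subseteq> U i" using U''(2) U'(1) by blast
  ultimately show ?thesis using U''(1) q'1(1) by blast
qed

text \<open>Pairs once freed remain so in smaller clusters, and each pair costs one factor
  \<open>\<delta>\<close>. The number of pairs does not depend on \<open>n\<close>, so the clusters
  stay linear in size.\<close>

lemma free_all_patterns:
  assumes H: "fin_graph H" "verts H \<noteq> {}" and W: "W \<subseteq> verts G"
    and bf: "bowtie_free H G c b \<delta> W" and \<delta>: "0 < \<delta>" "\<delta> < 1"
    and Ps: "finite Ps" "Ps \<subseteq> bowtie_patterns H M b" and U: "clusters M q W U" and q: "1 \<le> q"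
  shows "\<exists>U' q'. clusters M q' W U' \<and> (\<forall>i<M. U' i \<subseteq> U i) \<and> \<delta> ^ card Ps * q \<le> real q' \<and>
    (\<forall>P\<in>Ps. freed H G c U' P)"
  using Ps
proof (induction Ps rule: finite_induct)
  case empty
  show ?case by (rule exI[of _ U], rule exI[of _ q]) (use U in simp)
next
  case (insert P Ps)
  then obtain U' q' where IH: "clusters M q' W U'" "\<forall>i<M. U' i \<subseteq> U i" "\<delta> ^ card Ps * q \<le> real q'"
    "\<forall>P\<in>Ps. freed H G c U' P" by auto
  have "0 < \<delta> ^ card Ps * q" using \<delta> q by simp
  then have "0 < real q'" using IH(3) by linarith
  then have q': "1 \<le> q'" by simp
  obtain U'' q'' where *: "clusters M q'' W U''" "\<forall>i<M. U'' i \<subseteq> U' i" "\<delta> * q' \<le> real q''"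
    "freed H G c U'' P"
    using free_one_pattern[OF H W bf \<delta> _ IH(1) q', of P] insert.prems by blast
  have "\<delta> ^ card (insert P Ps) * q = \<delta> * (\<delta> ^ card Ps * q)"
    using insert.hyps by simp
  also have "\<dots> \<le> \<delta> * q'" using IH(3) \<delta> by (intro mult_left_mono) auto
  also have "\<dots> \<le> q''" by (rule *(3))
  finally have "\<delta> ^ card (insert P Ps) * q \<le> q''" .
  moreover have "\<forall>Q\<in>insert P Ps. freed H G c U'' Q"
  proof
    fix Q assume "Q \<in> insert P Ps"
    then show "freed H G c U'' Q"
      using *(2,4) IH(4) insert.prems freed_mono[of H G c U' Q M b U''] by blast
  qed
  moreover have "\<forall>i<M. U'' i \<subseteq> U i" using *(2) IH(2) by blast
  ultimately show ?case using *(1) by blast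
qed

section \<open>Ramsey's theorem on the pairs of clusters\<close>

lemma ramsey_goodD:
  assumes good: "ramsey_good H M \<xi> n G" and G: "verts G = {..<n}"
    and U: "clusters M q {..<n} U" and q: "\<xi> * n \<le> real q"
  obtains \<kappa> :: "nat set \<Rightarrow> colour" where "\<And>col \<phi>. \<lbrakk>(col, \<phi>) \<in> patterns H M; \<forall>e\<in>edges H. \<kappa> (\<phi> ` e) = col\<rbrakk>
      \<Longrightarrow> \<exists>f. along H G c col \<phi> U f"
proof -
  \<comment> \<open>The default label \<open>M\<close> keeps vertices outside all clusters out of
    the classes below \<open>M\<close>, which are then exactly the sets \<open>U i\<close>.\<close>
  define h where "h = restrict (\<lambda>x. if \<exists>i<M. x \<in> U i then THE i. i < M \<and> x \<in> U i else M) {..<n}"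
  have the: "(THE i. i < M \<and> x \<in> U i) = i" if "i < M" "x \<in> U i" for x i
  proof (rule the_equality)
    show "j = i" if "j < M \<and> x \<in> U j" for j
    proof (rule ccontr)
      assume "j \<noteq> i"
      then have "U j \<inter> U i = {}" using U that \<open>i < M\<close> by (simp add: clusters_def)
      then show False using that \<open>x \<in> U i\<close> by blast
    qed
  qed (use that in blast)
  have Un: "U i \<subseteq> {..<n}" "card (U i) = q" if "i < M" for i using U that by (simp_all add: clusters_def)
  have hU: "{x\<in>{..<n}. h x = i} = U i" if i: "i < M" for i
  proof (intro equalityI subsetI)
    fix x assume x: "x \<in> U i"
    then have "h x = i" unfolding h_def using Un[OF i] the[OF i x] i by auto
    then show "x \<in> {x\<in>{..<n}. h x = i}" using x Un[OF i] by blast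
  next
    fix x assume x: "x \<in> {x\<in>{..<n}. h x = i}"
    then obtain j where j: "j < M" "x \<in> U j"
      using i unfolding h_def by (auto split: if_splits)
    then have "h x = j" unfolding h_def using x the[OF j] by auto
    then show "x \<in> U i" using j x by simp
  qed
  have "h \<in> {..<n} \<rightarrow>\<^sub>E {..M}"
  proof (rule PiE_I)
    fix x assume x: "x \<in> {..<n}"
    show "h x \<in> {..M}"
    proof (cases "\<exists>i<M. x \<in> U i")
      case True
      then obtain i where i: "i < M" "x \<in> U i" by blast
      then have "h x = i" unfolding h_def using x the[OF i] by auto
      then show ?thesis using i by simp
    next
      case False
      then have "h x = M" unfolding h_def using x by (simp only: restrict_apply' if_False)
      then show ?thesis by simp
    qed
  qed (simp add: h_def)
  moreover have "\<forall>i<M. card {x\<in>{..<n}. h x = i} = q" using hU Un(2) by simp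
  ultimately obtain \<kappa> :: "nat set \<Rightarrow> colour" where \<kappa>: "\<forall>t\<in>patterns H M.
      (\<forall>e\<in>edges H. \<kappa> (snd t ` e) = fst t) \<longrightarrow>
      (\<exists>f\<in>class_maps H n h (snd t). \<forall>e\<in>edges H. f ` e \<in> edges G \<and> c (f ` e) = fst t)"
    using good q unfolding ramsey_good_def by blast
  show thesis
  proof (rule that)
    fix col \<phi> assume *: "(col, \<phi>) \<in> patterns H M" "\<forall>e\<in>edges H. \<kappa> (\<phi> ` e) = col"
    obtain f where f: "f \<in> class_maps H n h \<phi>" "\<forall>e\<in>edges H. f ` e \<in> edges G \<and> c (f ` e) = col"
      using \<kappa>[rule_format, OF *(1)] *(2) by auto
    have "f u \<in> U (\<phi> u)" if u: "u \<in> verts H" for u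
    proof -
      have lt: "\<phi> u < M" using patternsD(1)[OF *(1)] u by auto
      have "f u \<in> {x\<in>{..<n}. h x = \<phi> u}" using f(1) u by (auto simp: class_maps_def)
      then show ?thesis unfolding hU[OF lt] .
    qed
    then show "\<exists>f. along H G c col \<phi> U f" using f(2) unfolding along_def by blast
  qed
qed

text \<open>The three colours of a pair \<open>x < y\<close> are those inside the first family of clusters, inside the
  second one, and from cluster \<open>x\<close> of the first to cluster \<open>y\<close> of the second.\<close>

lemma homogeneous_pairs:
  fixes \<kappa> :: "nat set \<Rightarrow> colour"
  assumes N: "partn_lst {..<N} (replicate 8 (2 * k)) 2" and k: "1 \<le> k"
  obtains e :: "nat \<Rightarrow> nat" and cA cB cC where
    "\<And>i. i < 2 * k \<Longrightarrow> e i < N" "\<And>i j. i < j \<Longrightarrow> j < 2 * k \<Longrightarrow> e i < e j"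
    "\<And>i j. \<lbrakk>i < j; j < 2 * k\<rbrakk> \<Longrightarrow>
       \<kappa> {e i, e j} = cA \<and> \<kappa> {N + e i, N + e j} = cB \<and> \<kappa> {e i, N + e j} = cC"
proof -
  \<comment> \<open>Three bits encode the three colours of a pair, which accounts for the 8 colours
    in \<open>N\<close>; \<open>Min\<close> and \<open>Max\<close> orient the pair.\<close>
  define g :: "nat set \<Rightarrow> nat" where "g s = 4 * of_bool (\<kappa> {Min s, Max s} = Red)
    + 2 * of_bool (\<kappa> {N + Min s, N + Max s} = Red) + of_bool (\<kappa> {Min s, N + Max s} = Red)" for s
  have "g \<in> nsets {..<N} 2 \<rightarrow> {..<length (replicate 8 (2 * k))}"
    by (auto simp: g_def of_bool_def)
  then obtain i where i: "i < 8" "monochromatic {..<N} (replicate 8 (2 * k) ! i) 2 g i"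
    using N unfolding partn_lst_def by auto
  then obtain S where S: "S \<in> nsets {..<N} (2 * k)" "g ` nsets S 2 \<subseteq> {i}"
    by (auto simp: monochromatic_def)
  have Sf: "finite S" "card S = 2 * k" "S \<subseteq> {..<N}" using S(1) by (auto simp: nsets_def)
  obtain e where e: "bij_betw e {..<card S} S" "strict_mono_on {..<card S} e"
    using ex_bij_betw_strict_mono_card[OF Sf(1)] by blast
  have eS: "e x \<in> S" if "x < 2 * k" for x using e(1) that Sf(2) by (auto simp: bij_betw_def)
  have mono: "e x < e y" if "x < y" "y < 2 * k" for x y
    using e(2) that Sf(2) by (auto simp: strict_mono_on_def)
  have g: "4 * of_bool (\<kappa> {e x, e y} = Red) + 2 * of_bool (\<kappa> {N + e x, N + e y} = Red)
      + of_bool (\<kappa> {e x, N + e y} = Red) = i" if "x < y" "y < 2 * k" for x y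
  proof -
    have "{e x, e y} \<in> nsets S 2" using eS[of x] eS[of y] mono[OF that] that by (auto simp: nsets_def)
    then have "g {e x, e y} = i" using S(2) by blast
    then show ?thesis using mono[OF that] by (simp add: g_def)
  qed
  have red: "c = c'" if "c = Red \<longleftrightarrow> c' = Red" for c c' using that by (cases c; cases c') auto
  have "\<kappa> {e x, e y} = \<kappa> {e 0, e 1} \<and> \<kappa> {N + e x, N + e y} = \<kappa> {N + e 0, N + e 1} \<and>
      \<kappa> {e x, N + e y} = \<kappa> {e 0, N + e 1}" if "x < y" "y < 2 * k" for x y
  proof -
    have "b1 = d1 \<and> b2 = d2 \<and> b3 = d3"
      if "4 * of_bool b1 + 2 * of_bool b2 + of_bool b3 = i"
        "4 * of_bool d1 + 2 * of_bool d2 + of_bool d3 = i" for b1 b2 b3 d1 d2 d3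
      using that by (cases b1; cases b2; cases b3; cases d1; cases d2; cases d3; simp)
    from this[OF g[OF that] g[of 0 1]] show ?thesis using k by (auto intro!: red)
  qed
  moreover have "e x < N" if "x < 2 * k" for x using eS[OF that] Sf(3) by auto
  ultimately show thesis using that mono by blast
qed

text \<open>\<open>noblue\<close> and \<open>nored\<close> force the first homogeneous set to be red
  and the second to be blue, since each has room for all of \<open>H\<close>. If the cross pairs are
  red, the red copy puts \<open>I\<close> into the second set and the rest into the first, sharing
  \<open>\<alpha>\<close> clusters with a blue copy inside the second set. Blue cross pairs are
  symmetric.\<close>

lemma exists_bowtie_pattern:
  fixes H :: "'a ugraph" and \<kappa> :: "nat set \<Rightarrow> colour"
  assumes H: "fin_graph H" and k: "card (verts H) = k" "1 \<le> k"
    and I: "I \<subseteq> verts H" "indep I (edges H)" "card I = \<alpha>"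
    and N: "partn_lst {..<N} (replicate 8 (2 * k)) 2"
    and noblue: "\<And>\<phi>. \<lbrakk>(Blue, \<phi>) \<in> patterns H (2 * N); \<phi> ` verts H \<subseteq> {..<N};
      \<forall>e\<in>edges H. \<kappa> (\<phi> ` e) = Blue\<rbrakk> \<Longrightarrow> False"
    and nored: "\<And>\<phi>. \<lbrakk>(Red, \<phi>) \<in> patterns H (2 * N); \<phi> ` verts H \<subseteq> {N..};
      \<forall>e\<in>edges H. \<kappa> (\<phi> ` e) = Red\<rbrakk> \<Longrightarrow> False"
  shows "\<exists>P\<in>bowtie_patterns H (2 * N) (2 * k - \<alpha>).
    (\<forall>e\<in>edges H. \<kappa> (fst P ` e) = Red) \<and> (\<forall>e\<in>edges H. \<kappa> (snd P ` e) = Blue)"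
proof -
  let ?V = "verts H"
  have finV: "finite ?V" using H by (simp add: fin_graph_def)
  obtain e :: "nat \<Rightarrow> nat" and cA cB cC where e: "\<And>i. i < 2 * k \<Longrightarrow> e i < N"
    "\<And>i j. i < j \<Longrightarrow> j < 2 * k \<Longrightarrow> e i < e j" and col:
    "\<And>i j. \<lbrakk>i < j; j < 2 * k\<rbrakk> \<Longrightarrow>
       \<kappa> {e i, e j} = cA \<and> \<kappa> {N + e i, N + e j} = cB \<and> \<kappa> {e i, N + e j} = cC"
    using homogeneous_pairs[OF N k(2), of \<kappa>] by blast
  obtain \<iota> where \<iota>: "bij_betw \<iota> ?V {0..<k}" using ex_bij_betw_finite_nat[OF finV] k(1) by blast
  have \<iota>k: "\<iota> u < k" if "u \<in> ?V" for u using \<iota> that by (auto simp: bij_betw_def)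
  have \<iota>ne: "\<iota> u \<noteq> \<iota> v" if "u \<in> ?V" "v \<in> ?V" "u \<noteq> v" for u v
    using \<iota> that by (auto simp: bij_betw_def inj_on_def)
  have ene: "e i \<noteq> e j" if "i < 2 * k" "j < 2 * k" "i \<noteq> j" for i j
    using e(2)[of i j] e(2)[of j i] that by (cases "i < j") auto
  \<comment> \<open>The first side takes the lower half of the \<open>2 * k\<close> indices and the
    second side the upper half, so every cross pair is increasing and has colour \<open>cC\<close>,
    even for the two images of one vertex.\<close>
  define a where "a u = e (\<iota> u)" for u
  define b where "b u = N + e (k + \<iota> u)" for u
  have aN: "a u < N" and bN: "N \<le> b u" "b u < 2 * N" if "u \<in> ?V" for u
    using e(1)[of "\<iota> u"] e(1)[of "k + \<iota> u"] \<iota>k[OF that] by (auto simp: a_def b_def)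
  have ane: "a u \<noteq> a v" and bne: "b u \<noteq> b v" if "u \<in> ?V" "v \<in> ?V" "u \<noteq> v" for u v
    using ene[of "\<iota> u" "\<iota> v"] ene[of "k + \<iota> u" "k + \<iota> v"] \<iota>k[OF that(1)] \<iota>k[OF that(2)] \<iota>ne[OF that]
    by (simp_all add: a_def b_def)
  have aa: "\<kappa> {a u, a v} = cA" if uv: "u \<in> ?V" "v \<in> ?V" "u \<noteq> v" for u v
  proof (cases "\<iota> u < \<iota> v")
    case True
    then show ?thesis using col[of "\<iota> u" "\<iota> v"] \<iota>k[OF uv(2)] by (simp add: a_def)
  next
    case False
    then have "\<iota> v < \<iota> u" using \<iota>ne[OF uv] by simp
    then show ?thesis using col[of "\<iota> v" "\<iota> u"] \<iota>k[OF uv(1)] by (simp add: a_def insert_commute)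
  qed
  have bb: "\<kappa> {b u, b v} = cB" if uv: "u \<in> ?V" "v \<in> ?V" "u \<noteq> v" for u v
  proof (cases "\<iota> u < \<iota> v")
    case True
    then show ?thesis using col[of "k + \<iota> u" "k + \<iota> v"] \<iota>k[OF uv(2)] by (simp add: b_def)
  next
    case False
    then have "\<iota> v < \<iota> u" using \<iota>ne[OF uv] by simp
    then show ?thesis using col[of "k + \<iota> v" "k + \<iota> u"] \<iota>k[OF uv(1)] by (simp add: b_def insert_commute)
  qed
  have ab: "\<kappa> {a u, b v} = cC" if uv: "u \<in> ?V" "v \<in> ?V" for u v
    using col[of "\<iota> u" "k + \<iota> v"] \<iota>k[OF uv(1)] \<iota>k[OF uv(2)] by (simp add: a_def b_def)
  have edge: "\<exists>u v. e = {u, v} \<and> u \<in> ?V \<and> v \<in> ?V \<and> u \<noteq> v" if "e \<in> edges H" for e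
    using H that by (auto simp: fin_graph_def nsets_def card_2_iff) blast
  \<comment> \<open>With \<open>J = {}\<close> the placement \<open>y\<close> is used throughout, so
    the maps within one side and the mixed maps are all of this form.\<close>
  define m where "m J x y = restrict (\<lambda>u. if u \<in> J then x u else y u) ?V"
    for J and x y :: "'a \<Rightarrow> nat"
  have pat: "(cl, m J x y) \<in> patterns H (2 * N)"
    if "x = a \<and> y = b \<or> x = b \<and> y = a" for cl J x y
  proof -
    have "m J x y \<in> ?V \<rightarrow>\<^sub>E {..<2 * N}"
      using that aN bN by (fastforce simp: m_def)
    moreover have "inj_on (m J x y) ?V"
    proof (rule inj_onI, rule ccontr)
      fix u v assume uv: "u \<in> ?V" "v \<in> ?V" "m J x y u = m J x y v" "u \<noteq> v"
      show False
        using that uv ane[OF uv(1,2,4)] bne[OF uv(1,2,4)] aN[OF uv(1)] aN[OF uv(2)] bN[OF uv(1)] bN[OF uv(2)]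
        by (auto simp: m_def split: if_splits)
    qed
    ultimately show ?thesis by (simp add: patterns_def)
  qed
  have A: "cA = Red"
  proof (rule ccontr)
    assume "cA \<noteq> Red"
    then have "cA = Blue" by (cases cA) auto
    show False
    proof (rule noblue)
      show "(Blue, m {} b a) \<in> patterns H (2 * N)" by (rule pat) simp
      show "m {} b a ` ?V \<subseteq> {..<N}" using aN by (auto simp: m_def)
      show "\<forall>e\<in>edges H. \<kappa> (m {} b a ` e) = Blue"
      proof
        fix e assume "e \<in> edges H"
        then obtain u v where "e = {u, v}" "u \<in> ?V" "v \<in> ?V" "u \<noteq> v" using edge by blast
        then show "\<kappa> (m {} b a ` e) = Blue" using aa \<open>cA = Blue\<close> by (simp add: m_def)
      qed
    qed
  qed
  have B: "cB = Blue"
  proof (rule ccontr)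
    assume "cB \<noteq> Blue"
    then have "cB = Red" by (cases cB) auto
    show False
    proof (rule nored)
      show "(Red, m {} a b) \<in> patterns H (2 * N)" by (rule pat) simp
      show "m {} a b ` ?V \<subseteq> {N..}" using bN by (auto simp: m_def)
      show "\<forall>e\<in>edges H. \<kappa> (m {} a b ` e) = Red"
      proof
        fix e assume "e \<in> edges H"
        then obtain u v where "e = {u, v}" "u \<in> ?V" "v \<in> ?V" "u \<noteq> v" using edge by blast
        then show "\<kappa> (m {} a b ` e) = Red" using bb \<open>cB = Red\<close> by (simp add: m_def)
      qed
    qed
  qed
  have \<alpha>: "card (?V - I) = k - \<alpha>" using I k(1) finV by (simp add: card_Diff_subset finite_subset)
  have \<alpha>k: "\<alpha> \<le> k" using I k(1) card_mono[OF finV] by blast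
  have size: "card (m J x y ` ?V \<union> m {} y x ` ?V) \<le> 2 * k - \<alpha>" if "J = I" for J and x y :: "'a \<Rightarrow> nat"
  proof -
    have "m J x y ` ?V \<union> m {} y x ` ?V \<subseteq> y ` (?V - I) \<union> x ` ?V"
      using that by (auto simp: m_def)
    then have "card (m J x y ` ?V \<union> m {} y x ` ?V) \<le> card (y ` (?V - I) \<union> x ` ?V)"
      by (rule card_mono[rotated]) (use finV in simp)
    also have "\<dots> \<le> card (y ` (?V - I)) + card (x ` ?V)" by (rule card_Un_le)
    also have "\<dots> \<le> (k - \<alpha>) + k"
      using card_image_le[of "?V - I" y] card_image_le[of ?V x] finV \<alpha> k(1) by simp
    finally show ?thesis using \<alpha>k by simp
  qed
  have notboth: "\<not> (u \<in> I \<and> v \<in> I)" if "{u, v} \<in> edges H" "u \<noteq> v" for u v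
    using I(2) that unfolding indep_def by blast
  show ?thesis
  proof (cases cC)
    case Red
    let ?P = "(m I b a, m {} a b)"
    have "\<forall>e\<in>edges H. \<kappa> (fst ?P ` e) = Red"
    proof
      fix e assume e: "e \<in> edges H"
      then obtain u v where uv: "e = {u, v}" "u \<in> ?V" "v \<in> ?V" "u \<noteq> v" using edge by blast
      have img: "m I b a ` e = {if u \<in> I then b u else a u, if v \<in> I then b v else a v}"
        using uv by (simp add: m_def)
      consider "u \<notin> I" "v \<notin> I" | "u \<in> I" "v \<notin> I" | "u \<notin> I" "v \<in> I"
        using notboth uv e by blast
      then have "\<kappa> (m I b a ` e) = Red"
      proof cases
        case 1
        then show ?thesis using img aa[OF uv(2-4)] A by simp
      next
        case 2
        then have "m I b a ` e = {b u, a v}" "m I b a ` e = {a v, b u}" using img by auto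
        then show ?thesis using ab[OF uv(3,2)] Red by simp
      next
        case 3
        then have "m I b a ` e = {a u, b v}" "m I b a ` e = {b v, a u}" using img by auto
        then show ?thesis using ab[OF uv(2,3)] Red by simp
      qed
      then show "\<kappa> (fst ?P ` e) = Red" by simp
    qed
    moreover have "\<forall>e\<in>edges H. \<kappa> (snd ?P ` e) = Blue"
    proof
      fix e assume "e \<in> edges H"
      then obtain u v where "e = {u, v}" "u \<in> ?V" "v \<in> ?V" "u \<noteq> v" using edge by blast
      then show "\<kappa> (snd ?P ` e) = Blue" using bb B by (simp add: m_def)
    qed
    moreover have "?P \<in> bowtie_patterns H (2 * N) (2 * k - \<alpha>)"
      using pat size[of I b a] by (simp add: bowtie_patterns_def)
    ultimately show ?thesis by blast
  next
    case Blue
    let ?P = "(m {} b a, m I a b)"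
    have "\<forall>e\<in>edges H. \<kappa> (fst ?P ` e) = Red"
    proof
      fix e assume "e \<in> edges H"
      then obtain u v where "e = {u, v}" "u \<in> ?V" "v \<in> ?V" "u \<noteq> v" using edge by blast
      then show "\<kappa> (fst ?P ` e) = Red" using aa A by (simp add: m_def)
    qed
    moreover have "\<forall>e\<in>edges H. \<kappa> (snd ?P ` e) = Blue"
    proof
      fix e assume e: "e \<in> edges H"
      then obtain u v where uv: "e = {u, v}" "u \<in> ?V" "v \<in> ?V" "u \<noteq> v" using edge by blast
      have img: "m I a b ` e = {if u \<in> I then a u else b u, if v \<in> I then a v else b v}"
        using uv by (simp add: m_def)
      consider "u \<notin> I" "v \<notin> I" | "u \<in> I" "v \<notin> I" | "u \<notin> I" "v \<in> I"
        using notboth uv e by blast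
      then have "\<kappa> (m I a b ` e) = Blue"
      proof cases
        case 1
        then show ?thesis using img bb[OF uv(2-4)] B by simp
      next
        case 2
        then have "m I a b ` e = {a u, b v}" "m I a b ` e = {b v, a u}" using img by auto
        then show ?thesis using ab[OF uv(2,3)] Blue by simp
      next
        case 3
        then have "m I a b ` e = {b u, a v}" "m I a b ` e = {a v, b u}" using img by auto
        then show ?thesis using ab[OF uv(3,2)] Blue by simp
      qed
      then show "\<kappa> (snd ?P ` e) = Blue" by simp
    qed
    moreover have "?P \<in> bowtie_patterns H (2 * N) (2 * k - \<alpha>)"
      using pat size[of I a b] by (simp add: bowtie_patterns_def Un_commute)
    ultimately show ?thesis by blast
  qed
qed

section \<open>Covering almost everything by a monochromatic tiling\<close>

lemma split_into_clusters:
  assumes "finite X" "N * q \<le> card X"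
  shows "\<exists>U. clusters N q X U"
  using assms
proof (induction N arbitrary: X)
  case 0
  show ?case by (simp add: clusters_def)
next
  case (Suc N)
  obtain Y where Y: "Y \<subseteq> X" "card Y = q"
    using obtain_subset_with_card_n[of q X] Suc.prems by auto
  have "card (X - Y) = card X - q" using Y Suc.prems finite_subset by (metis card_Diff_subset)
  then have "N * q \<le> card (X - Y)" using Suc.prems by simp
  then obtain U where U: "clusters N q (X - Y) U" using Suc.IH[of "X - Y"] Suc.prems by auto
  have "clusters (Suc N) q X (U(N := Y))"
    using U Y Suc.prems(1) finite_subset[OF Y(1)] unfolding clusters_def
    by (auto simp: less_Suc_eq)
  then show ?case by blast
qed

text \<open>\<open>\<xi>\<close> is the proportion of a cluster guaranteed after all bowtie patterns
  are freed: it starts at \<open>\<delta> / (4 * N)\<close> and loses a factor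
  \<open>\<delta>\<close> per pair. If both greedy tilings fell short,
  \<open>exists_bowtie_pattern\<close> would produce a pair that is realised although it has been
  freed.\<close>

lemma bowtie_free_imp_large_tiling:
  fixes H :: "'a ugraph" and n N k \<alpha> :: nat and \<delta> \<xi> :: real
  assumes H: "fin_graph H" and k: "card (verts H) = k" "1 \<le> k"
    and I: "I \<subseteq> verts H" "indep I (edges H)" "card I = \<alpha>"
    and N: "partn_lst {..<N} (replicate 8 (2 * k)) 2" and N0: "0 < N"
    and \<delta>: "0 < \<delta>" "\<delta> < 1" and G: "verts G = {..<n}" and good: "ramsey_good H (2 * N) \<xi> n G"
    and \<xi>: "\<xi> = \<delta> ^ card (bowtie_patterns H (2 * N) (2 * k - \<alpha>)) * (\<delta> / (4 * N))"
    and large: "4 * N \<le> \<delta> * n"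
    and W: "W \<subseteq> {..<n}" and bf: "bowtie_free H G c (2 * k - \<alpha>) \<delta> W"
  shows "\<exists>col m. tileable H G c col W m \<and> card W \<le> \<delta> * n + k * m"
proof (rule ccontr)
  assume no: "\<not> ?thesis"
  have Vne: "verts H \<noteq> {}" using k by auto
  have finW: "finite W" using W finite_subset by blast
  have left: "\<exists>W'\<subseteq>W. \<delta> * n < card W' \<and> \<not> (\<exists>f. coloured_embedding H G c col f \<and> f ` verts H \<subseteq> W')" for col
  proof -
    obtain m W' where W': "W' \<subseteq> W" "tileable H G c col (W - W') m" "card W = card W' + k * m"
      "\<not> (\<exists>f. coloured_embedding H G c col f \<and> f ` verts H \<subseteq> W')"
      using greedy_tiling[OF H Vne finW, of G c col] k(1) by blast
    have "tileable H G c col W m" by (rule tileable_mono[OF W'(2)]) auto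
    then have "\<not> card W \<le> \<delta> * n + k * m" using no by blast
    then have "\<delta> * n < card W'" using W'(3) by simp
    then show ?thesis using W'(1,4) by blast
  qed
  obtain WB where WB: "WB \<subseteq> W" "\<delta> * n < card WB"
    "\<not> (\<exists>f. coloured_embedding H G c Blue f \<and> f ` verts H \<subseteq> WB)" using left by blast
  obtain WR where WR: "WR \<subseteq> W" "\<delta> * n < card WR"
    "\<not> (\<exists>f. coloured_embedding H G c Red f \<and> f ` verts H \<subseteq> WR)" using left by blast
  \<comment> \<open>The \<open>N\<close> clusters inside \<open>WB\<close> use up only half of
    \<open>\<delta> * n\<close>, so \<open>WR\<close> has room for \<open>N\<close> more even if it
    overlaps \<open>WB\<close>. By \<open>large\<close>, rounding costs at most a factor 2.\<close>
  define q where "q = nat \<lfloor>\<delta> * n / (2 * N)\<rfloor>"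
  have "2 \<le> \<delta> * n / (2 * N)" using large N0 by (simp add: field_simps)
  then have q: "real q \<le> \<delta> * n / (2 * N)" "\<delta> * n / (2 * N) - 1 < real q"
    unfolding q_def by linarith+
  have "\<delta> * n / (4 * N) \<le> real q" using q(2) \<open>2 \<le> \<delta> * n / (2 * N)\<close> by simp
  have "1 < real q" using q(2) \<open>2 \<le> \<delta> * n / (2 * N)\<close> by linarith
  then have q1: "1 \<le> q" by simp
  have Nq: "real (N * q) \<le> \<delta> * n / 2" using q(1) N0 by (simp add: field_simps)
  have "real (N * q) \<le> real (card WB)" using Nq WB(2) large N0 by linarith
  then have "N * q \<le> card WB" by (simp only: of_nat_le_iff)
  from obtain_subset_with_card_n[OF this] obtain X where X: "X \<subseteq> WB" "card X = N * q" by auto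
  have finX: "finite X" by (rule finite_subset[OF subset_trans[OF X(1) WB(1)] finW])
  have finWR: "finite WR" using WR(1) finW by (rule finite_subset)
  have "card (WR \<inter> X) \<le> card X" by (rule card_mono[OF finX]) blast
  then have "card WR \<le> card (WR - X) + card X" using card_Int_Diff[OF finWR, of X] by linarith
  then have "real (card WR) \<le> real (card (WR - X)) + real (card X)" by linarith
  then have "real (N * q) \<le> real (card (WR - X))" using Nq WR(2) X(2) by linarith
  then have "N * q \<le> card (WR - X)" by (simp only: of_nat_le_iff)
  moreover have "finite (WR - X)" using finWR by simp
  ultimately obtain UY where UY: "clusters N q (WR - X) UY" using split_into_clusters by blast
  have "N * q \<le> card X" using X(2) by simp
  from split_into_clusters[OF finX this] obtain UX where UX: "clusters N q X UX" by blast
  define U where "U i = (if i < N then UX i else UY (i - N))" for i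
  have U1: "U i \<subseteq> X" if "i < N" for i using UX that by (simp add: U_def clusters_def)
  have U2: "U i \<subseteq> WR - X" if "N \<le> i" "i < 2 * N" for i
    using UY that by (simp add: U_def clusters_def)
  have U: "clusters (2 * N) q W U"
    unfolding clusters_def
  proof (intro conjI allI impI)
    fix i assume i: "i < 2 * N"
    show "U i \<subseteq> W" using U1[of i] U2[of i] i X(1) WB(1) WR(1) by (cases "i < N") auto
    show "finite (U i)" "card (U i) = q"
      using UX UY i by (auto simp: U_def clusters_def)
    fix j assume j: "j < 2 * N" "i \<noteq> j"
    consider "i < N" "j < N" | "N \<le> i" "N \<le> j" | "i < N" "N \<le> j" | "N \<le> i" "j < N" by linarith
    then show "U i \<inter> U j = {}"
    proof cases
      case 1
      then show ?thesis using UX j by (simp add: U_def clusters_def)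
    next
      case 2
      then show ?thesis using UY i j by (simp add: U_def clusters_def)
    next
      case 3
      then show ?thesis using U1[of i] U2[of j] j by blast
    next
      case 4
      then show ?thesis using U1[of j] U2[of i] i by blast
    qed
  qed
  have WG: "W \<subseteq> verts G" using W G by simp
  let ?Ps = "bowtie_patterns H (2 * N) (2 * k - \<alpha>)"
  obtain U' q' where U': "clusters (2 * N) q' W U'" "\<forall>i<2 * N. U' i \<subseteq> U i"
    "\<delta> ^ card ?Ps * q \<le> real q'" "\<forall>P\<in>?Ps. freed H G c U' P"
    using free_all_patterns[OF H Vne WG bf \<delta> finite_bowtie_patterns[OF H] order_refl U q1] by blast
  have U'n: "clusters (2 * N) q' {..<n} U'" using U'(1) W unfolding clusters_def by blast
  have "\<xi> * n = \<delta> ^ card ?Ps * (\<delta> * n / (4 * N))" by (simp add: \<xi>)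
  also have "\<dots> \<le> \<delta> ^ card ?Ps * q"
    using \<open>\<delta> * n / (4 * N) \<le> real q\<close> \<delta> by (intro mult_left_mono) auto
  also have "\<dots> \<le> q'" by (rule U'(3))
  finally have "\<xi> * n \<le> q'" .
  from ramsey_goodD[OF good G U'n this, of c] obtain \<kappa> :: "nat set \<Rightarrow> colour" where
    \<kappa>: "\<And>col \<phi>. \<lbrakk>(col, \<phi>) \<in> patterns H (2 * N); \<forall>e\<in>edges H. \<kappa> (\<phi> ` e) = col\<rbrakk>
      \<Longrightarrow> \<exists>f. along H G c col \<phi> U' f" by blast
  have emb: "\<exists>f. coloured_embedding H G c col f \<and> f ` verts H \<subseteq> Z"
    if pat: "(col, \<phi>) \<in> patterns H (2 * N)" "\<forall>e\<in>edges H. \<kappa> (\<phi> ` e) = col"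
      and Z: "\<And>u. u \<in> verts H \<Longrightarrow> U (\<phi> u) \<subseteq> Z" for col \<phi> Z
  proof -
    obtain f where f: "along H G c col \<phi> U' f" using \<kappa>[OF pat] by blast
    have \<phi>: "\<phi> ` verts H \<subseteq> {..<2 * N}" "inj_on \<phi> (verts H)"
      using patternsD[OF pat(1)] by simp_all
    have "coloured_embedding H G c col f"
      by (rule along_imp_embedding[OF f U'(1) WG \<phi>]) simp
    moreover have "f u \<in> Z" if u: "u \<in> verts H" for u
    proof -
      have "f u \<in> U' (\<phi> u)" using f u by (simp add: along_def)
      moreover have "\<phi> u < 2 * N" using \<phi>(1) u by auto
      ultimately show ?thesis using U'(2) Z[OF u] by blast
    qed
    ultimately show ?thesis by blast
  qed
  have noblue: False if "(Blue, \<phi>) \<in> patterns H (2 * N)" "\<phi> ` verts H \<subseteq> {..<N}"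
      "\<forall>e\<in>edges H. \<kappa> (\<phi> ` e) = Blue" for \<phi>
  proof -
    have "U (\<phi> u) \<subseteq> WB" if "u \<in> verts H" for u
      using U1[of "\<phi> u"] X(1) \<open>\<phi> ` verts H \<subseteq> {..<N}\<close> that by blast
    from emb[OF that(1,3) this] WB(3) show False by blast
  qed
  have nored: False if "(Red, \<phi>) \<in> patterns H (2 * N)" "\<phi> ` verts H \<subseteq> {N..}"
      "\<forall>e\<in>edges H. \<kappa> (\<phi> ` e) = Red" for \<phi>
  proof -
    have "U (\<phi> u) \<subseteq> WR" if u: "u \<in> verts H" for u
    proof -
      have "N \<le> \<phi> u" using \<open>\<phi> ` verts H \<subseteq> {N..}\<close> u by auto
      moreover have "\<phi> u < 2 * N" using patternsD(1)[OF \<open>(Red, \<phi>) \<in> patterns H (2 * N)\<close>] u by auto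
      ultimately show ?thesis using U2[of "\<phi> u"] by blast
    qed
    from emb[OF that(1,3) this] WR(3) show False by blast
  qed
  have "\<exists>P\<in>?Ps. (\<forall>e\<in>edges H. \<kappa> (fst P ` e) = Red) \<and> (\<forall>e\<in>edges H. \<kappa> (snd P ` e) = Blue)"
    by (rule exists_bowtie_pattern[OF H k I N]) (fact noblue, fact nored)
  then obtain P where P: "P \<in> ?Ps" "\<forall>e\<in>edges H. \<kappa> (fst P ` e) = Red"
    "\<forall>e\<in>edges H. \<kappa> (snd P ` e) = Blue" by blast
  have "(Red, fst P) \<in> patterns H (2 * N)" "(Blue, snd P) \<in> patterns H (2 * N)"
    using P(1) by (auto simp: bowtie_patterns_def)
  then have "\<exists>f. along H G c Red (fst P) U' f" "\<exists>f. along H G c Blue (snd P) U' f"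
    using \<kappa> P(2,3) by blast+
  moreover have "freed H G c U' P" using U'(4) P(1) by blast
  ultimately show False unfolding freed_def by blast
qed

text \<open>A largest bowtie set \<open>Z\<close> can be tiled in either colour, so whichever colour
  works on the rest \<open>W\<close> can be used on \<open>Z\<close> too. The density is nearly
  \<open>1 / b\<close> on \<open>Z\<close>, and nearly \<open>1 / k\<close>, which is no less, on
  \<open>W\<close>; each part loses at most \<open>\<delta> * n\<close> vertices.\<close>

lemma large_tiling:
  fixes H :: "'a ugraph" and n N k \<alpha> :: nat and \<delta> \<xi> :: real
  assumes H: "fin_graph H" and k: "card (verts H) = k" "1 \<le> k"
    and I: "I \<subseteq> verts H" "indep I (edges H)" "card I = \<alpha>"
    and N: "partn_lst {..<N} (replicate 8 (2 * k)) 2" and N0: "0 < N"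
    and \<delta>: "0 < \<delta>" "\<delta> < 1" and G: "verts G = {..<n}" and good: "ramsey_good H (2 * N) \<xi> n G"
    and \<xi>: "\<xi> = \<delta> ^ card (bowtie_patterns H (2 * N) (2 * k - \<alpha>)) * (\<delta> / (4 * N))"
    and large: "4 * N \<le> \<delta> * n"
  shows "\<exists>col m. tileable H G c col {..<n} m \<and> n / (2 * real k - real \<alpha>) - 2 * \<delta> * n \<le> m"
proof -
  define b where "b = 2 * k - \<alpha>"
  have Vne: "verts H \<noteq> {}" using k by auto
  have "\<alpha> \<le> k" using I k(1) H card_mono[of "verts H" I] by (auto simp: fin_graph_def)
  then have b: "k \<le> b" "real b = 2 * real k - real \<alpha>" by (simp_all add: b_def of_nat_diff)
  define bt where "bt Z \<longleftrightarrow> Z \<subseteq> {..<n} \<and> (\<exists>m. tileable H G c Red Z m \<and> tileable H G c Blue Z m \<and>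
      (1 - \<delta>) * card Z \<le> real (b * m))" for Z
  have "bt {}" unfolding bt_def using tileable_0[of H G c _ "{}"] by auto
  moreover have "\<forall>Z. bt Z \<longrightarrow> card Z < Suc n"
  proof (intro allI impI)
    fix Z assume "bt Z"
    then have "Z \<subseteq> {..<n}" by (simp add: bt_def)
    then show "card Z < Suc n" using card_mono[of "{..<n}" Z] by simp
  qed
  ultimately have "\<exists>Z. bt Z \<and> (\<forall>Z'. bt Z' \<longrightarrow> card Z' \<le> card Z)" by (rule ex_has_greatest_nat)
  then obtain Z where Z: "bt Z" "\<And>Z'. bt Z' \<Longrightarrow> card Z' \<le> card Z" by blast
  obtain mZ where mZ: "Z \<subseteq> {..<n}" "tileable H G c Red Z mZ" "tileable H G c Blue Z mZ"
    "(1 - \<delta>) * card Z \<le> real (b * mZ)" using Z(1) unfolding bt_def by blast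
  have finZ: "finite Z" by (rule finite_subset[OF mZ(1)]) simp
  define W where "W = {..<n} - Z"
  \<comment> \<open>A bowtie set inside \<open>W\<close> could be added to \<open>Z\<close>, against
    maximality.\<close>
  have "bowtie_free H G c b \<delta> W"
    unfolding bowtie_free_def
  proof (intro allI impI notI)
    fix Y assume Y: "Y \<subseteq> W" "Y \<noteq> {}"
    assume "\<exists>m. tileable H G c Red Y m \<and> tileable H G c Blue Y m \<and> (1 - \<delta>) * card Y \<le> real (b * m)"
    then obtain m where m: "tileable H G c Red Y m" "tileable H G c Blue Y m"
      "(1 - \<delta>) * card Y \<le> real (b * m)" by blast
    have disj: "Z \<inter> Y = {}" using Y by (auto simp: W_def)
    have finY: "finite Y" by (rule finite_subset[OF Y(1)]) (simp add: W_def)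
    have cZY: "card (Z \<union> Y) = card Z + card Y" using finZ finY disj by (rule card_Un_disjoint)
    have "(1 - \<delta>) * card (Z \<union> Y) \<le> real (b * (mZ + m))"
      using mZ(4) m(3) by (simp add: cZY algebra_simps)
    moreover have "Z \<union> Y \<subseteq> {..<n}" using mZ(1) Y by (auto simp: W_def)
    ultimately have "bt (Z \<union> Y)"
      unfolding bt_def using tileable_Un[OF Vne mZ(2) m(1) disj] tileable_Un[OF Vne mZ(3) m(2) disj]
      by blast
    then have "card Y = 0" using Z(2)[of "Z \<union> Y"] cZY by simp
    then show False using finY Y(2) by simp
  qed
  then have "\<exists>col m. tileable H G c col W m \<and> card W \<le> \<delta> * n + k * m"
    unfolding b_def
    by (intro bowtie_free_imp_large_tiling[OF H k I N N0 \<delta> G good \<xi> large]) (auto simp: W_def)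
  then obtain col m where m: "tileable H G c col W m" "card W \<le> \<delta> * n + k * m" by blast
  have "tileable H G c col Z mZ" using mZ(2,3) by (cases col) auto
  then have "tileable H G c col (Z \<union> W) (mZ + m)"
    by (rule tileable_Un[OF Vne _ m(1)]) (auto simp: W_def)
  then have "tileable H G c col {..<n} (mZ + m)" using mZ(1) by (simp add: W_def Un_absorb1)
  moreover have "n / real b - 2 * \<delta> * n \<le> real (mZ + m)"
  proof -
    have b0: "0 < real b" "1 \<le> real b" using b(1) k(2) by auto
    have n: "real n = real (card Z) + real (card W)"
      using mZ(1) finZ card_mono[OF _ mZ(1)] by (simp add: W_def card_Diff_subset of_nat_diff)
    have "real (card Z) - \<delta> * n \<le> (1 - \<delta>) * card Z"
      using \<delta> n by (simp add: algebra_simps)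
    also have "\<dots> \<le> b * mZ" using mZ(4) by simp
    finally have 1: "real (card Z) - \<delta> * n \<le> b * mZ" .
    have "real k * real m \<le> real b * real m" using b(1) by (intro mult_right_mono) auto
    then have 2: "real (card W) - \<delta> * n \<le> b * m" using m(2) by simp
    have "real n - 2 * \<delta> * n \<le> b * (real mZ + real m)" using 1 2 n by (simp add: algebra_simps)
    then have "(real n - 2 * \<delta> * n) / b \<le> real (mZ + m)"
      using b0 by (simp add: pos_divide_le_eq mult.commute)
    moreover have "2 * \<delta> * n / b \<le> 2 * \<delta> * n"
      using mult_left_mono[OF b0(2), of "2 * \<delta> * n"] b0(1) \<delta> by (simp add: pos_divide_le_eq)
    ultimately show ?thesis by (simp add: diff_divide_distrib)
  qed
  ultimately show ?thesis unfolding b(2) by blast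
qed

section \<open>From tilings to \<open>Rt\<close> and to the limit\<close>

lemma independence_numberE:
  assumes H: "fin_graph H"
  obtains I where "I \<subseteq> verts H" "indep I (edges H)" "card I = independence_number H"
proof -
  define R where "R = {card I | I. I \<subseteq> verts H \<and> indep I (edges H)}"
  have "finite (card ` Pow (verts H))" using H by (simp add: fin_graph_def)
  then have "finite R" unfolding R_def by (rule rev_finite_subset) blast
  moreover have "card {} \<in> R"
    unfolding R_def by (rule CollectI, rule exI[of _ "{}"]) (simp add: indep_def)
  ultimately have "Max R \<in> R" by (intro Max_in) auto
  moreover have "independence_number H = Max R" by (simp add: independence_number_def R_def)
  ultimately have "independence_number H \<in> R" by simp
  then obtain I where "independence_number H = card I" "I \<subseteq> verts H" "indep I (edges H)"
    unfolding R_def by blast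
  then show thesis using that by simp
qed

text \<open>A tiling is a set of subgraphs of the finite graph \<open>G\<close>, so the maximum in
  \<open>Rt\<close> runs over a finite set.\<close>

lemma le_Rt:
  fixes H :: "'a ugraph" and G :: "'b ugraph"
  assumes H: "verts H \<noteq> {}" and G: "fin_graph G"
    and tl: "\<And>c. \<exists>col. tileable H G c col (verts G) m"
  shows "m \<le> Rt H G"
proof -
  let ?S = "{m. \<forall>c. \<exists>T. mono_tiling H G c T \<and> card T = m}"
  have fin: "finite (Pow (verts G) \<times> Pow (edges G))"
    using G fin_graph_finite_edges[OF G] by (simp add: fin_graph_def)
  have "?S \<subseteq> {..card (Pow (verts G) \<times> Pow (edges G))}"
  proof
    fix l assume "l \<in> ?S"
    then obtain T where T: "is_tiling H G T" "card T = l" unfolding mono_tiling_def by blast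
    have "T \<subseteq> Pow (verts G) \<times> Pow (edges G)"
    proof
      fix F assume "F \<in> T"
      then have "subgraph F G" using is_tilingD(2)[OF T(1)] by (simp add: is_copy_def)
      then show "F \<in> Pow (verts G) \<times> Pow (edges G)" by (simp add: subgraph_def mem_Times_iff)
    qed
    then show "l \<in> {..card (Pow (verts G) \<times> Pow (edges G))}"
      using card_mono[OF fin] T(2) by auto
  qed
  then have "finite ?S" by (rule finite_subset) simp
  moreover have "m \<in> ?S"
  proof (rule CollectI, rule allI)
    fix c :: "'b set \<Rightarrow> colour"
    obtain col T where "is_tiling H G T" "card T = m" "\<forall>F\<in>T. \<forall>e\<in>edges F. c e = col"
      using tl[of c] unfolding tileable_def by blast
    then show "\<exists>T. mono_tiling H G c T \<and> card T = m" unfolding mono_tiling_def by blast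
  qed
  ultimately show ?thesis unfolding Rt_def by (rule Max_ge)
qed

text \<open>The size \<open>m\<close> may vary with the colouring, whereas \<open>Rt\<close> asks
  for one size that works for all; every tiling is thinned out to
  \<open>nat \<lceil>x\<rceil>\<close> copies.\<close>

lemma Rt_lower_bound:
  fixes H :: "'a ugraph" and G :: "'b ugraph" and x :: real
  assumes H: "verts H \<noteq> {}" and G: "fin_graph G" and tl: "\<And>c. \<exists>col m. tileable H G c col (verts G) m \<and> x \<le> real m"
  shows "x \<le> real (Rt H G)"
proof -
  have "nat \<lceil>x\<rceil> \<le> Rt H G"
  proof (rule le_Rt[OF H G])
    fix c :: "'b set \<Rightarrow> colour"
    obtain col m where m: "tileable H G c col (verts G) m" "x \<le> real m" using tl[of c] by blast
    have "nat \<lceil>x\<rceil> \<le> m" using m(2) by linarith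
    then show "\<exists>col. tileable H G c col (verts G) (nat \<lceil>x\<rceil>)"
      using tileable_mono[OF m(1) order_refl] by blast
  qed
  then show ?thesis by linarith
qed

theorem theorem1p6:
  fixes H :: "'a ugraph" and k \<alpha> :: nat and \<epsilon> :: real
  assumes "fin_graph H"
    and "card (verts H) = k"
    and "independence_number H = \<alpha>"
    and "\<epsilon> > 0"
  shows "\<exists>C>0. \<forall>p :: nat \<Rightarrow> real.
    (\<forall>n. 0 \<le> p n \<and> p n \<le> 1) \<longrightarrow>
    (\<forall>\<^sub>F n in sequentially. p n \<ge> C * real n powr (- (1 / max (m2 H) 1))) \<longrightarrow>
    (\<lambda>n. measure_pmf.prob (binomial_random_graph n (p n))
           {G. real (Rt H G) \<ge> real n / (2 * real k - real \<alpha>) - \<epsilon> * real n})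
      \<longlonglongrightarrow> 1"
proof -
  let ?good = "\<lambda>n. {G :: nat ugraph. real (Rt H G) \<ge> real n / (2 * real k - real \<alpha>) - \<epsilon> * real n}"
  obtain I where I: "I \<subseteq> verts H" "indep I (edges H)" "card I = \<alpha>"
    using independence_numberE[OF assms(1)] assms(3) by metis
  show ?thesis
  proof (cases "k = 0")
    \<comment> \<open>Then also \<open>\<alpha> = 0\<close>, and the quotient by 0 has the value 0,
      so the claimed lower bound is not positive.\<close>
    case True
    then have "\<alpha> = 0" using I assms(1,2) by (simp add: fin_graph_def)
    have "?good n = UNIV" for n
    proof -
      have "G \<in> ?good n" for G :: "nat ugraph"
      proof -
        have "0 \<le> \<epsilon> * real n" using assms(4) by simp
        then have "- (\<epsilon> * real n) \<le> real (Rt H G)"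
          using of_nat_0_le_iff[of "Rt H G"] by linarith
        then show ?thesis using True \<open>\<alpha> = 0\<close> by simp
      qed
      then show ?thesis by blast
    qed
    then show ?thesis by (intro exI[of _ 1]) simp
  next
    case False
    then have k: "1 \<le> k" by simp
    have Vne: "verts H \<noteq> {}" using assms(2) False by auto
    \<comment> \<open>\<open>large_tiling\<close> loses \<open>2 * \<delta> * n\<close>, hence the
      half of \<open>\<epsilon>\<close>; the other bound keeps \<open>\<delta>\<close> below
      1.\<close>
    define \<delta> where "\<delta> = min (\<epsilon> / 2) (1 / 2)"
    have \<delta>: "0 < \<delta>" "\<delta> < 1" "2 * \<delta> \<le> \<epsilon>" using assms(4) by (auto simp: \<delta>_def)
    obtain N' :: nat where "partn_lst {..<N'} (replicate 8 (2 * k)) 2" 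
      using ramsey_full[of "replicate 8 (2 * k)" 2] by blast
    then have N: "partn_lst {..<Suc N'} (replicate 8 (2 * k)) 2"
      by (rule partn_lst_greater_resource) simp
    define N where "N = Suc N'"
    note N = N[folded N_def]
    have N0: "0 < N" by (simp add: N_def)
    define \<xi> where "\<xi> = \<delta> ^ card (bowtie_patterns H (2 * N) (2 * k - \<alpha>)) * (\<delta> / (4 * N))"
    have \<xi>: "0 < \<xi>" using \<delta> N0 by (simp add: \<xi>_def)
    obtain C A where C: "0 < C" and bound: "\<forall>n\<ge>1. \<forall>p. 0 \<le> p \<longrightarrow> p \<le> 1 \<longrightarrow>
        C * real n powr (- (1 / max (m2 H) 1)) \<le> p \<longrightarrow>
      measure_pmf.prob (binomial_random_graph n p) {G. \<not> ramsey_good H (2 * N) \<xi> n G} \<le> A * exp (- real n)"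
      using prob_not_ramsey_good_le[OF assms(1) _ \<xi>, of "2 * N"] N0 by auto
    show ?thesis
    proof (rule exI[of _ C], intro conjI C allI impI)
      fix p :: "nat \<Rightarrow> real"
      assume p: "\<forall>n. 0 \<le> p n \<and> p n \<le> 1"
        and pC: "\<forall>\<^sub>F n in sequentially. p n \<ge> C * real n powr (- (1 / max (m2 H) 1))"
      let ?\<mu> = "\<lambda>n. measure_pmf.prob (binomial_random_graph n (p n))"
      have "\<forall>\<^sub>F n in sequentially. nat \<lceil>4 * N / \<delta>\<rceil> + 1 \<le> n" by (rule eventually_ge_at_top)
      then have ev: "\<forall>\<^sub>F n in sequentially. 1 - A * exp (- real n) \<le> ?\<mu> n (?good n)"
        using pC
      proof eventually_elim
        case (elim n)
        then have n1: "1 \<le> n" by simp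
        have "4 * N / \<delta> \<le> n" using elim(1) by linarith
        then have large: "4 * N \<le> \<delta> * n" using \<delta> by (simp add: field_simps)
        \<comment> \<open>The comparison of events is made on the support, where graphs are known to
          have the vertex set \<open>{..<n}\<close>.\<close>
        have "- ?good n \<inter> set_pmf (binomial_random_graph n (p n)) \<subseteq> {G. \<not> ramsey_good H (2 * N) \<xi> n G}"
        proof
          fix G assume G: "G \<in> - ?good n \<inter> set_pmf (binomial_random_graph n (p n))"
          then have vG: "verts G = {..<n}" and fG: "fin_graph G"
            by (auto simp: binomial_random_graph_def fin_graph_def)
          show "G \<in> {G. \<not> ramsey_good H (2 * N) \<xi> n G}"
          proof (rule CollectI, rule notI)
            assume good: "ramsey_good H (2 * N) \<xi> n G"
            have "real n / (2 * real k - real \<alpha>) - 2 * \<delta> * n \<le> real (Rt H G)"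
              by (rule Rt_lower_bound[OF Vne fG, unfolded vG])
                (rule large_tiling[OF assms(1,2) k I N N0 \<delta>(1,2) vG good \<xi>_def large])
            moreover have "2 * \<delta> * n \<le> \<epsilon> * n" using \<delta>(3) by (intro mult_right_mono) auto
            ultimately show False using G by simp
          qed
        qed
        then have "?\<mu> n (- ?good n \<inter> set_pmf (binomial_random_graph n (p n)))
            \<le> ?\<mu> n {G. \<not> ramsey_good H (2 * N) \<xi> n G}"
          by (rule measure_pmf.finite_measure_mono) simp
        also have "\<dots> \<le> A * exp (- real n)" using bound n1 p elim(2) by simp
        finally have "?\<mu> n (- ?good n) \<le> A * exp (- real n)" by (simp add: measure_Int_set_pmf)
        moreover have "?\<mu> n (- ?good n) = 1 - ?\<mu> n (?good n)"
          using measure_pmf.prob_compl[of "?good n" "binomial_random_graph n (p n)"]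
          by (simp add: Compl_eq_Diff_UNIV)
        ultimately show ?case by simp
      qed
      have "filterlim (\<lambda>n. - real n) at_bot sequentially"
        by (simp add: filterlim_uminus_at_bot filterlim_real_sequentially)
      then have "(\<lambda>n. exp (- real n)) \<longlonglongrightarrow> 0" by (rule filterlim_compose[OF exp_at_bot])
      then have "(\<lambda>n. 1 - A * exp (- real n)) \<longlonglongrightarrow> 1 - A * 0" by (intro tendsto_intros)
      then have lim: "(\<lambda>n. 1 - A * exp (- real n)) \<longlonglongrightarrow> 1" by simp
      show "(\<lambda>n. ?\<mu> n (?good n)) \<longlonglongrightarrow> 1"
        by (rule tendsto_sandwich[OF ev _ lim tendsto_const]) simp
    qed
  qed
qed

end
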